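(* Fix $\xi \in \mathbb{T}$ of Diophantine type. Then for Lebesgue-almost every $\alpha \in \mathbb{T}$ we have $$\limsup_{T \to \infty}\frac{-\log\bigl(k^{(1)}_{\xi}(T;\alpha)\bigr)}{\log\log T}=1$$ and $$\limsup_{T \to \infty}\frac{-\log\bigl(k^{(r)}_{\xi}(T;\alpha)\bigr)}{\log\log T}=\frac{1}{2}\quad\text{for all } r\geq 2.$$ Moreover, for almost every $\alpha \in \mathbb{T}$, $$\limsup_{T \to \infty} \frac{\log\bigl(k^{(1)}_\xi(T;\alpha)\bigr)}{\log\log T}=1.$$
   Context: $\mathbb{T}=\mathbb{R}/\mathbb{Z}$ with distance $d(x,y)=\min_{p\in\mathbb{Z}}|x-y+p|$. An element $\xi\in\mathbb{T}$ is of Diophantine type if there exist $M\ge 2$ and $c>0$ such that $|\xi-p/q|\ge c/q^M$ for all $p\in\mathbb{Z}$, $q\in\mathbb{N}$ (where $\xi$ is represented by a real number). For $\alpha,\xi\in\mathbb{T}$ with $\xi\ne 0$, $r\in\mathbb{N}=\{1,2,\dots\}$ and real $T\ge r$, let $d^{(r)}_\xi(T;\alpha)$ be the $r$-th minimum (the $r$-th smallest value, counted with multiplicity over $q$) among the numbers $d(q\alpha,\xi)$, $q$ an integer with $0\le q\le T$, and set $k^{(r)}_\xi(T;\alpha):=T\cdot d^{(r)}_\xi(T;\alpha)$. The limsup is over real $T\to\infty$. *)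

theory Defs
  imports "HOL-Analysis.Analysis"
begin

text \<open>
  Points of the circle \<open>\<real>/\<int>\<close> are represented by real numbers. Everything below depends only
  on the classes modulo 1 (see the invariance lemmas), and Lebesgue measure on the circle is
  Lebesgue measure on the fundamental domain \<open>[0,1)\<close>.
\<close>

definition circle_dist :: "real \<Rightarrow> real \<Rightarrow> real" where
  "circle_dist x y = (INF p::int. \<bar>x - y + of_int p\<bar>)"

text \<open>A real exponent \<open>M\<close> is allowed, hence \<open>powr\<close>.\<close>

definition diophantine_type :: "real \<Rightarrow> bool" where
  "diophantine_type \<xi> \<longleftrightarrow>
    (\<exists>M\<ge>2. \<exists>c>0. \<forall>p::int. \<forall>q::nat. q \<ge> 1 \<longrightarrow>
       \<bar>\<xi> - of_int p / of_nat q\<bar> \<ge> c / (of_nat q) powr M)"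

text \<open>
  The \<open>r\<close>-th smallest entry, with multiplicity, is the entry at position \<open>r - 1\<close> of the sorted
  list. Meaningful for \<open>r \<ge> 1\<close> and \<open>T \<ge> r\<close>; other arguments give junk values.
\<close>

definition rth_min :: "nat \<Rightarrow> real \<Rightarrow> real \<Rightarrow> real \<Rightarrow> real" where
  "rth_min r \<xi> T \<alpha> =
     sort (map (\<lambda>q::int. circle_dist (of_int q * \<alpha>) \<xi>) [0..\<lfloor>T\<rfloor>]) ! (r - 1)"

definition rth_min_scaled :: "nat \<Rightarrow> real \<Rightarrow> real \<Rightarrow> real \<Rightarrow> real" where
  "rth_min_scaled r \<xi> T \<alpha> = T * rth_min r \<xi> T \<alpha>"

lemma circle_dist_attained: "\<exists>p::int. circle_dist x y = \<bar>x - y + of_int p\<bar>"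
proof -
  define z where "z = x - y"
  define p where "p = - round z"
  have "\<bar>z + of_int p\<bar> \<le> \<bar>z + of_int k\<bar>" for k :: int
    using round_diff_minimal[of z "- k"] by (simp add: p_def)
  then have "(INF k::int. \<bar>z + of_int k\<bar>) = \<bar>z + of_int p\<bar>"
    by (intro cInf_eq_minimum) auto
  then show ?thesis unfolding circle_dist_def z_def by blast
qed

lemma circle_dist_shift:
  "circle_dist (x + of_int m) (y + of_int n) = circle_dist x y"
proof -
  have "range (\<lambda>p::int. \<bar>x + of_int m - (y + of_int n) + of_int p\<bar>)
      = (\<lambda>p::int. \<bar>x - y + of_int p\<bar>) ` range (\<lambda>p. p + (m - n))"
    unfolding image_image by (simp add: algebra_simps)
  also have "range (\<lambda>p. p + (m - n)) = (UNIV :: int set)"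
    using surj_plus_right by blast
  finally show ?thesis unfolding circle_dist_def by simp
qed

lemma rth_min_shift:
  "rth_min r (\<xi> + of_int n) T (\<alpha> + of_int m) = rth_min r \<xi> T \<alpha>"
proof -
  have "circle_dist (of_int q * (\<alpha> + of_int m)) (\<xi> + of_int n) = circle_dist (of_int q * \<alpha>) \<xi>"
    for q :: int
    using circle_dist_shift[of "of_int q * \<alpha>" "q * m" \<xi> n] by (simp add: algebra_simps)
  then show ?thesis unfolding rth_min_def by presburger
qed

lemma diophantine_type_shift_imp:
  assumes "diophantine_type \<xi>" shows "diophantine_type (\<xi> + of_int n)"
proof -
  obtain M c where M: "M \<ge> 2" "c > 0" and
    H: "\<And>(p::int) q::nat. q \<ge> 1 \<Longrightarrow> \<bar>\<xi> - of_int p / of_nat q\<bar> \<ge> c / (of_nat q) powr M"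
    using assms unfolding diophantine_type_def by blast
  have "\<bar>\<xi> + of_int n - of_int p / of_nat q\<bar> \<ge> c / (of_nat q) powr M" if "q \<ge> 1"
    for p :: int and q :: nat
  proof -
    have "\<xi> + of_int n - of_int p / of_nat q = \<xi> - of_int (p - n * int q) / of_nat q"
      using that by (simp add: field_simps)
    then show ?thesis using H[OF that, of "p - n * int q"] by presburger
  qed
  then show ?thesis using M unfolding diophantine_type_def by blast
qed

lemma diophantine_type_shift: "diophantine_type (\<xi> + of_int n) \<longleftrightarrow> diophantine_type \<xi>"
  using diophantine_type_shift_imp[of \<xi> n] diophantine_type_shift_imp[of "\<xi> + of_int n" "- n"]
  by auto

text \<open>In particular \<open>\<xi> \<noteq> 0\<close> on the circle.\<close>

lemma diophantine_type_irrational: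
  assumes "diophantine_type \<xi>" shows "\<xi> \<notin> \<rat>"
proof
  assume "\<xi> \<in> \<rat>"
  then obtain p :: int and q where q: "q > 0" "\<xi> = of_int p / of_int q"
    by (elim Rats_cases') blast
  from assms obtain M c where "c > 0" and
    H: "\<And>(p::int) q::nat. q \<ge> 1 \<Longrightarrow> \<bar>\<xi> - of_int p / of_nat q\<bar> \<ge> c / (of_nat q) powr M"
    unfolding diophantine_type_def by blast
  have "c / (of_nat (nat q)) powr M \<le> \<bar>\<xi> - of_int p / of_nat (nat q)\<bar>"
    by (rule H) (use q in linarith)
  then have "c / (of_int q) powr M \<le> 0" using q by simp
  moreover have "c / (of_int q) powr M > 0" using q \<open>c > 0\<close> by simp
  ultimately show False by linarith
qed

end

theory Submission
  imports Defs "HOL-Probability.Probability" "HOL-Real_Asymp.Real_Asymp"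
begin

text \<open>
  The points \<open>q \<alpha> - \<xi>\<close> with \<open>0 \<le> q \<le> T\<close> form a piece of a shifted planar lattice, and
  \<open>T d\<close> is the area of a box that is being tested for such points. At one scale, a box of small
  area \<open>k\<close> contains a point with probability about \<open>k\<close>. It contains several points with
  probability about \<open>k\<^sup>2\<close>: the lattice must have a short vector, and one of the widely spaced lines
  parallel to that vector must meet the box. A box of large area \<open>K\<close> is empty with probability about
  \<open>1 / K\<close>, again because of a short vector. There are about \<open>n = log T\<close> nearly independent dyadic
  scales, so the extreme values to expect are \<open>n powr (- 1)\<close>, \<open>n powr (- 1 / 2)\<close> and \<open>n\<close>. The proof
  makes this heuristic precise up to arbitrarily small powers of \<open>n\<close>, which is all that the exponents
  see.

  The bounds that hold eventually come from the Borel-Cantelli lemma: \<open>AE_no_close_multiple\<close> for one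
  close point, \<open>AE_no_close_pair\<close> for two, and Dirichlet's theorem together with
  \<open>AE_no_close_multiple\<close> for large gaps (\<open>AE_large_first_min_exponent_le\<close>). Pairs need the measure of
  the set where both \<open>q \<alpha>\<close> and \<open>q' \<alpha>\<close> are close to \<open>\<xi>\<close>. It is the product of the two measures up
  to a term governed by \<open>gcd q q'\<close> (\<open>hits_overlap_le\<close>), and that term is absent unless a certain
  multiple of \<open>\<xi>\<close> is nearly an integer (\<open>hits_overlap_empty\<close>). Because \<open>\<xi>\<close> is of Diophantine type,
  its multiples are equidistributed with a power saving (\<open>discrepancy\<close>), so this happens rarely.

  The bounds that hold infinitely often are divergence statements. For one close point, the overlap
  estimate makes the variance of the number of hits comparable with its mean, and the second moment
  method gives infinitely many hits for almost every \<open>\<alpha>\<close> (\<open>khinchin_inhomogeneous\<close>). The other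
  two cases look at \<open>\<alpha>\<close> near a reduced fraction \<open>p / v\<close>: the orbit then follows the multiples of
  \<open>1 / v\<close>, and everything depends on \<open>v \<xi>\<close> modulo 1. If \<open>v \<xi>\<close> is nearly an integer, some \<open>q \<alpha>\<close> with
  \<open>q < v\<close> is close to \<open>\<xi>\<close>, and so are the points of \<open>q + v\<close>, \<open>q + 2 v\<close> and so on (\<open>rth_min_near_rational\<close>). If \<open>v \<xi>\<close> is near
  \<open>1 / 2\<close>, the orbit misses \<open>\<xi>\<close> for a time much longer than \<open>v\<close>
  (\<open>first_min_ge_near_rational\<close>). Hence both follow from a Khinchin theorem for denominators \<open>v\<close>
  with \<open>v \<xi>\<close> in a prescribed arc (\<open>khinchin_bohr\<close>). There the neighbourhoods of reduced fractions
  are quasi-independent (\<open>reduced_hits_overlap_le\<close>), a sieve shows that enough numerators are coprime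
  to the denominator (\<open>bohr_window_coprime_pairs\<close>), the second moment method gives positive measure,
  and a zero-one law for the doubling map (\<open>doubling_zero_one\<close>) turns this into full measure.
\<close>

section \<open>Distance to the nearest integer\<close>

text \<open>This is the norm of the circle: \<open>circle_dist x y = nd (x - y)\<close>.\<close>

definition nd :: "real \<Rightarrow> real" where
  "nd x = \<bar>x - of_int (round x)\<bar>"

lemma nd_le: "nd x \<le> \<bar>x - of_int p\<bar>"
  unfolding nd_def using round_diff_minimal[of x p] .

lemma nd_attained: obtains p :: int where "nd x = \<bar>x - of_int p\<bar>"
  unfolding nd_def by blast

lemma nd_nonneg [simp]: "0 \<le> nd x"
  by (simp add: nd_def)

lemma nd_le_half: "nd x \<le> 1 / 2"
  unfolding nd_def using of_int_round_abs_le[of x] by (simp add: abs_minus_commute)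

lemma nd_less_iff: "nd x < r \<longleftrightarrow> (\<exists>p::int. \<bar>x - of_int p\<bar> < r)"
  by (metis nd_attained nd_le order_le_less_trans)

lemma nd_le_abs: "nd x \<le> \<bar>x\<bar>"
  using nd_le[of x 0] by simp

lemma nd_add_int [simp]: "nd (x + of_int p) = nd x"
proof -
  have "x + of_int p + 1 / 2 = x + 1 / 2 + of_int p" by simp
  then have "round (x + of_int p) = round x + p" unfolding round_def by (metis floor_add_int)
  then show ?thesis by (simp add: nd_def)
qed

lemma nd_minus [simp]: "nd (- x) = nd x"
proof -
  have le: "nd (- y) \<le> nd y" for y
  proof -
    obtain p :: int where "nd y = \<bar>y - of_int p\<bar>" by (rule nd_attained)
    with nd_le[of "- y" "- p"] show ?thesis by simp
  qed
  from le[of x] le[of "- x"] show ?thesis by simp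
qed

lemma nd_minus_commute: "nd (x - y) = nd (y - x)"
  using nd_minus[of "x - y"] by simp

lemma nd_triangle: "nd (x + y) \<le> nd x + nd y"
proof -
  obtain p q :: int where "nd x = \<bar>x - of_int p\<bar>" "nd y = \<bar>y - of_int q\<bar>"
    by (metis nd_attained)
  with nd_le[of "x + y" "p + q"] show ?thesis by simp
qed

lemma nd_diff_le: "nd x \<le> nd (x - y) + \<bar>y\<bar>"
  using nd_triangle[of "x - y" y] nd_le_abs[of y] by simp

lemma nd_int_mult_le: "nd (of_int k * x) \<le> \<bar>of_int k\<bar> * nd x"
proof -
  obtain p :: int where p: "nd x = \<bar>x - of_int p\<bar>" by (rule nd_attained)
  have "nd (of_int k * x) \<le> \<bar>of_int k * x - of_int (k * p)\<bar>" by (rule nd_le)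
  also have "\<dots> = \<bar>of_int k\<bar> * nd x"
    unfolding p by (simp add: abs_mult flip: right_diff_distrib)
  finally show ?thesis .
qed

lemma nd_measurable [measurable]: "nd \<in> borel_measurable borel"
  unfolding nd_def round_def by measurable

lemma nd_pos_iff: "0 < nd x \<longleftrightarrow> x \<notin> \<int>"
proof -
  have "nd x = 0 \<longleftrightarrow> x \<in> \<int>"
    unfolding nd_def by (auto simp: Ints_def)
  with nd_nonneg[of x] show ?thesis by linarith
qed

lemma circle_dist_nd: "circle_dist x y = nd (x - y)"
proof -
  obtain p :: int where "circle_dist x y = \<bar>x - y + of_int p\<bar>" using circle_dist_attained by blast
  then have "nd (x - y) \<le> circle_dist x y"
    using nd_le[of "x - y" "- p"] by simp
  moreover have "circle_dist x y \<le> nd (x - y)"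
  proof -
    obtain q :: int where "nd (x - y) = \<bar>x - y - of_int q\<bar>" by (rule nd_attained)
    moreover have "circle_dist x y \<le> \<bar>x - y + of_int (- q)\<bar>"
      unfolding circle_dist_def by (intro cINF_lower bdd_belowI[of _ 0]) auto
    ultimately show ?thesis by simp
  qed
  ultimately show ?thesis by simp
qed

section \<open>Order statistics of a finite list\<close>

text \<open>The entries that are at most \<open>d\<close> form an initial segment of a sorted list.\<close>

lemma sorted_nth_le_iff_card:
  fixes xs :: "'a::linorder list"
  assumes "sorted xs" "i < length xs"
  shows "xs ! i \<le> d \<longleftrightarrow> i < card {j. j < length xs \<and> xs ! j \<le> d}"
proof
  assume "xs ! i \<le> d"
  then have "{..i} \<subseteq> {j. j < length xs \<and> xs ! j \<le> d}"
    using assms by (auto intro: order_trans[OF sorted_nth_mono])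
  then have "card {..i} \<le> card {j. j < length xs \<and> xs ! j \<le> d}"
    by (intro card_mono) auto
  then show "i < card {j. j < length xs \<and> xs ! j \<le> d}" by simp
next
  assume *: "i < card {j. j < length xs \<and> xs ! j \<le> d}"
  show "xs ! i \<le> d"
  proof (rule ccontr)
    assume "\<not> xs ! i \<le> d"
    then have "{j. j < length xs \<and> xs ! j \<le> d} \<subseteq> {..<i}"
      using sorted_nth_mono[OF assms(1)] by (force simp: not_le not_less)
    then have "card {j. j < length xs \<and> xs ! j \<le> d} \<le> card {..<i}"
      by (intro card_mono) auto
    with * show False by simp
  qed
qed

lemma finite_bounded_ints: "finite {q::int. 0 \<le> q \<and> q \<le> n \<and> P q}"
  by (rule finite_subset[of _ "{0..n}"]) auto

text \<open>Replacing the order statistic by a number of close multiples gives the form in which the metric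
  estimates apply.\<close>

lemma rth_min_le_iff:
  assumes "1 \<le> r" "real r \<le> T + 1"
  shows "rth_min r \<xi> T \<alpha> \<le> d \<longleftrightarrow>
    r \<le> card {q::int. 0 \<le> q \<and> q \<le> \<lfloor>T\<rfloor> \<and> nd (of_int q * \<alpha> - \<xi>) \<le> d}"
proof -
  define f where "f = (\<lambda>q::int. circle_dist (of_int q * \<alpha>) \<xi>)"
  define xs where "xs = sort (map f [0..\<lfloor>T\<rfloor>])"
  have len: "length xs = nat (\<lfloor>T\<rfloor> + 1)" by (simp add: xs_def)
  have "card {j. j < length xs \<and> xs ! j \<le> d} = length (filter (\<lambda>x. x \<le> d) xs)"
    by (simp add: length_filter_conv_card)
  also have "\<dots> = size (filter_mset (\<lambda>x. x \<le> d) (mset (map f [0..\<lfloor>T\<rfloor>])))"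
    by (metis mset_filter mset_sort size_mset xs_def)
  also have "\<dots> = length (filter (\<lambda>q. f q \<le> d) [0..\<lfloor>T\<rfloor>])"
    by (simp only: mset_filter[symmetric] size_mset filter_map length_map comp_def)
  also have "\<dots> = card {q. 0 \<le> q \<and> q \<le> \<lfloor>T\<rfloor> \<and> f q \<le> d}"
    by (subst distinct_card[symmetric]) (auto intro!: arg_cong[of _ _ card])
  finally have card: "card {j. j < length xs \<and> xs ! j \<le> d} = \<dots>" .
  have "int r \<le> \<lfloor>T\<rfloor> + 1" using assms by linarith
  then have "r - 1 < length xs" using assms unfolding len by linarith
  then have "rth_min r \<xi> T \<alpha> \<le> d \<longleftrightarrow> r - 1 < card {j. j < length xs \<and> xs ! j \<le> d}"
    unfolding rth_min_def
    using sorted_nth_le_iff_card[of xs "r - 1" d] by (simp add: xs_def f_def)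
  then show ?thesis using assms unfolding card f_def circle_dist_nd by auto
qed

lemma rth_min_ge_if_few_close:
  assumes "1 \<le> r" "real r \<le> T + 1"
    and "card {q::int. 0 \<le> q \<and> q \<le> \<lfloor>T\<rfloor> \<and> nd (of_int q * \<alpha> - \<xi>) < d} < r"
  shows "d \<le> rth_min r \<xi> T \<alpha>"
proof (rule ccontr)
  assume lt: "\<not> ?thesis"
  then have "r \<le> card {q::int. 0 \<le> q \<and> q \<le> \<lfloor>T\<rfloor> \<and> nd (of_int q * \<alpha> - \<xi>) \<le> rth_min r \<xi> T \<alpha>}"
    using rth_min_le_iff[OF assms(1,2), of \<xi> \<alpha> "rth_min r \<xi> T \<alpha>"] by simp
  also have "\<dots> \<le> card {q::int. 0 \<le> q \<and> q \<le> \<lfloor>T\<rfloor> \<and> nd (of_int q * \<alpha> - \<xi>) < d}"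
    using lt by (intro card_mono finite_bounded_ints) auto
  finally show False using assms(3) by simp
qed

lemma first_min_le:
  assumes "0 \<le> q" "of_int q \<le> T" "nd (of_int q * \<alpha> - \<xi>) \<le> d"
  shows "rth_min 1 \<xi> T \<alpha> \<le> d"
proof -
  have "card {q} \<le> card {q::int. 0 \<le> q \<and> q \<le> \<lfloor>T\<rfloor> \<and> nd (of_int q * \<alpha> - \<xi>) \<le> d}"
    using assms by (intro card_mono finite_bounded_ints) (auto simp: le_floor_iff)
  moreover have "real 1 \<le> T + 1" using assms by auto
  ultimately show ?thesis using rth_min_le_iff[of 1 T \<xi> \<alpha> d] by auto
qed

lemma first_min_ge:
  assumes "0 \<le> T" "\<And>q::int. 0 \<le> q \<Longrightarrow> of_int q \<le> T \<Longrightarrow> d \<le> nd (of_int q * \<alpha> - \<xi>)"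
  shows "d \<le> rth_min 1 \<xi> T \<alpha>"
proof (rule rth_min_ge_if_few_close)
  have "{q::int. 0 \<le> q \<and> q \<le> \<lfloor>T\<rfloor> \<and> nd (of_int q * \<alpha> - \<xi>) < d} = {}"
    using assms(2) by (force simp: le_floor_iff)
  then show "card {q::int. 0 \<le> q \<and> q \<le> \<lfloor>T\<rfloor> \<and> nd (of_int q * \<alpha> - \<xi>) < d} < 1" by (metis card.empty zero_less_one)
qed (use assms in auto)

text \<open>An exact hit would make the logarithm of the scaled minimum \<open>ln 0 = 0\<close>, so lower bounds for the
  exponents need this.\<close>

lemma rth_min_pos:
  assumes "1 \<le> r" "real r \<le> T + 1" "\<And>q::int. of_int q * \<alpha> - \<xi> \<notin> \<int>"
  shows "0 < rth_min r \<xi> T \<alpha>"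
proof (rule ccontr)
  assume "\<not> ?thesis"
  then have "r \<le> card {q::int. 0 \<le> q \<and> q \<le> \<lfloor>T\<rfloor> \<and> nd (of_int q * \<alpha> - \<xi>) \<le> 0}"
    using rth_min_le_iff[OF assms(1,2)] by (simp add: not_less)
  also have "{q::int. 0 \<le> q \<and> q \<le> \<lfloor>T\<rfloor> \<and> nd (of_int q * \<alpha> - \<xi>) \<le> 0} = {}"
    using assms(3) nd_pos_iff by (force simp: not_le)
  finally show False using assms(1) by simp
qed

section \<open>Lebesgue measure on the circle\<close>

definition periodic :: "real set \<Rightarrow> bool" where
  "periodic S \<longleftrightarrow> (\<forall>x. x + 1 \<in> S \<longleftrightarrow> x \<in> S)"

text \<open>The normalized measure of the circle, as a measure on the whole line that is concentrated on the
  fundamental domain. It is applied to 1-periodic sets, so that translates and preimages under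
  multiplication need no reduction modulo 1.\<close>

definition circ :: "real measure" where
  "circ = density lborel (indicator {0..<1})"

lemma sets_circ [simp, measurable_cong]: "sets circ = sets borel"
  and space_circ [simp]: "space circ = UNIV"
  by (simp_all add: circ_def)

lemma emeasure_circ: "S \<in> sets borel \<Longrightarrow> emeasure circ S = emeasure lborel (S \<inter> {0..<1})"
  unfolding circ_def
  by (subst emeasure_density) (auto simp: nn_integral_indicator[symmetric] indicator_inter_arith[symmetric] Int_commute simp del: nn_integral_indicator)

lemma measure_circ: "S \<in> sets borel \<Longrightarrow> measure circ S = measure lborel (S \<inter> {0..<1})"
  by (simp add: measure_def emeasure_circ)

interpretation circ: prob_space circ
  by (rule prob_spaceI) (simp add: emeasure_circ)

lemma AE_circ: "(AE x in circ. P x) \<longleftrightarrow> (AE x in lborel. 0 \<le> x \<and> x < 1 \<longrightarrow> P x)"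
  unfolding circ_def by (subst AE_density) (auto simp: indicator_def)

lemma periodicI: "(\<And>x. x + 1 \<in> S \<longleftrightarrow> x \<in> S) \<Longrightarrow> periodic S"
  by (simp add: periodic_def)

lemma periodic_add_nat: "periodic S \<Longrightarrow> x + of_nat k \<in> S \<longleftrightarrow> x \<in> S"
proof (induction k)
  case (Suc k)
  have "x + of_nat (Suc k) \<in> S \<longleftrightarrow> x + of_nat k + 1 \<in> S" by (simp add: algebra_simps)
  also have "\<dots> \<longleftrightarrow> x + of_nat k \<in> S" using Suc.prems by (simp only: periodic_def)
  finally show ?case using Suc by simp
qed simp

lemma periodic_add_int: "periodic S \<Longrightarrow> x + of_int k \<in> S \<longleftrightarrow> x \<in> S"
  using periodic_add_nat[of S x "nat k"] periodic_add_nat[of S "x + of_int k" "nat (- k)"]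
  by (cases "0 \<le> k") auto


lemma AE_lebesgue_on_of_circ:
  assumes "AE x in circ. P x"
  shows "AE x in lebesgue_on {0..<1::real}. P x"
proof -
  have "AE x in lebesgue. 0 \<le> x \<and> x < 1 \<longrightarrow> P x"
    using assms unfolding AE_circ by (rule AE_completion)
  then show ?thesis
    by (subst AE_restrict_space_iff) auto
qed

lemma measure_lborel_translate:
  fixes S :: "real set"
  assumes "S \<in> sets borel"
  shows "measure lborel ((\<lambda>x. x + t) -` S) = measure lborel S"
proof -
  have eq: "(+) t = (\<lambda>x. x + t)" by (auto simp: add.commute)
  have "measure lborel S = measure (distr lborel borel (\<lambda>x. x + t)) S"
    using lborel_distr_plus[of t] by (simp add: eq)
  also have "\<dots> = measure lborel ((\<lambda>x. x + t) -` S)"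
    using assms by (subst measure_distr) auto
  finally show ?thesis by simp
qed

lemma measure_lborel_stretch:
  fixes S :: "real set"
  assumes "S \<in> sets borel" "0 < c"
  shows "measure lborel ((\<lambda>x. c * x) -` S) = measure lborel S / c"
proof -
  have "emeasure lborel ((\<lambda>x. c * x) -` S) = emeasure (distr lborel borel ((*) c)) S"
    using assms by (subst emeasure_distr) auto
  also have "\<dots> = ennreal (inverse c) * emeasure lborel S"
    using assms by (simp add: lborel_distr_mult emeasure_density_const)
  finally show ?thesis
    using assms by (simp add: measure_def enn2real_mult field_simps)
qed

lemma fmeasurable_Int_Ico [simp]:
  "S \<in> sets borel \<Longrightarrow> S \<inter> {a..<b::real} \<in> fmeasurable lborel"
proof (rule fmeasurableI2)
  show "{a..<b} \<in> fmeasurable lborel" by (cases "a \<le> b") (auto intro!: fmeasurableI)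
qed auto

lemma measure_Int_Ico_split:
  assumes "S \<in> sets borel" "a \<le> b" "b \<le> (c::real)"
  shows "measure lborel (S \<inter> {a..<c}) = measure lborel (S \<inter> {a..<b}) + measure lborel (S \<inter> {b..<c})"
proof -
  have "S \<inter> {a..<c} = (S \<inter> {a..<b}) \<union> (S \<inter> {b..<c})" using assms by auto
  then show ?thesis
    using assms by (simp only:) (rule measure_Un_AE[OF _ fmeasurable_Int_Ico fmeasurable_Int_Ico], auto)
qed

lemma measure_periodic_Ico_add_int:
  assumes "periodic S" "S \<in> sets borel"
  shows "measure lborel (S \<inter> {a + of_int k..<b + of_int k}) = measure lborel (S \<inter> {a..<b})"
proof -
  have "(\<lambda>x. x + of_int k) -` (S \<inter> {a + of_int k..<b + of_int k}) = S \<inter> {a..<b}"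
    using periodic_add_int[OF assms(1)] by auto
  then show ?thesis
    using measure_lborel_translate[of "S \<inter> {a + of_int k..<b + of_int k}" "of_int k"] assms by simp
qed

text \<open>Cutting the window at its integer point and translating one of the two pieces by 1 yields the
  fundamental domain.\<close>

lemma measure_periodic_unit_window:
  assumes "periodic S" "S \<in> sets borel"
  shows "measure lborel (S \<inter> {t..<t + 1}) = measure circ S"
proof -
  define u where "u = frac t"
  have u: "0 \<le> u" "u < 1" "t = u + of_int \<lfloor>t\<rfloor>" using frac_lt_1[of t] by (auto simp: u_def frac_def)
  have "measure lborel (S \<inter> {t..<t + 1}) = measure lborel (S \<inter> {u..<u + 1})"
    using measure_periodic_Ico_add_int[OF assms, of u "\<lfloor>t\<rfloor>" "u + 1"] u(3) by (simp add: algebra_simps)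
  also have "\<dots> = measure lborel (S \<inter> {u..<1}) + measure lborel (S \<inter> {1..<u + 1})"
    using u assms by (intro measure_Int_Ico_split) auto
  also have "measure lborel (S \<inter> {1..<u + 1}) = measure lborel (S \<inter> {0..<u})"
    using measure_periodic_Ico_add_int[OF assms, of 0 1 u] by simp
  also have "measure lborel (S \<inter> {u..<1}) + measure lborel (S \<inter> {0..<u}) = measure lborel (S \<inter> {0..<1})"
    using measure_Int_Ico_split[OF assms(2), of 0 u 1] u by simp
  finally show ?thesis using assms by (simp add: measure_circ)
qed

lemma measure_circ_shift:
  assumes "periodic S" "S \<in> sets borel"
  shows "measure circ ((\<lambda>x. x + t) -` S) = measure circ S"
proof -
  have "measure circ ((\<lambda>x. x + t) -` S) = measure lborel ((\<lambda>x. x + t) -` S \<inter> {0..<1})"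
    using assms measurable_sets[of "\<lambda>x. x + t" borel borel S] by (subst measure_circ) auto
  also have "(\<lambda>x. x + t) -` S \<inter> {0..<1} = (\<lambda>x. x + t) -` (S \<inter> {t..<t + 1})"
    by auto
  also have "measure lborel \<dots> = measure lborel (S \<inter> {t..<t + 1})"
    using assms by (intro measure_lborel_translate) auto
  finally show ?thesis using measure_periodic_unit_window[OF assms] by simp
qed

lemma measure_periodic_long_window:
  assumes "periodic S" "S \<in> sets borel"
  shows "measure lborel (S \<inter> {t..<t + real n}) = real n * measure circ S"
proof (induction n)
  case (Suc n)
  have "measure lborel (S \<inter> {t..<t + real (Suc n)})
      = measure lborel (S \<inter> {t..<t + real n}) + measure lborel (S \<inter> {t + real n..<t + real n + 1})"
    using measure_Int_Ico_split[OF assms(2), of t "t + real n" "t + real n + 1"]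
    by (simp add: algebra_simps)
  also have "measure lborel (S \<inter> {t + real n..<t + real n + 1}) = measure circ S"
    by (rule measure_periodic_unit_window[OF assms])
  finally show ?case using Suc by (simp add: algebra_simps)
qed simp

text \<open>Multiplication by \<open>q\<close> winds the circle \<open>q\<close> times around itself.\<close>

lemma measure_circ_stretch:
  assumes "periodic S" "S \<in> sets borel" "0 < q"
  shows "measure circ ((\<lambda>x. real q * x) -` S) = measure circ S"
proof -
  have "measure circ ((\<lambda>x. real q * x) -` S) = measure lborel ((\<lambda>x. real q * x) -` S \<inter> {0..<1})"
    using assms measurable_sets[of "\<lambda>x. real q * x" borel borel S] by (subst measure_circ) auto
  also have "(\<lambda>x. real q * x) -` S \<inter> {0..<1} = (\<lambda>x. real q * x) -` (S \<inter> {0..<0 + real q})"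
    using assms(3) by (auto simp: mult_less_cancel_left1 zero_le_mult_iff)
  also have "measure lborel \<dots> = measure circ S"
    using assms measure_periodic_long_window[OF assms(1,2), of 0 q]
    by (subst measure_lborel_stretch) auto
  finally show ?thesis .
qed

definition circle_arc :: "real \<Rightarrow> real \<Rightarrow> real set" where
  "circle_arc y \<rho> = {x. nd (x - y) < \<rho>}"

lemma periodic_circle_arc [simp]: "periodic (circle_arc y \<rho>)"
proof (rule periodicI)
  fix x
  have "nd (x + 1 - y) = nd (x - y)"
    using nd_add_int[of "x - y" 1] by (simp add: algebra_simps)
  then show "x + 1 \<in> circle_arc y \<rho> \<longleftrightarrow> x \<in> circle_arc y \<rho>" by (simp add: circle_arc_def)
qed

lemma circle_arc_borel [measurable]: "circle_arc y \<rho> \<in> sets borel"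
  unfolding circle_arc_def by measurable

lemma measure_arc:
  assumes "0 \<le> \<rho>" "\<rho> \<le> 1 / 2"
  shows "measure circ (circle_arc y \<rho>) = 2 * \<rho>"
proof -
  have "circle_arc y \<rho> \<inter> {y - 1/2..<y - 1/2 + 1} = {y - \<rho><..<y + \<rho>}"
  proof (intro set_eqI iffI)
    fix x assume x: "x \<in> circle_arc y \<rho> \<inter> {y - 1/2..<y - 1/2 + 1}"
    then obtain p :: int where p: "\<bar>x - y - of_int p\<bar> < \<rho>" by (auto simp: circle_arc_def nd_less_iff)
    have "- 1 < real_of_int p" "real_of_int p < 1" using p x assms by auto
    then have "p = 0" by linarith
    then show "x \<in> {y - \<rho><..<y + \<rho>}" using p by auto
  next
    fix x assume "x \<in> {y - \<rho><..<y + \<rho>}"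
    then show "x \<in> circle_arc y \<rho> \<inter> {y - 1/2..<y - 1/2 + 1}"
      using assms nd_le_abs[of "x - y"] by (auto simp: circle_arc_def abs_if split: if_splits)
  qed
  then show ?thesis
    using measure_periodic_unit_window[of "circle_arc y \<rho>" "y - 1/2"] assms by simp
qed

lemma measure_arc_le: "0 \<le> \<rho> \<Longrightarrow> measure circ (circle_arc y \<rho>) \<le> 2 * \<rho>"
  using measure_arc[of \<rho> y] circ.prob_le_1[of "circle_arc y \<rho>"] by (cases "\<rho> \<le> 1/2") linarith+

definition hits :: "real \<Rightarrow> nat \<Rightarrow> real \<Rightarrow> real set" where
  "hits \<xi> q \<rho> = {\<alpha>. nd (real q * \<alpha> - \<xi>) < \<rho>}"

lemma hits_vimage: "hits \<xi> q \<rho> = (\<lambda>x. real q * x) -` circle_arc \<xi> \<rho>"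
  by (auto simp: hits_def circle_arc_def)

lemma hits_borel [measurable]: "hits \<xi> q \<rho> \<in> sets borel"
  unfolding hits_def by measurable

lemma hits_shift: "x + real i / real q \<in> hits \<xi> q \<rho> \<longleftrightarrow> x \<in> hits \<xi> q \<rho>"
proof (cases "q = 0")
  case False
  have "real q * (x + real i / real q) - \<xi> = real q * x - \<xi> + of_int (int i)"
    using False by (simp add: field_simps)
  then show ?thesis unfolding hits_def mem_Collect_eq by (metis nd_add_int)
qed (simp add: hits_def)

lemma periodic_hits [simp]: "periodic (hits \<xi> q \<rho>)"
  using hits_shift[of _ q q \<xi> \<rho>] by (intro periodicI) (cases "q = 0"; simp add: hits_def)

lemma measure_hits:
  assumes "0 < q" "0 \<le> \<rho>" "\<rho> \<le> 1 / 2"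
  shows "measure circ (hits \<xi> q \<rho>) = 2 * \<rho>"
  unfolding hits_vimage using assms by (simp add: measure_circ_stretch measure_arc)

lemma measure_hits_le: "0 < q \<Longrightarrow> 0 \<le> \<rho> \<Longrightarrow> measure circ (hits \<xi> q \<rho>) \<le> 2 * \<rho>"
  unfolding hits_vimage by (simp add: measure_circ_stretch measure_arc_le)

section \<open>Equidistribution of rotations\<close>

lemma finite_int_block [simp]: "finite {n::int. a \<le> n \<and> n < b \<and> P n}"
  by (rule finite_subset[of _ "{a..<b}"]) auto

lemma card_ints_between:
  fixes a b :: real
  assumes "a \<le> b"
  shows "real (card {j::int. a < j \<and> j < b}) \<le> b - a + 1"
    and "b - a - 1 \<le> real (card {j::int. a < j \<and> j < b})"
proof -
  have "{j::int. a < j \<and> j < b} = {\<lfloor>a\<rfloor> + 1..\<lceil>b\<rceil> - 1}"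
    by (auto simp: floor_less_iff less_ceiling_iff) linarith+
  then have card: "card {j::int. a < j \<and> j < b} = nat (\<lceil>b\<rceil> - 1 - \<lfloor>a\<rfloor>)" by simp
  show "real (card {j::int. a < j \<and> j < b}) \<le> b - a + 1"
    "b - a - 1 \<le> real (card {j::int. a < j \<and> j < b})"
    unfolding card using assms by linarith+
qed

text \<open>The numerators are the residues modulo \<open>s\<close> of the integers in a real interval of length
  \<open>2 * \<rho> * s\<close>. For \<open>\<rho> \<le> 1 / 2\<close> that interval is too short to meet a residue class twice, hence the
  lower bound.\<close>

lemma card_fractions_in_arc:
  fixes s :: int
  assumes "0 < s" "0 \<le> \<rho>"
  shows "real (card {j \<in> {0..<s}. nd (of_int j / of_int s - y) < \<rho>}) \<le> 2 * \<rho> * of_int s + 1"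
    and "\<rho> \<le> 1 / 2 \<Longrightarrow> 2 * \<rho> * of_int s - 1 \<le> real (card {j \<in> {0..<s}. nd (of_int j / of_int s - y) < \<rho>})"
proof -
  define A where "A = {j \<in> {0..<s}. nd (of_int j / of_int s - y) < \<rho>}"
  define B where "B = {k::int. of_int s * (y - \<rho>) < k \<and> k < of_int s * (y + \<rho>)}"
  have near: "nd (of_int j / of_int s - y) < \<rho> \<longleftrightarrow> (\<exists>p. j - s * p \<in> B)" for j
  proof -
    have "\<bar>of_int j / of_int s - y - of_int p\<bar> < \<rho> \<longleftrightarrow> j - s * p \<in> B" for p
      using assms(1) unfolding B_def abs_less_iff by (simp add: field_simps) linarith
    then show ?thesis by (simp add: nd_less_iff)
  qed
  have A_eq: "A = (\<lambda>k. k mod s) ` B"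
  proof (intro set_eqI iffI)
    fix j assume "j \<in> A"
    then obtain p where p: "j - s * p \<in> B" "0 \<le> j" "j < s" using near by (auto simp: A_def)
    then have "j = (j - s * p) mod s" by (simp add: mod_diff_eq[symmetric])
    then show "j \<in> (\<lambda>k. k mod s) ` B" using p by blast
  next
    fix j assume "j \<in> (\<lambda>k. k mod s) ` B"
    then obtain k where k: "k \<in> B" "j = k mod s" by blast
    then have "j - s * (- (k div s)) \<in> B" by (simp add: algebra_simps)
    then have "nd (of_int j / of_int s - y) < \<rho>" using near by blast
    then show "j \<in> A" using k assms(1) by (simp add: A_def)
  qed
  have "B \<subseteq> {\<lfloor>of_int s * (y - \<rho>)\<rfloor>..\<lceil>of_int s * (y + \<rho>)\<rceil>}"
    by (auto simp: B_def) linarith+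
  then have "finite B" by (rule finite_subset) simp
  have le: "of_int s * (y - \<rho>) \<le> of_int s * (y + \<rho>)" using assms by simp
  have len: "of_int s * (y + \<rho>) - of_int s * (y - \<rho>) = 2 * \<rho> * of_int s" by (simp add: algebra_simps)
  have "card A \<le> card B" unfolding A_eq using \<open>finite B\<close> by (rule card_image_le)
  then show "real (card {j \<in> {0..<s}. nd (of_int j / of_int s - y) < \<rho>}) \<le> 2 * \<rho> * of_int s + 1"
    using card_ints_between(1)[OF le] len unfolding A_def[symmetric] B_def by linarith
  assume "\<rho> \<le> 1 / 2"
  have "inj_on (\<lambda>k. k mod s) B"
  proof (rule inj_onI)
    fix k k' assume k: "k \<in> B" "k' \<in> B" "k mod s = k' mod s"
    have "2 * \<rho> * of_int s \<le> 1 * of_int s"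
      using \<open>\<rho> \<le> 1 / 2\<close> assms(1) by (intro mult_right_mono) auto
    then have "\<bar>real_of_int (k - k')\<bar> < of_int s" using k(1,2) len by (auto simp: B_def)
    then have "\<bar>k - k'\<bar> < s" by linarith
    moreover have "s dvd k - k'" using k(3) by (simp add: mod_eq_dvd_iff)
    ultimately show "k = k'" using zdvd_not_zless[of "\<bar>k - k'\<bar>" s] by force
  qed
  then have "card A = card B" unfolding A_eq by (rule card_image)
  then show "2 * \<rho> * of_int s - 1 \<le> real (card {j \<in> {0..<s}. nd (of_int j / of_int s - y) < \<rho>})"
    using card_ints_between(2)[OF le] len unfolding A_def[symmetric] B_def by linarith
qed

lemma nd_mod: "nd (of_int (m mod s) / of_int s - y) = nd (of_int m / of_int s - y)"
proof (cases "s = 0")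
  case False
  have "real_of_int m = of_int (m mod s) + of_int s * of_int (m div s)"
    by (metis mod_mult_div_eq of_int_add of_int_mult)
  then have "of_int m / of_int s - y = of_int (m mod s) / of_int s - y + of_int (m div s)"
    using False by (simp add: field_simps)
  then show ?thesis by (metis nd_add_int)
qed simp

text \<open>Multiplication by a unit modulo \<open>s\<close> permutes the residues, so a full block of multiples of a
  reduced fraction \<open>t / s\<close> visits every multiple of \<open>1 / s\<close> exactly once.\<close>

lemma card_block_rational:
  fixes s t k :: int
  assumes "0 < s" "coprime t s"
  shows "card {i \<in> {k..<k + s}. P (nd (of_int i * (of_int t / of_int s) - y))}
       = card {j \<in> {0..<s}. P (nd (of_int j / of_int s - y))}"
proof -
  define f where "f = (\<lambda>i. (i * t) mod s)"
  have inj: "inj_on f {k..<k + s}"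
  proof (rule inj_onI)
    fix i i' assume i: "i \<in> {k..<k + s}" "i' \<in> {k..<k + s}" "f i = f i'"
    then have "s dvd (i - i') * t" by (simp add: f_def mod_eq_dvd_iff left_diff_distrib)
    then have "s dvd i - i'" using assms(2) by (simp add: coprime_dvd_mult_left_iff coprime_commute)
    moreover have "\<bar>i - i'\<bar> < s" using i by auto
    ultimately show "i = i'" using zdvd_not_zless[of "\<bar>i - i'\<bar>" s] by force
  qed
  have surj: "f ` {k..<k + s} = {0..<s}"
    using assms(1) inj by (intro card_subset_eq) (auto simp: f_def card_image)
  have eq: "nd (of_int i * (of_int t / of_int s) - y) = nd (of_int (f i) / of_int s - y)" for i
    unfolding f_def nd_mod by simp
  have "{j \<in> {0..<s}. P (nd (of_int j / of_int s - y))}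
      = f ` {i \<in> {k..<k + s}. P (nd (of_int i * (of_int t / of_int s) - y))}"
    unfolding eq surj[symmetric] by blast
  moreover have "inj_on f {i \<in> {k..<k + s}. P (nd (of_int i * (of_int t / of_int s) - y))}"
    by (rule inj_on_subset[OF inj]) auto
  ultimately show ?thesis by (simp add: card_image)
qed

lemma card_shift_block:
  "card {n \<in> {k..<k + L}. P n} = card {i \<in> {0..<L::int}. P (k + i)}"
proof -
  have "{n \<in> {k..<k + L}. P n} = (\<lambda>i. k + i) ` {i \<in> {0..<L}. P (k + i)}"
  proof (intro set_eqI iffI)
    fix n assume "n \<in> {n \<in> {k..<k + L}. P n}"
    then show "n \<in> (\<lambda>i. k + i) ` {i \<in> {0..<L}. P (k + i)}"
      by (intro image_eqI[of _ _ "n - k"]) auto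
  qed auto
  then show ?thesis by (simp add: card_image)
qed

text \<open>Within a block of length \<open>s\<close> the rotation by \<open>\<theta>\<close> drifts away from the rotation by \<open>t / s\<close> by at
  most \<open>1 / s\<close>. Widening or narrowing the arc by this amount costs 2 in the count.\<close>

lemma card_block_perturbed:
  fixes s t k :: int and N :: nat
  assumes s: "0 < s" "s \<le> int N" "coprime t s" "\<bar>of_int s * \<theta> - of_int t\<bar> < 1 / N" and \<rho>: "0 \<le> \<rho>"
  shows "real (card {n \<in> {k..<k + s}. nd (of_int n * \<theta> - y) < \<rho>}) \<le> 2 * \<rho> * of_int s + 3"
    and "\<rho> \<le> 1 / 2 \<Longrightarrow> 2 * \<rho> * of_int s - 3 \<le> real (card {n \<in> {k..<k + s}. nd (of_int n * \<theta> - y) < \<rho>})"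
proof -
  define y' where "y' = y - of_int k * \<theta>"
  define R where "R = (\<lambda>r. {i \<in> {0..<s}. nd (of_int i * (of_int t / of_int s) - y') < r})"
  have shift: "card {n \<in> {k..<k + s}. nd (of_int n * \<theta> - y) < \<rho>}
      = card {i \<in> {0..<s}. nd (of_int i * \<theta> - y') < \<rho>}"
    unfolding card_shift_block y'_def by (simp add: algebra_simps)
  have close: "\<bar>of_int i * \<theta> - of_int i * (of_int t / of_int s)\<bar> \<le> 1 / of_int s" if "i \<in> {0..<s}" for i
  proof -
    have "of_int i * \<theta> - of_int i * (of_int t / of_int s) = of_int i / of_int s * (of_int s * \<theta> - of_int t)"
      using s(1) by (simp add: field_simps)
    then have "\<bar>of_int i * \<theta> - of_int i * (of_int t / of_int s)\<bar> = of_int i / of_int s * \<bar>of_int s * \<theta> - of_int t\<bar>"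
      using that s(1) by (simp add: abs_mult)
    also have "\<dots> \<le> 1 * (1 / N)" using that s by (intro mult_mono) auto
    also have "\<dots> \<le> 1 / of_int s" using s by (simp add: frac_le)
    finally show ?thesis .
  qed
  have finQ: "finite {i \<in> {0..<s}. nd (of_int i * \<theta> - y') < \<rho>}"
    by (rule finite_subset[of _ "{0..<s}"]) auto
  have finR: "finite (R r)" for r
    unfolding R_def by (rule finite_subset[of _ "{0..<s}"]) auto
  have card_R: "card (R r) = card {j \<in> {0..<s}. nd (of_int j / of_int s - y') < r}" for r
    unfolding R_def using card_block_rational[OF s(1,3), of 0 "\<lambda>z. z < r" y'] by simp
  have "{i \<in> {0..<s}. nd (of_int i * \<theta> - y') < \<rho>} \<subseteq> R (\<rho> + 1 / of_int s)"
  proof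
    fix i assume i: "i \<in> {i \<in> {0..<s}. nd (of_int i * \<theta> - y') < \<rho>}"
    then show "i \<in> R (\<rho> + 1 / of_int s)"
      using close[of i] nd_diff_le[of "of_int i * (of_int t / of_int s) - y'" "of_int i * (of_int t / of_int s) - of_int i * \<theta>"]
      by (auto simp: R_def)
  qed
  then have "card {i \<in> {0..<s}. nd (of_int i * \<theta> - y') < \<rho>} \<le> card (R (\<rho> + 1 / of_int s))"
    by (intro card_mono finR)
  moreover have "real (card (R (\<rho> + 1 / of_int s))) \<le> 2 * (\<rho> + 1 / of_int s) * of_int s + 1"
    unfolding card_R using s \<rho> by (intro card_fractions_in_arc) auto
  moreover have "2 * (\<rho> + 1 / of_int s) * of_int s + 1 = 2 * \<rho> * of_int s + 3"
    using s(1) by (simp add: field_simps)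
  ultimately show "real (card {n \<in> {k..<k + s}. nd (of_int n * \<theta> - y) < \<rho>}) \<le> 2 * \<rho> * of_int s + 3"
    unfolding shift by linarith
  assume half: "\<rho> \<le> 1 / 2"
  show "2 * \<rho> * of_int s - 3 \<le> real (card {n \<in> {k..<k + s}. nd (of_int n * \<theta> - y) < \<rho>})"
  proof (cases "\<rho> \<ge> 1 / of_int s")
    case True
    have "R (\<rho> - 1 / of_int s) \<subseteq> {i \<in> {0..<s}. nd (of_int i * \<theta> - y') < \<rho>}"
    proof
      fix i assume i: "i \<in> R (\<rho> - 1 / of_int s)"
      then show "i \<in> {i \<in> {0..<s}. nd (of_int i * \<theta> - y') < \<rho>}"
        using close[of i] nd_diff_le[of "of_int i * \<theta> - y'" "of_int i * \<theta> - of_int i * (of_int t / of_int s)"]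
        by (auto simp: R_def)
    qed
    then have "card (R (\<rho> - 1 / of_int s)) \<le> card {i \<in> {0..<s}. nd (of_int i * \<theta> - y') < \<rho>}"
      by (intro card_mono finQ)
    moreover have "2 * (\<rho> - 1 / of_int s) * of_int s - 1 \<le> real (card (R (\<rho> - 1 / of_int s)))"
    proof -
      have "0 \<le> 1 / real_of_int s" using s(1) by simp
      with half have "\<rho> - 1 / of_int s \<le> 1 / 2" by linarith
      then show ?thesis unfolding card_R using s True by (intro card_fractions_in_arc(2)) auto
    qed
    moreover have "2 * (\<rho> - 1 / of_int s) * of_int s - 1 = 2 * \<rho> * of_int s - 3"
      using s(1) by (simp add: field_simps)
    ultimately show ?thesis unfolding shift by linarith
  next
    case False
    then have "\<rho> * of_int s < 1" using s(1) by (simp add: field_simps)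
    then have "2 * \<rho> * of_int s - 3 \<le> 0" by linarith
    also have "0 \<le> real (card {n \<in> {k..<k + s}. nd (of_int n * \<theta> - y) < \<rho>})" by simp
    finally show ?thesis .
  qed
qed

lemma card_block_split:
  fixes a b d :: int
  assumes "a \<le> b" "b \<le> d"
  shows "card {n \<in> {a..<d}. P n} = card {n \<in> {a..<b}. P n} + card {n \<in> {b..<d}. P n}"
proof -
  have fin: "finite {n \<in> {u..<v}. P n}" for u v :: int
    by (rule finite_subset[of _ "{u..<v}"]) auto
  have "{n \<in> {a..<d}. P n} = {n \<in> {a..<b}. P n} \<union> {n \<in> {b..<d}. P n}"
    using assms by auto
  moreover have "{n \<in> {a..<b}. P n} \<inter> {n \<in> {b..<d}. P n} = {}" by auto
  ultimately show ?thesis using fin by (metis card_Un_disjoint)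
qed

lemma card_many_blocks:
  fixes s t k :: int and N m :: nat and \<rho> :: real
  assumes s: "0 < s" "s \<le> int N" "coprime t s" "\<bar>of_int s * \<theta> - of_int t\<bar> < 1 / N" and \<rho>: "0 \<le> \<rho>" "\<rho> \<le> 1 / 2"
  shows "\<bar>real (card {n \<in> {k..<k + int m * s}. nd (of_int n * \<theta> - y) < \<rho>}) - 2 * \<rho> * m * of_int s\<bar> \<le> 3 * m"
proof (induction m)
  case (Suc m)
  define P where "P = (\<lambda>n. nd (of_int n * \<theta> - y) < \<rho>)"
  define b where "b = k + int m * s"
  have b: "k \<le> b" "k + int (Suc m) * s = b + s" using s(1) by (simp_all add: b_def distrib_right)
  have "card {n \<in> {k..<k + int (Suc m) * s}. P n} = card {n \<in> {k..<b}. P n} + card {n \<in> {b..<b + s}. P n}"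
    unfolding b(2) using b(1) s(1) by (intro card_block_split) auto
  moreover have "\<bar>real (card {n \<in> {b..<b + s}. P n}) - 2 * \<rho> * of_int s\<bar> \<le> 3"
    using card_block_perturbed[OF s \<rho>(1), of b y] \<rho>(2) unfolding P_def by linarith
  moreover have "2 * \<rho> * real (Suc m) * of_int s = 2 * \<rho> * m * of_int s + 2 * \<rho> * of_int s"
    by (simp add: algebra_simps)
  ultimately have "\<bar>real (card {n \<in> {k..<k + int (Suc m) * s}. P n}) - 2 * \<rho> * real (Suc m) * of_int s\<bar>
      \<le> \<bar>real (card {n \<in> {k..<b}. P n}) - 2 * \<rho> * m * of_int s\<bar> + 3"
    by simp
  then show ?case using Suc unfolding P_def b_def by simp
qed simp

text \<open>The range is tiled by blocks of length \<open>s\<close>, with one incomplete block left over.\<close>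

lemma card_rotation_discrepancy:
  fixes s t k :: int and N L :: nat and \<rho> :: real
  assumes s: "0 < s" "s \<le> int N" "coprime t s" "\<bar>of_int s * \<theta> - of_int t\<bar> < 1 / N" and \<rho>: "0 \<le> \<rho>" "\<rho> \<le> 1 / 2"
  shows "\<bar>real (card {n \<in> {k..<k + int L}. nd (of_int n * \<theta> - y) < \<rho>}) - 2 * \<rho> * L\<bar>
    \<le> 3 * L / of_int s + of_int s + 3"
proof -
  define C where "C = (\<lambda>m::nat. card {n \<in> {k..<k + int m * s}. nd (of_int n * \<theta> - y) < \<rho>})"
  define X where "X = card {n \<in> {k..<k + int L}. nd (of_int n * \<theta> - y) < \<rho>}"
  define m where "m = nat (int L div s)"
  have m: "int m * s \<le> int L" "int L < (int m + 1) * s"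
  proof -
    have "int m = int L div s" using s(1) by (simp add: m_def pos_imp_zdiv_nonneg_iff)
    then have "int L = int m * s + int L mod s" by simp
    then show "int m * s \<le> int L" "int L < (int m + 1) * s"
      using pos_mod_bound[of s "int L"] pos_mod_sign[of s "int L"] s(1)
      unfolding distrib_right by linarith+
  qed
  then have mr: "real m * of_int s \<le> real L" "real L < (real m + 1) * of_int s"
    by (simp_all flip: of_int_le_iff[where 'a = real] of_int_less_iff[where 'a = real])
  define W E\<^sub>1 E\<^sub>2 :: real where "W = 2 * \<rho> * L" and "E\<^sub>1 = 2 * \<rho> * m * of_int s" and "E\<^sub>2 = 2 * \<rho> * Suc m * of_int s"
  have "C m \<le> X" unfolding C_def X_def using m(1) by (intro card_mono) auto
  moreover have "X \<le> C (Suc m)" unfolding C_def X_def using m(2) by (intro card_mono) (auto simp: algebra_simps)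
  moreover have "\<bar>real (C m) - E\<^sub>1\<bar> \<le> 3 * m" "\<bar>real (C (Suc m)) - E\<^sub>2\<bar> \<le> 3 * m + 3"
    using card_many_blocks[OF s \<rho>, of k m y] card_many_blocks[OF s \<rho>, of k "Suc m" y]
    unfolding C_def E\<^sub>1_def E\<^sub>2_def by simp_all
  moreover have "E\<^sub>2 \<le> W + of_int s"
  proof -
    have "2 * \<rho> * (m * of_int s) \<le> 2 * \<rho> * L" using mr \<rho> by (intro mult_left_mono) auto
    moreover have "2 * \<rho> * of_int s \<le> 1 * of_int s" using \<rho> s by (intro mult_right_mono) auto
    ultimately show ?thesis by (simp add: E\<^sub>2_def W_def algebra_simps)
  qed
  moreover have "W - of_int s \<le> E\<^sub>1"
  proof -
    have "2 * \<rho> * L \<le> 2 * \<rho> * ((real m + 1) * of_int s)" using mr \<rho> by (intro mult_left_mono) auto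
    moreover have "2 * \<rho> * of_int s \<le> 1 * of_int s" using \<rho> s by (intro mult_right_mono) auto
    ultimately show ?thesis by (simp add: E\<^sub>1_def W_def algebra_simps)
  qed
  moreover have "3 * real m \<le> 3 * L / of_int s" using mr(1) s(1) by (simp add: field_simps)
  ultimately have "\<bar>real X - W\<bar> \<le> 3 * L / of_int s + of_int s + 3" by linarith
  then show ?thesis unfolding X_def W_def .
qed

text \<open>The witnesses of Diophantine type are fixed because the constants of the estimates depend on them.\<close>

locale diophantine =
  fixes \<xi> M c :: real
  assumes M_ge: "2 \<le> M" and c_pos: "0 < c"
    and badly_approximable: "\<And>(p::int) q::nat. 1 \<le> q \<Longrightarrow> c / real q powr M \<le> \<bar>\<xi> - of_int p / real q\<bar>"
begin

lemma nd_multiple_ge: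
  assumes "1 \<le> q"
  shows "c / real q powr M \<le> nd (real q * \<xi>)"
proof -
  obtain p :: int where p: "nd (real q * \<xi>) = \<bar>real q * \<xi> - of_int p\<bar>" by (rule nd_attained)
  have "c / real q powr M \<le> \<bar>\<xi> - of_int p / real q\<bar>" using assms by (rule badly_approximable)
  also have "\<dots> \<le> real q * \<bar>\<xi> - of_int p / real q\<bar>" using assms by (simp add: mult_le_cancel_right1)
  also have "\<dots> = \<bar>real q * (\<xi> - of_int p / real q)\<bar>" by (simp add: abs_mult)
  also have "\<dots> = \<bar>real q * \<xi> - of_int p\<bar>" using assms by (simp add: right_diff_distrib)
  finally show ?thesis unfolding p .
qed

text \<open>Diophantine type enters here: a denominator that is too small would give too good an approximation of
  \<open>\<xi>\<close>. The multiplier \<open>D\<close> allows passing to arithmetic progressions.\<close>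

lemma denominator_large:
  assumes "1 \<le> D" "0 < s" "0 < N" "\<bar>of_int s * (real D * \<xi>) - of_int t\<bar> < 1 / real N"
  shows "(c * N) powr (1 / M) \<le> real D * of_int s"
proof -
  define q where "q = D * nat s"
  have q: "1 \<le> q" "real q = real D * of_int s" using assms by (auto simp: q_def Suc_le_eq)
  have "c / real q powr M \<le> nd (real q * \<xi>)" using q by (intro nd_multiple_ge)
  also have "\<dots> \<le> \<bar>real q * \<xi> - of_int t\<bar>" by (rule nd_le)
  also have "\<dots> \<le> 1 / N" using assms(4) unfolding q(2) by (simp add: algebra_simps)
  finally have "c * N \<le> real q powr M" using assms(3) q(1) by (simp add: field_simps)
  then have "(c * N) powr (1 / M) \<le> (real q powr M) powr (1 / M)"
    using c_pos M_ge by (intro powr_mono2) auto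
  also have "\<dots> = real q" using M_ge q by (simp add: powr_powr)
  finally show ?thesis unfolding q .
qed

text \<open>The power saved in the discrepancy bound: with \<open>N\<close> about \<open>sqrt L\<close>, the denominator of the rational
  approximation is at least of order \<open>L powr (1 / (2 * M))\<close>.\<close>

definition \<eta> :: real where "\<eta> = 1 / (2 * M)"

lemma \<eta>_bounds: "0 < \<eta>" "\<eta> \<le> 1 / 4"
  using M_ge by (auto simp: \<eta>_def field_simps)

definition K\<^sub>0 :: real where "K\<^sub>0 = 3 * (c / 2) powr (- 1 / M) + 4"

lemma K\<^sub>0_pos: "4 \<le> K\<^sub>0"
  by (simp add: K\<^sub>0_def)

text \<open>Dirichlet's theorem with \<open>N\<close> about \<open>sqrt L\<close> produces a denominator \<open>s\<close> that is at most \<open>sqrt L\<close>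
  and, by Diophantine type, at least a power of \<open>L\<close>. Both error terms \<open>L / s\<close> and \<open>s\<close> of the
  block count then save a power of \<open>L\<close>.\<close>

theorem discrepancy:
  assumes "1 \<le> D" "0 \<le> \<rho>" "\<rho> \<le> 1 / 2"
  shows "\<bar>real (card {n \<in> {k..<k + int L}. nd (of_int n * (real D * \<xi>) - y) < \<rho>}) - 2 * \<rho> * L\<bar>
    \<le> K\<^sub>0 * D * real L powr (1 - \<eta>)"
proof (cases "L = 0")
  case False
  define N where "N = nat \<lfloor>sqrt (real L)\<rfloor>"
  have sq: "1 \<le> sqrt (real L)" using False by simp
  have "1 \<le> \<lfloor>sqrt (real L)\<rfloor>" using sq by (simp add: le_floor_iff)
  moreover from this have "real N = of_int \<lfloor>sqrt (real L)\<rfloor>" by (simp add: N_def)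
  ultimately have N: "0 < N" "real N \<le> sqrt L" "sqrt L / 2 \<le> real N" by linarith+
  obtain t s where ts: "coprime t s" "0 < s" "s \<le> int N" "\<bar>of_int s * (real D * \<xi>) - of_int t\<bar> < 1 / real N"
    using Dirichlet_approx_coprime[OF N(1)] by blast
  have "(c / 2) powr (1 / M) * real L powr \<eta> = (c / 2 * sqrt L) powr (1 / M)"
    using c_pos by (simp only: powr_mult powr_powr powr_half_sqrt[symmetric] \<eta>_def) (simp add: powr_powr)
  also have "\<dots> \<le> (c * N) powr (1 / M)"
    using c_pos M_ge N(3) by (intro powr_mono2) (auto simp: field_simps)
  also have "\<dots> \<le> real D * of_int s" using denominator_large[OF assms(1) ts(2) N(1) ts(4)] .
  finally have s_ge: "(c / 2) powr (1 / M) * real L powr \<eta> \<le> real D * of_int s" .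
  have "real L / of_int s \<le> (c / 2) powr (- 1 / M) * D * real L powr (1 - \<eta>)"
  proof -
    have "real L / of_int s * ((c / 2) powr (1 / M) * real L powr \<eta>) \<le> real L / of_int s * (real D * of_int s)"
      using ts(2) by (intro mult_left_mono s_ge) auto
    also have "\<dots> = D * (real L powr (1 - \<eta>) * real L powr \<eta>)"
      using ts(2) False by (simp flip: powr_add)
    finally have "real L / of_int s * (c / 2) powr (1 / M) * real L powr \<eta> \<le> D * real L powr (1 - \<eta>) * real L powr \<eta>"
      by (simp only: mult.assoc)
    then have "real L / of_int s * (c / 2) powr (1 / M) \<le> D * real L powr (1 - \<eta>)"
      by (rule mult_right_le_imp_le) (use False in simp)
    then show ?thesis using c_pos
      by (simp add: powr_minus_divide minus_divide_left[symmetric] field_simps)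
  qed
  moreover have "of_int s \<le> D * real L powr (1 - \<eta>)"
  proof -
    have "of_int s \<le> real N" using ts(3) by linarith
    also have "\<dots> \<le> real L powr (1 / 2)" using N by (simp add: powr_half_sqrt)
    also have "\<dots> \<le> 1 * real L powr (1 - \<eta>)" using False \<eta>_bounds by (simp add: powr_mono)
    also have "\<dots> \<le> D * real L powr (1 - \<eta>)" using assms(1) by (intro mult_right_mono) auto
    finally show ?thesis .
  qed
  moreover have "3 \<le> 3 * (D * real L powr (1 - \<eta>))"
  proof -
    have "1 \<le> real L powr (1 - \<eta>)" using False \<eta>_bounds by (simp add: ge_one_powr_ge_zero)
    then have "1 * 1 \<le> D * real L powr (1 - \<eta>)" using assms(1) by (intro mult_mono) auto
    then show ?thesis by simp
  qed
  moreover have "K\<^sub>0 * D * real L powr (1 - \<eta>) = 3 * ((c / 2) powr (- 1 / M) * D * real L powr (1 - \<eta>))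
      + D * real L powr (1 - \<eta>) + 3 * (D * real L powr (1 - \<eta>))"
    by (simp add: K\<^sub>0_def algebra_simps)
  ultimately show ?thesis
    using card_rotation_discrepancy[OF ts(2,3,1,4) assms(2,3), of k L y] by linarith
qed (auto simp: algebra_simps)

corollary card_close_le:
  assumes "1 \<le> D" "0 \<le> \<rho>"
  shows "real (card {n \<in> {k..<k + int L}. nd (of_int n * (real D * \<xi>) - y) < \<rho>})
    \<le> 2 * \<rho> * L + K\<^sub>0 * D * real L powr (1 - \<eta>)"
proof (cases "\<rho> \<le> 1 / 2")
  case True
  then show ?thesis using discrepancy[OF assms True, of k L y] by linarith
next
  case False
  have "card {n \<in> {k..<k + int L}. nd (of_int n * (real D * \<xi>) - y) < \<rho>} \<le> card {k..<k + int L}"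
    by (intro card_mono) auto
  then have "real (card {n \<in> {k..<k + int L}. nd (of_int n * (real D * \<xi>) - y) < \<rho>}) \<le> 1 * real L" by simp
  also have "\<dots> \<le> 2 * \<rho> * L" using False by (intro mult_right_mono) auto
  also have "\<dots> \<le> 2 * \<rho> * L + K\<^sub>0 * D * real L powr (1 - \<eta>)" using K\<^sub>0_pos by simp
  finally show ?thesis .
qed

end

section \<open>Second moments\<close>

lemma (in finite_measure) integrable_indicator_event:
  "X \<in> sets M \<Longrightarrow> integrable M (indicator X :: 'a \<Rightarrow> real)"
  by (intro integrable_real_indicator) (auto simp: emeasure_eq_measure)

text \<open>This is the Chung-Erdos inequality.\<close>

lemma (in prob_space) second_moment_union:
  assumes G: "finite G" and ev: "\<And>i. i \<in> G \<Longrightarrow> A i \<in> events"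
    and B: "(\<Sum>i\<in>G. \<Sum>j\<in>G. prob (A i \<inter> A j)) \<le> B"
  shows "(\<Sum>i\<in>G. prob (A i))\<^sup>2 \<le> B * prob (\<Union>i\<in>G. A i)"
proof -
  define U where "U = (\<Union>i\<in>G. A i)"
  define s where "s = (\<Sum>i\<in>G. prob (A i))"
  define N where "N = (\<lambda>x. \<Sum>i\<in>G. indicator (A i) x :: real)"
  have U: "U \<in> events" unfolding U_def using G ev by auto
  note int = integrable_indicator_event
  have E1: "expectation N = s"
    unfolding N_def s_def using ev int by (subst Bochner_Integration.integral_sum) auto
  have N2: "(N x)\<^sup>2 = (\<Sum>i\<in>G. \<Sum>j\<in>G. indicator (A i \<inter> A j) x)" for x
    unfolding N_def power2_eq_square sum_product by (simp add: indicator_inter_arith)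
  have E2: "expectation (\<lambda>x. (N x)\<^sup>2) = (\<Sum>i\<in>G. \<Sum>j\<in>G. prob (A i \<inter> A j))"
    unfolding N2 using ev int
    by (simp add: Bochner_Integration.integral_sum Bochner_Integration.integrable_sum sets.Int)
  have int1: "integrable M N" unfolding N_def using ev int by (intro Bochner_Integration.integrable_sum) auto
  have int2: "integrable M (\<lambda>x. (N x)\<^sup>2)"
    unfolding N2 using ev int by (intro Bochner_Integration.integrable_sum int sets.Int) auto
  \<comment> \<open>The quadratic \<open>N\<^sup>2 - 2 t N + t\<^sup>2\<close> is nonnegative, and off \<open>U\<close> the count \<open>N\<close> vanishes.\<close>
  have key: "2 * t * s - t\<^sup>2 * prob U \<le> B" for t :: real
  proof -
    have "2 * t * N x - t\<^sup>2 * indicator U x \<le> (N x)\<^sup>2" for x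
    proof (cases "x \<in> U")
      case True
      then show ?thesis using zero_le_power2[of "N x - t"] by (simp add: power2_diff algebra_simps)
    next
      case False
      then have "N x = 0" unfolding N_def U_def by (intro sum.neutral) auto
      then show ?thesis using False by simp
    qed
    then have "expectation (\<lambda>x. 2 * t * N x - t\<^sup>2 * indicator U x) \<le> expectation (\<lambda>x. (N x)\<^sup>2)"
      using int1 int2 int[OF U] by (intro integral_mono) auto
    also have "expectation (\<lambda>x. 2 * t * N x - t\<^sup>2 * indicator U x) = 2 * t * s - t\<^sup>2 * prob U"
      using int1 int[OF U] U E1 by (subst Bochner_Integration.integral_diff) auto
    finally show ?thesis using B unfolding E2 by simp
  qed
  have "s\<^sup>2 \<le> B * prob U"
  proof (cases "prob U = 0")
    case True
    have "prob (A i) \<le> prob U" if "i \<in> G" for i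
      using that U unfolding U_def by (intro finite_measure_mono) auto
    then have "prob (A i) = 0" if "i \<in> G" for i using that True by (simp add: measure_le_0_iff)
    then show ?thesis using True by (simp add: s_def)
  next
    case False
    then have "prob U > 0" by (simp add: zero_less_measure_iff)
    then show ?thesis
      using key[of "s / prob U"] by (simp add: power2_eq_square field_simps)
  qed
  then show ?thesis unfolding s_def U_def .
qed

text \<open>Dropping finitely many events changes the sum of the probabilities by a bounded amount, so the
  bound for unions passes to every tail, hence to the limit superior. For \<open>K = 1\<close>, when the variance is
  small compared with the square of the mean, the limit superior has full measure.\<close>

theorem (in prob_space) second_moment_limsup:
  fixes A :: "nat \<Rightarrow> 'a set" and F :: "nat \<Rightarrow> nat set"
  defines "S \<equiv> (\<lambda>n. \<Sum>i\<in>F n. prob (A i))"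
  assumes F: "\<And>n. finite (F n)" and ev: "\<And>i. A i \<in> events"
    and S: "filterlim S at_top sequentially"
    and K: "0 < K" and bound: "\<And>n. (\<Sum>i\<in>F n. \<Sum>j\<in>F n. prob (A i \<inter> A j)) \<le> K * (S n)\<^sup>2 + C * S n"
  shows "1 / K \<le> prob {x \<in> space M. \<exists>\<^sub>\<infinity>i. x \<in> A i}"
proof -
  define U where "U = (\<lambda>m. \<Union>i\<in>{m..}. A i)"
  have U: "U m \<in> events" for m unfolding U_def using ev by auto
  have U_ge: "1 / K \<le> prob (U m)" for m
  proof (rule tendsto_le)
    have "((\<lambda>x::real. (x - real m)\<^sup>2 / (K * x\<^sup>2 + C * x)) \<longlongrightarrow> inverse K) at_top"
      using K by real_asymp
    then have "((\<lambda>x::real. (x - real m)\<^sup>2 / (K * x\<^sup>2 + C * x)) \<longlongrightarrow> 1 / K) at_top"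
      by (simp only: inverse_eq_divide)
    then show "(\<lambda>n. (S n - m)\<^sup>2 / (K * (S n)\<^sup>2 + C * S n)) \<longlonglongrightarrow> 1 / K"
      using S by (rule filterlim_compose)
    show "(\<lambda>_. prob (U m)) \<longlonglongrightarrow> prob (U m)" by simp
    have "eventually (\<lambda>x::real. K * x\<^sup>2 + C * x > 0 \<and> x > real m) at_top"
      using K by (intro eventually_conj eventually_gt_at_top) real_asymp
    then have "eventually (\<lambda>n. K * (S n)\<^sup>2 + C * S n > 0 \<and> S n > real m) sequentially"
      using S by (rule eventually_compose_filterlim)
    then show "eventually (\<lambda>n. (S n - m)\<^sup>2 / (K * (S n)\<^sup>2 + C * S n) \<le> prob (U m)) sequentially"
    proof eventually_elim
      case (elim n)
      define G where "G = F n - {..<m}"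
      have "S n \<le> (\<Sum>i\<in>G. prob (A i)) + (\<Sum>i<m. prob (A i))"
        unfolding S_def G_def
        using F[of n] by (subst sum.union_disjoint[symmetric]) (auto intro!: sum_mono2)
      also have "(\<Sum>i<m. prob (A i)) \<le> (\<Sum>i<m. 1)" by (intro sum_mono) simp
      finally have le: "S n - m \<le> (\<Sum>i\<in>G. prob (A i))" by simp
      have "(\<Sum>i\<in>G. \<Sum>j\<in>G. prob (A i \<inter> A j)) \<le> (\<Sum>i\<in>G. \<Sum>j\<in>F n. prob (A i \<inter> A j))"
        unfolding G_def using F by (intro sum_mono sum_mono2) auto
      also have "\<dots> \<le> (\<Sum>i\<in>F n. \<Sum>j\<in>F n. prob (A i \<inter> A j))"
        unfolding G_def using F by (intro sum_mono2 sum_nonneg) auto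
      also have "\<dots> \<le> K * (S n)\<^sup>2 + C * S n" by (rule bound)
      finally have "(\<Sum>i\<in>G. prob (A i))\<^sup>2 \<le> (K * (S n)\<^sup>2 + C * S n) * prob (\<Union>i\<in>G. A i)"
        using F ev by (intro second_moment_union) (auto simp: G_def)
      also have "\<dots> \<le> (K * (S n)\<^sup>2 + C * S n) * prob (U m)"
      proof (intro mult_left_mono finite_measure_mono)
        show "(\<Union>i\<in>G. A i) \<subseteq> U m" unfolding G_def U_def by force
      qed (use elim U in auto)
      finally have "(\<Sum>i\<in>G. prob (A i))\<^sup>2 \<le> (K * (S n)\<^sup>2 + C * S n) * prob (U m)" .
      moreover have "(S n - m)\<^sup>2 \<le> (\<Sum>i\<in>G. prob (A i))\<^sup>2" using elim le by (intro power_mono) auto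
      ultimately show ?case using elim by (simp add: field_simps)
    qed
  qed simp
  have "(\<lambda>m. prob (U m)) \<longlonglongrightarrow> prob (\<Inter>m. U m)"
    using U by (intro finite_Lim_measure_decseq) (auto simp: decseq_def U_def intro: order_trans)
  then have "1 / K \<le> prob (\<Inter>m. U m)"
    using U_ge by (intro LIMSEQ_le_const) auto
  also have "(\<Inter>m. U m) = {x \<in> space M. \<exists>\<^sub>\<infinity>i. x \<in> A i}"
    using ev[THEN sets.sets_into_space] by (fastforce simp: U_def INFM_nat_le)
  finally show ?thesis .
qed

section \<open>Averages over divisors\<close>

lemma sum_antimono_multiples:
  fixes \<psi> :: "nat \<Rightarrow> real"
  assumes "\<And>m n. 1 \<le> m \<Longrightarrow> m \<le> n \<Longrightarrow> \<psi> n \<le> \<psi> m"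
  shows "real d * (\<Sum>b=1..m. \<psi> (d * b)) \<le> (\<Sum>k=1..d * m. \<psi> k)"
proof (induction m)
  case (Suc m)
  have "real d * \<psi> (d * Suc m) = (\<Sum>k=d * m + 1..d * m + d. \<psi> (d * Suc m))" by simp
  also have "\<dots> \<le> (\<Sum>k=d * m + 1..d * m + d. \<psi> k)"
    by (intro sum_mono assms) auto
  finally have "real d * (\<Sum>b=1..Suc m. \<psi> (d * b))
      \<le> (\<Sum>k=1..d * m. \<psi> k) + (\<Sum>k=d * m + 1..d * m + d. \<psi> k)"
    using Suc by (simp add: distrib_left)
  also have "\<dots> = (\<Sum>k=1..d * m + d. \<psi> k)"
    by (rule sum.ub_add_nat[symmetric]) simp
  finally show ?case by (simp add: add.commute)
qed simp

lemma sum_over_multiples_le: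
  fixes \<psi> :: "nat \<Rightarrow> real"
  assumes mono: "\<And>m n. 1 \<le> m \<Longrightarrow> m \<le> n \<Longrightarrow> \<psi> n \<le> \<psi> m" and nonneg: "\<And>n. 0 \<le> \<psi> n" and "1 \<le> d"
  shows "(\<Sum>n | n \<in> {1..Q} \<and> d dvd n. \<psi> n) \<le> (\<Sum>n=1..Q. \<psi> n) / d"
proof -
  have "{n. n \<in> {1..Q} \<and> d dvd n} = (\<lambda>b. d * b) ` {1..Q div d}"
    using assms(3) by (auto simp: image_iff Suc_le_eq less_eq_div_iff_mult_less_eq mult.commute dvd_def)
  then have "(\<Sum>n | n \<in> {1..Q} \<and> d dvd n. \<psi> n) = (\<Sum>b=1..Q div d. \<psi> (d * b))"
    using assms(3) by (simp add: sum.reindex inj_on_def)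
  also have "\<dots> * real d \<le> (\<Sum>k=1..d * (Q div d). \<psi> k)"
    using sum_antimono_multiples[of \<psi> d "Q div d", OF mono] by (simp add: mult.commute)
  also have "\<dots> \<le> (\<Sum>n=1..Q. \<psi> n)"
    using nonneg by (intro sum_mono2) (auto intro: order_trans[OF _ times_div_less_eq_dividend])
  finally show ?thesis using assms(3) by (simp add: field_simps)
qed

text \<open>After exchanging the sums, the multiples of \<open>d\<close> carry at most the proportion \<open>1 / d\<close> of a decreasing
  weight.\<close>

lemma sum_divisors_average:
  fixes \<psi> g :: "nat \<Rightarrow> real"
  assumes mono: "\<And>m n. 1 \<le> m \<Longrightarrow> m \<le> n \<Longrightarrow> \<psi> n \<le> \<psi> m" and nonneg: "\<And>n. 0 \<le> \<psi> n"
    and g: "\<And>d. 0 \<le> g d" and G: "(\<Sum>d=1..Q. g d / d) \<le> G"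
  shows "(\<Sum>n=1..Q. \<psi> n * (\<Sum>d | d dvd n. g d)) \<le> G * (\<Sum>n=1..Q. \<psi> n)"
proof -
  have "(\<Sum>n=1..Q. \<psi> n * (\<Sum>d | d dvd n. g d)) = (\<Sum>n=1..Q. \<Sum>d | d \<in> {1..Q} \<and> d dvd n. g d * \<psi> n)"
  proof (rule sum.cong)
    fix n assume n: "n \<in> {1..Q}"
    then have "{d. d dvd n} = {d. d \<in> {1..Q} \<and> d dvd n}"
      by (auto dest: dvd_imp_le intro: Suc_leI dvd_pos_nat)
    then show "\<psi> n * (\<Sum>d | d dvd n. g d) = (\<Sum>d | d \<in> {1..Q} \<and> d dvd n. g d * \<psi> n)"
      by (simp add: sum_distrib_left mult.commute)
  qed simp
  also have "\<dots> = (\<Sum>d=1..Q. \<Sum>n | n \<in> {1..Q} \<and> d dvd n. g d * \<psi> n)"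
    by (rule sum.swap_restrict) auto
  also have "\<dots> = (\<Sum>d=1..Q. g d * (\<Sum>n | n \<in> {1..Q} \<and> d dvd n. \<psi> n))"
    by (simp add: sum_distrib_left)
  also have "\<dots> \<le> (\<Sum>d=1..Q. g d * ((\<Sum>n=1..Q. \<psi> n) / d))"
    by (intro sum_mono mult_left_mono sum_over_multiples_le mono nonneg g) auto
  also have "\<dots> = (\<Sum>d=1..Q. g d / d) * (\<Sum>n=1..Q. \<psi> n)"
    by (simp add: sum_distrib_right)
  also have "\<dots> \<le> G * (\<Sum>n=1..Q. \<psi> n)"
    using G nonneg by (intro mult_right_mono sum_nonneg) auto
  finally show ?thesis .
qed

section \<open>Overlaps of two approximation sets\<close>

lemma card_blocks_le:
  fixes s k :: int
  assumes "0 < s" and block: "\<And>k. real (card {n \<in> {k..<k + s}. P n}) \<le> X"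
  shows "real (card {n \<in> {k..<k + int m * s}. P n}) \<le> m * X"
proof (induction m)
  case (Suc m)
  define b where "b = k + int m * s"
  have b: "k \<le> b" "k + int (Suc m) * s = b + s" using assms(1) by (simp_all add: b_def distrib_right)
  have "card {n \<in> {k..<k + int (Suc m) * s}. P n} = card {n \<in> {k..<b}. P n} + card {n \<in> {b..<b + s}. P n}"
    unfolding b(2) using b(1) assms(1) by (intro card_block_split) auto
  then show ?case using Suc block[of b] unfolding b_def by (simp add: distrib_right)
qed simp

lemma gcd_factors:
  assumes "1 \<le> q" "1 \<le> (q'::nat)"
  obtains a b where "q = gcd q q' * a" "q' = gcd q q' * b" "coprime a b" "1 \<le> a" "1 \<le> b"
proof -
  obtain a b where ab: "q = a * gcd q q'" "q' = b * gcd q q'" "coprime a b"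
    using gcd_coprime_exists[of q q'] assms by auto
  moreover have "a \<noteq> 0" "b \<noteq> 0" using ab(1,2) assms by (metis mult_0 not_one_le_zero, metis mult_0 not_one_le_zero)
  ultimately show ?thesis using that[of a b] by (simp add: mult.commute)
qed

text \<open>The set \<open>hits \<xi> q' \<rho>'\<close> is invariant under translation by \<open>1 / q'\<close>. Averaging over these \<open>q'\<close>
  translations, one has to count how many translates of a point lie in \<open>hits \<xi> q \<rho>\<close>. They run
  through \<open>gcd q q'\<close> blocks of equally spaced points, and the rounding error of 1 in each block gives the
  gcd term.\<close>

lemma hits_overlap_le:
  assumes "1 \<le> q" "1 \<le> q'" "0 \<le> \<rho>"
  shows "measure circ (hits \<xi> q \<rho> \<inter> hits \<xi> q' \<rho>') \<le> measure circ (hits \<xi> q' \<rho>') * (2 * \<rho> + real (gcd q q') / real q')"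
proof -
  define A where "A = hits \<xi> q \<rho>"
  define B where "B = hits \<xi> q' \<rho>'"
  define A' where "A' = (\<lambda>i::nat. (\<lambda>x. x + real i / real q') -` A)"
  obtain a b where ab: "q = gcd q q' * a" "q' = gcd q q' * b" "coprime a b" "1 \<le> a" "1 \<le> b"
    using gcd_factors[OF assms(1,2)] .
  define d where "d = gcd q q'"
  have d: "1 \<le> d" using assms by (simp add: d_def Suc_le_eq)
  have "real q = d * a" "real q' = d * b" unfolding d_def by (metis ab(1) of_nat_mult) (metis ab(2) of_nat_mult)
  then have ratio: "real q / real q' = real a / real b" using d by simp
  have [measurable]: "A \<in> sets borel" "B \<in> sets borel" by (auto simp: A_def B_def)
  have [measurable]: "A' i \<in> sets borel" for i
    using measurable_sets[of "\<lambda>x. x + real i / real q'" borel borel A] by (auto simp: A'_def)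
  have AB: "measure circ (A' i \<inter> B) = measure circ (A \<inter> B)" for i
  proof -
    have "(\<lambda>x. x + real i / real q') -` (A \<inter> B) = A' i \<inter> B"
      using hits_shift[of _ i q' \<xi> \<rho>'] by (auto simp: A'_def B_def)
    moreover have "periodic (A \<inter> B)"
      using periodic_hits unfolding A_def B_def periodic_def by blast
    ultimately show ?thesis using measure_circ_shift[of "A \<inter> B" "real i / real q'"] by simp
  qed
  have count: "(\<Sum>i<q'. indicator (A' i) x) \<le> 2 * \<rho> * q' + d" for x :: real
  proof -
    define P where "P = (\<lambda>n::int. nd (of_int n * (of_int (int a) / of_int (int b)) - (\<xi> - q * x)) < \<rho>)"
    have iff: "x \<in> A' i \<longleftrightarrow> P (int i)" for i
    proof -
      have "real q * (x + real i / real q') - \<xi> = of_int (int i) * (of_int (int a) / of_int (int b)) - (\<xi> - q * x)"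
        unfolding distrib_left using arg_cong[OF ratio, of "\<lambda>z. real i * z"] by (simp add: mult_ac)
      then show ?thesis by (simp add: A'_def A_def hits_def P_def diff_diff_eq2)
    qed
    have "(\<Sum>i<q'. indicator (A' i) x) = real (card {i \<in> {..<q'}. P (int i)})"
      by (simp add: indicator_def iff sum.If_cases Int_def conj_commute)
    also have "card {i \<in> {..<q'}. P (int i)} = card {n \<in> {0..<0 + int d * int b}. P n}"
    proof (rule bij_betw_same_card[of int])
      have "int ` {i \<in> {..<q'}. P (int i)} = {n \<in> {0..<0 + int d * int b}. P n}"
      proof (intro set_eqI iffI)
        fix n assume "n \<in> {n \<in> {0..<0 + int d * int b}. P n}"
        moreover have "int d * int b = int q'" using ab(2) by (simp add: d_def flip: of_nat_mult)
        ultimately show "n \<in> int ` {i \<in> {..<q'}. P (int i)}" by (intro image_eqI[of _ _ "nat n"]) auto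
      qed (use ab(2) in \<open>auto simp: d_def simp flip: of_nat_mult\<close>)
      then show "bij_betw int {i \<in> {..<q'}. P (int i)} {n \<in> {0..<0 + int d * int b}. P n}"
        by (simp add: bij_betw_def)
    qed
    also have "real (card {n \<in> {0..<0 + int d * int b}. P n}) \<le> d * (2 * \<rho> * b + 1)"
    proof (rule card_blocks_le)
      fix k
      have "card {n \<in> {k..<k + int b}. P n} = card {j \<in> {0..<int b}. nd (of_int j / of_int (int b) - (\<xi> - q * x)) < \<rho>}"
        unfolding P_def using ab by (intro card_block_rational) auto
      then show "real (card {n \<in> {k..<k + int b}. P n}) \<le> 2 * \<rho> * b + 1"
        using card_fractions_in_arc(1)[of "int b" \<rho> "\<xi> - q * x"] ab(5) assms(3) by simp
    qed (use ab in auto)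
    also have "d * (2 * \<rho> * b + 1) = 2 * \<rho> * q' + d"
      using \<open>real q' = d * b\<close> by (simp add: algebra_simps)
    finally show ?thesis .
  qed
  have "q' * measure circ (A \<inter> B) = (\<Sum>i<q'. measure circ (A' i \<inter> B))"
    by (simp add: AB)
  also have "\<dots> = (\<integral>x. (\<Sum>i<q'. indicator (A' i) x) * indicator B x \<partial>circ)"
    unfolding sum_distrib_right
    by (subst Bochner_Integration.integral_sum)
       (auto simp: indicator_inter_arith[symmetric] intro!: circ.integrable_indicator_event)
  also have "\<dots> \<le> (\<integral>x. (2 * \<rho> * q' + d) * indicator B x \<partial>circ)"
    using count
    by (intro integral_mono mult_right_mono)
       (auto simp: sum_distrib_right indicator_inter_arith[symmetric]
         intro!: circ.integrable_indicator_event Bochner_Integration.integrable_sum)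
  also have "\<dots> = (2 * \<rho> * q' + d) * measure circ B" by simp
  finally show ?thesis
    using assms(2) unfolding A_def B_def d_def by (simp add: field_simps)
qed

text \<open>Eliminating \<open>x\<close> from the two approximations leaves a multiple of \<open>\<xi>\<close> close to an integer.\<close>

lemma hits_overlap_empty:
  assumes "1 \<le> q" "1 \<le> q'" "0 \<le> \<rho>" "0 \<le> \<rho>'" "x \<in> hits \<xi> q \<rho> \<inter> hits \<xi> q' \<rho>'"
  shows "nd ((real (q' div gcd q q') - real (q div gcd q q')) * \<xi>)
    < real (q' div gcd q q') * \<rho> + real (q div gcd q q') * \<rho>'"
proof -
  obtain a b where ab: "q = gcd q q' * a" "q' = gcd q q' * b" "coprime a b" "1 \<le> a" "1 \<le> b"
    using gcd_factors[OF assms(1,2)] .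
  have "0 < gcd q q'" using assms by simp
  then have div: "q' div gcd q q' = b" "q div gcd q q' = a"
    using ab(1,2) by (metis nonzero_mult_div_cancel_left less_numeral_extra(3))+
  have cross: "real b * real q = real a * real q'"
    using ab(1,2) by (metis mult.commute mult.left_commute of_nat_mult)
  have "nd ((real b - real a) * \<xi>) = nd (real b * (q * x - \<xi>) + - (real a * (q' * x - \<xi>)))"
    using cross nd_minus_commute[of "real b * \<xi>" "real a * \<xi>"] by (simp add: algebra_simps)
  also have "\<dots> \<le> nd (real b * (q * x - \<xi>)) + nd (real a * (q' * x - \<xi>))"
    using nd_triangle[of "real b * (q * x - \<xi>)" "- (real a * (q' * x - \<xi>))"] by simp
  also have "\<dots> \<le> b * nd (q * x - \<xi>) + a * nd (q' * x - \<xi>)"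
    using nd_int_mult_le[of "int b" "q * x - \<xi>"] nd_int_mult_le[of "int a" "q' * x - \<xi>"] by simp
  also have "\<dots> < b * \<rho> + a * \<rho>'"
    using assms(5) ab(4,5) unfolding hits_def
    by (intro add_strict_mono mult_strict_left_mono) auto
  finally show ?thesis unfolding div .
qed

text \<open>Excluding the integers removes the additive constant of \<open>card_fractions_in_arc\<close>, so that a count
  over many blocks has no gcd term.\<close>

lemma card_fractions_near_zero:
  fixes s :: int
  assumes "0 < s" "0 \<le> r"
  shows "real (card {j \<in> {0..<s}. 0 < nd (of_int j / of_int s) \<and> nd (of_int j / of_int s) < r}) \<le> 2 * r * of_int s"
proof -
  define A where "A = {j::int. 0 < j \<and> j < r * of_int s}"
  have "A = {1..\<lceil>r * of_int s\<rceil> - 1}" by (auto simp: A_def less_ceiling_iff) 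
  moreover have "0 \<le> r * of_int s" using assms by simp
  ultimately have A: "finite A" "real (card A) \<le> r * of_int s"
    by (auto; linarith)+
  have "{j \<in> {0..<s}. 0 < nd (of_int j / of_int s) \<and> nd (of_int j / of_int s) < r} \<subseteq> A \<union> (\<lambda>j. s - j) ` A"
  proof
    fix j assume "j \<in> {j \<in> {0..<s}. 0 < nd (of_int j / of_int s) \<and> nd (of_int j / of_int s) < r}"
    then have j: "0 \<le> j" "j < s" "0 < nd (of_int j / of_int s)" "nd (of_int j / of_int s) < r" by auto
    have "j \<noteq> 0" using j(3) nd_pos_iff[of 0] by auto
    obtain p :: int where p: "nd (of_int j / of_int s) = \<bar>of_int j / of_int s - of_int p\<bar>" by (rule nd_attained)
    have half: "\<bar>of_int j / of_int s - of_int p\<bar> \<le> (1 / 2 :: real)" using nd_le_half p by metis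
    have "0 \<le> real_of_int j / of_int s" "real_of_int j / of_int s < 1" using j assms by auto
    then have "p = 0 \<or> p = 1" using half by linarith
    then show "j \<in> A \<union> (\<lambda>j. s - j) ` A"
    proof
      assume "p = 0"
      then have "of_int j / of_int s < r" using p j(4) \<open>p = 0\<close> \<open>0 \<le> real_of_int j / of_int s\<close> by linarith
      then have "of_int j < r * of_int s" using assms by (simp add: field_simps)
      then show ?thesis using \<open>j \<noteq> 0\<close> j by (simp add: A_def)
    next
      assume "p = 1"
      then have "1 - of_int j / of_int s < r" using p j \<open>real_of_int j / of_int s < 1\<close> by linarith
      then have "of_int (s - j) < r * of_int s" using assms by (simp add: field_simps)
      then have "s - j \<in> A" using j by (simp add: A_def)
      then show ?thesis by (intro UnI2 image_eqI[of _ _ "s - j"]) auto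
    qed
  qed
  then have "card {j \<in> {0..<s}. 0 < nd (of_int j / of_int s) \<and> nd (of_int j / of_int s) < r} \<le> card (A \<union> (\<lambda>j. s - j) ` A)"
    using A by (intro card_mono) auto
  also have "\<dots> \<le> card A + card ((\<lambda>j. s - j) ` A)" by (rule card_Un_le)
  also have "card ((\<lambda>j. s - j) ` A) \<le> card A" using A by (intro card_image_le)
  finally show ?thesis using A by simp
qed

text \<open>Coprimality makes the fractions attached to different denominators distinct.\<close>

definition reduced_hits :: "nat \<Rightarrow> real \<Rightarrow> real set" where
  "reduced_hits v \<rho> = {\<alpha>. \<exists>p::int. coprime p (int v) \<and> \<bar>real v * \<alpha> - of_int p\<bar> < \<rho>}"

lemma reduced_hits_borel [measurable]: "reduced_hits v \<rho> \<in> sets borel"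
proof -
  have "reduced_hits v \<rho> = (\<Union>p\<in>{p::int. coprime p (int v)}. {\<alpha>. \<bar>real v * \<alpha> - of_int p\<bar> < \<rho>})"
    by (auto simp: reduced_hits_def)
  also have "\<dots> \<in> sets borel" by (intro sets.countable_UN'') auto
  finally show ?thesis .
qed

lemma reduced_hits_shift: "x + 1 \<in> reduced_hits v \<rho> \<longleftrightarrow> x \<in> reduced_hits v \<rho>"
proof
  assume "x + 1 \<in> reduced_hits v \<rho>"
  then obtain p :: int where p: "coprime p (int v)" "\<bar>real v * (x + 1) - of_int p\<bar> < \<rho>" by (auto simp: reduced_hits_def)
  have "coprime (p - int v) (int v)" using p(1) by (metis coprime_iff_gcd_eq_1 gcd.commute gcd_diff1)
  moreover have "\<bar>real v * x - of_int (p - int v)\<bar> < \<rho>" using p(2) by (simp add: algebra_simps)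
  ultimately show "x \<in> reduced_hits v \<rho>" unfolding reduced_hits_def by blast
next
  assume "x \<in> reduced_hits v \<rho>"
  then obtain p :: int where p: "coprime p (int v)" "\<bar>real v * x - of_int p\<bar> < \<rho>" by (auto simp: reduced_hits_def)
  have "coprime (p + int v) (int v)" using p(1) by (metis coprime_iff_gcd_eq_1 gcd.commute gcd_add1)
  moreover have "\<bar>real v * (x + 1) - of_int (p + int v)\<bar> < \<rho>" using p(2) by (simp add: algebra_simps)
  ultimately show "x + 1 \<in> reduced_hits v \<rho>" unfolding reduced_hits_def by blast
qed

lemma measure_reduced_hits_ge:
  assumes "2 \<le> v" "0 \<le> \<rho>" "\<rho> \<le> 1 / 2"
  shows "2 * \<rho> / v * card {p \<in> {1..<v}. coprime p v} \<le> measure circ (reduced_hits v \<rho>)"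
proof -
  define I where "I = {p \<in> {1..<v}. coprime p v}"
  define J where "J = (\<lambda>p. {(real p - \<rho>) / v<..<(real p + \<rho>) / v})"
  have fin: "finite I" by (simp add: I_def)
  have len: "measure lborel (J p) = 2 * \<rho> / v" for p
    unfolding J_def using assms by (simp add: divide_right_mono diff_divide_distrib[symmetric])
  have iff: "x \<in> J p \<longleftrightarrow> \<bar>real v * x - p\<bar> < \<rho>" for x p
    using assms unfolding J_def by (auto simp: field_simps abs_less_iff)
  have disj: "disjoint_family_on J I"
    unfolding disjoint_family_on_def
  proof (intro ballI impI, rule ccontr)
    fix p q assume "p \<noteq> q" "J p \<inter> J q \<noteq> {}"
    then obtain x where "\<bar>real v * x - p\<bar> < \<rho>" "\<bar>real v * x - q\<bar> < \<rho>" using iff by blast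
    then have "\<bar>real p - real q\<bar> < 1" using assms(3) by linarith
    then show False using \<open>p \<noteq> q\<close> by linarith
  qed
  have sub: "J p \<subseteq> {0..<1}" if "p \<in> I" for p
  proof
    fix x assume "x \<in> J p"
    then have "\<bar>real v * x - p\<bar> < \<rho>" by (simp add: iff)
    moreover have "1 \<le> real p" "real p \<le> real v - 1" using that by (auto simp: I_def)
    ultimately have "0 < real v * x" "real v * x < real v * 1" using assms(3) by linarith+
    then show "x \<in> {0..<1}" by (auto simp: zero_less_mult_iff)
  qed
  have fm: "J p \<in> fmeasurable lborel" if "p \<in> I" for p
    using assms unfolding J_def by (intro fmeasurableI) (auto simp: divide_right_mono)
  have "2 * \<rho> / v * card I = (\<Sum>p\<in>I. measure lborel (J p))" by (simp add: len)
  also have "\<dots> = measure lborel (\<Union>p\<in>I. J p)"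
    using fin fm disj by (intro measure_UNION'[symmetric]) (auto simp: pairwise_def disjnt_def disjoint_family_on_def)
  also have "\<dots> \<le> measure lborel (reduced_hits v \<rho> \<inter> {0..<1})"
  proof (rule measure_mono_fmeasurable)
    have "J p \<subseteq> reduced_hits v \<rho>" if "p \<in> I" for p
      using that unfolding reduced_hits_def by (auto simp: iff I_def intro!: exI[of _ "int p"])
    then show "(\<Union>p\<in>I. J p) \<subseteq> reduced_hits v \<rho> \<inter> {0..<1}" using sub by blast
  qed (auto simp: J_def)
  also have "\<dots> = measure circ (reduced_hits v \<rho>)" by (subst measure_circ) auto
  finally show ?thesis unfolding I_def .
qed

text \<open>In contrast to \<open>hits_overlap_le\<close> there is no gcd term. The price is the factor 8 where independence
  would give 4, so that the second moment method yields only positive measure.\<close>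

lemma reduced_hits_overlap_le:
  assumes "1 \<le> v" "v < w" "0 \<le> \<rho>'" "\<rho>' \<le> \<rho>" "\<rho>' \<le> 1 / 2"
  shows "measure circ (reduced_hits v \<rho> \<inter> reduced_hits w \<rho>') \<le> 8 * \<rho> * \<rho>'"
proof -
  obtain a b where ab: "v = gcd v w * a" "w = gcd v w * b" "coprime a b" "1 \<le> a" "1 \<le> b"
    using gcd_factors[of v w] assms by auto
  define d where "d = gcd v w"
  have vw: "v = d * a" "w = d * b" using ab by (simp_all add: d_def)
  have d: "1 \<le> d" using assms by (simp add: d_def Suc_le_eq)
  have db: "int d * int b = int w" by (simp add: vw)
  have ratio: "real v / real w = real a / real b" unfolding vw using d by simp
  define G where "G = {n \<in> {0..<0 + int d * int b}. 0 < nd (of_int n * (of_int (int a) / of_int (int b)) - 0) \<and>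
      nd (of_int n * (of_int (int a) / of_int (int b)) - 0) < 2 * \<rho>}"
  have "real (card G) \<le> d * (2 * (2 * \<rho>) * b)"
    unfolding G_def
  proof (rule card_blocks_le)
    fix k
    have "card {n \<in> {k..<k + int b}. 0 < nd (of_int n * (of_int (int a) / of_int (int b)) - 0) \<and>
        nd (of_int n * (of_int (int a) / of_int (int b)) - 0) < 2 * \<rho>} =
      card {j \<in> {0..<int b}. 0 < nd (of_int j / of_int (int b) - 0) \<and> nd (of_int j / of_int (int b) - 0) < 2 * \<rho>}"
      using ab by (intro card_block_rational[where P = "\<lambda>z. 0 < z \<and> z < 2 * \<rho>"]) auto
    then show "real (card {n \<in> {k..<k + int b}. 0 < nd (of_int n * (of_int (int a) / of_int (int b)) - 0) \<and>
        nd (of_int n * (of_int (int a) / of_int (int b)) - 0) < 2 * \<rho>}) \<le> 2 * (2 * \<rho>) * b"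
      using card_fractions_near_zero[of "int b" "2 * \<rho>"] ab(5) assms by simp
  qed (use ab in auto)
  then have card_G: "real (card G) \<le> 4 * \<rho> * w" by (simp add: vw algebra_simps)
  have finG: "finite G" unfolding G_def by simp
  define J where "J = (\<lambda>n::int. {(of_int n - \<rho>') / w<..<(of_int n + \<rho>') / w})"
  have iff: "x \<in> J n \<longleftrightarrow> \<bar>real w * x - of_int n\<bar> < \<rho>'" for x n
    using assms unfolding J_def by (auto simp: field_simps abs_less_iff)
  have len: "measure lborel (J n) = 2 * \<rho>' / w" for n
    unfolding J_def using assms by (simp add: divide_right_mono diff_divide_distrib[symmetric])
  have fm: "J n \<in> fmeasurable lborel" for n
    using assms unfolding J_def by (intro fmeasurableI) (auto simp: divide_right_mono)
  \<comment> \<open>Two distinct reduced fractions: near the numerator \<open>n\<close> of the larger denominator, \<open>v n / w\<close> is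
    close to an integer without being one.\<close>
  have "reduced_hits v \<rho> \<inter> reduced_hits w \<rho>' \<inter> {0..<1} \<subseteq> (\<Union>n\<in>G. J n)"
  proof
    fix x assume x: "x \<in> reduced_hits v \<rho> \<inter> reduced_hits w \<rho>' \<inter> {0..<1}"
    then obtain p n :: int where p: "coprime p (int v)" "\<bar>real v * x - of_int p\<bar> < \<rho>"
      and n: "coprime n (int w)" "\<bar>real w * x - of_int n\<bar> < \<rho>'" by (auto simp: reduced_hits_def)
    define z where "z = of_int n * (real a / real b)"
    have z: "z = real v / real w * of_int n" by (simp add: z_def ratio)
    have "z - of_int p = (real v * x - of_int p) - real v / real w * (real w * x - of_int n)"
      unfolding z using assms by (simp add: field_simps)
    then have "\<bar>z - of_int p\<bar> \<le> \<bar>real v * x - of_int p\<bar> + \<bar>real v / real w * (real w * x - of_int n)\<bar>"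
      by (simp only: abs_triangle_ineq4)
    also have "\<bar>real v / real w * (real w * x - of_int n)\<bar> = real v / real w * \<bar>real w * x - of_int n\<bar>"
      by (simp add: abs_mult)
    also have "\<dots> \<le> 1 * \<rho>'" using n(2) assms by (intro mult_mono) auto
    finally have "\<bar>z - of_int p\<bar> < 2 * \<rho>" using p(2) assms by linarith
    then have "nd z < 2 * \<rho>" using nd_le[of z p] by linarith
    moreover have "z \<notin> \<int>"
    proof
      assume "z \<in> \<int>"
      then obtain k :: int where "z = of_int k" by (auto elim: Ints_cases)
      then have "real_of_int (int v * n) = of_int (k * int w)"
        using assms unfolding z by (simp add: field_simps)
      then have "int v * n = k * int w" by linarith
      then have "int w dvd n * int v" by (metis dvd_triv_right mult.commute)
      then have "int w dvd int v" using n(1) by (metis coprime_commute coprime_dvd_mult_right_iff)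
      then have "w \<le> v" using assms by (simp add: dvd_imp_le)
      then show False using assms by simp
    qed
    ultimately have nz: "0 < nd z \<and> nd z < 2 * \<rho>" by (simp add: nd_pos_iff)
    have wx: "0 \<le> real w * x" "real w * x < real w" using x assms by auto
    then have "- 1 < real_of_int n" "real_of_int n < real w + 1" using n(2) assms(5) by linarith+
    then have "0 \<le> n" "n \<le> int w" by linarith+
    moreover have "n \<noteq> int w"
    proof
      assume "n = int w"
      then have "z = of_int (int v)" unfolding z using assms by simp
      then show False using \<open>z \<notin> \<int>\<close> by (metis Ints_of_int)
    qed
    ultimately have "n \<in> G" using nz db by (simp add: G_def z_def)
    moreover have "x \<in> J n" using n(2) by (simp add: iff)
    ultimately show "x \<in> (\<Union>n\<in>G. J n)" by blast
  qed
  then have "measure lborel (reduced_hits v \<rho> \<inter> reduced_hits w \<rho>' \<inter> {0..<1}) \<le> measure lborel (\<Union>n\<in>G. J n)"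
    using fm finG by (intro measure_mono_fmeasurable fmeasurable.finite_UN) auto
  also have "\<dots> \<le> (\<Sum>n\<in>G. measure lborel (J n))"
    using fm finG by (intro measure_UNION_le) (auto simp: fmeasurable_def)
  also have "\<dots> = card G * (2 * \<rho>' / w)" by (simp add: len)
  also have "\<dots> \<le> 4 * \<rho> * w * (2 * \<rho>' / w)"
    using card_G assms by (intro mult_right_mono) auto
  also have "\<dots> = 8 * \<rho> * \<rho>'" using assms by simp
  finally show ?thesis by (subst measure_circ) auto
qed

section \<open>A zero-one law for the doubling map\<close>

text \<open>The complement \<open>B\<close> contains its preimages under \<open>x \<mapsto> 2 ^ k * x\<close>, which spread evenly: in every
  interval they have density close to \<open>\<beta>\<close>, the measure of \<open>B\<close>. So \<open>B\<close> has density at least \<open>\<beta>\<close> in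
  every interval, and its total mass forces equality. Lebesgue measure restricted to \<open>B\<close> is therefore
  \<open>\<beta>\<close> times Lebesgue measure, which is impossible for \<open>\<beta> > 0\<close> since it gives no mass to \<open>A\<close>.\<close>

theorem doubling_zero_one:
  assumes "periodic A" and [measurable]: "A \<in> sets borel" and dbl: "\<And>x. x \<in> A \<Longrightarrow> 2 * x \<in> A"
    and pos: "0 < measure circ A"
  shows "measure circ A = 1"
proof -
  define B where "B = - A"
  define \<beta> where "\<beta> = measure circ B"
  have [measurable]: "B \<in> sets borel" unfolding B_def by (rule borel_comp) simp
  have perB: "periodic B" using assms(1) by (auto simp: periodic_def B_def)
  have halve: "x \<in> B" if "2 ^ k * x \<in> B" for x k
    using that
  proof (induction k arbitrary: x)
    case (Suc k)
    then have "2 ^ k * (2 * x) \<in> B" by (simp add: algebra_simps)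
    then have "2 * x \<in> B" by (rule Suc.IH)
    then show ?case using dbl by (auto simp: B_def)
  qed simp
  have \<beta>: "0 \<le> \<beta>" "\<beta> \<le> 1" by (auto simp: \<beta>_def)
  have ge: "\<beta> * (u - l) \<le> measure lborel (B \<inter> {l..<u})" if "l \<le> u" for l u
  proof (rule LIMSEQ_le_const2)
    have "(\<lambda>k. \<beta> * (u - l) - \<beta> / 2 ^ k) \<longlonglongrightarrow> \<beta> * (u - l) - 0"
      by (intro tendsto_diff tendsto_const LIMSEQ_divide_realpow_zero) auto
    then show "(\<lambda>k. \<beta> * (u - l) - \<beta> / 2 ^ k) \<longlonglongrightarrow> \<beta> * (u - l)" by simp
    have "\<beta> * (u - l) - \<beta> / 2 ^ k \<le> measure lborel (B \<inter> {l..<u})" for k :: nat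
    proof -
      define n where "n = nat \<lfloor>2 ^ k * (u - l)\<rfloor>"
      have "0 \<le> 2 ^ k * (u - l)" using that by simp
      then have n: "real n \<le> 2 ^ k * (u - l)" "2 ^ k * (u - l) - 1 \<le> real n" unfolding n_def by linarith+
      have "\<beta> * (2 ^ k * (u - l) - 1) \<le> real n * \<beta>" using n \<beta> by (simp add: mult.commute mult_left_mono)
      also have "\<dots> = measure lborel (B \<inter> {2 ^ k * l..<2 ^ k * l + real n})"
        unfolding \<beta>_def by (rule measure_periodic_long_window[OF perB, symmetric]) simp
      also have "\<dots> \<le> measure lborel (B \<inter> {2 ^ k * l..<2 ^ k * u})"
        using n by (intro measure_mono_fmeasurable) (auto simp: algebra_simps)
      also have "\<dots> = 2 ^ k * measure lborel ((\<lambda>x. 2 ^ k * x) -` (B \<inter> {2 ^ k * l..<2 ^ k * u}))"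
        by (subst measure_lborel_stretch) auto
      also have "\<dots> \<le> 2 ^ k * measure lborel (B \<inter> {l..<u})"
      proof (intro mult_left_mono measure_mono_fmeasurable)
        show "(\<lambda>x. 2 ^ k * x) -` (B \<inter> {2 ^ k * l..<2 ^ k * u}) \<subseteq> B \<inter> {l..<u}"
          using halve by auto
        show "(\<lambda>x. 2 ^ k * x) -` (B \<inter> {2 ^ k * l..<2 ^ k * u}) \<in> sets lborel"
          using measurable_sets[of "\<lambda>x::real. 2 ^ k * x" borel borel "B \<inter> {2 ^ k * l..<2 ^ k * u}"] by auto
      qed auto
      finally show ?thesis by (simp add: field_simps)
    qed
    then show "\<exists>N. \<forall>k\<ge>N. \<beta> * (u - l) - \<beta> / 2 ^ k \<le> measure lborel (B \<inter> {l..<u})" by blast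
  qed
  have eq: "measure lborel (B \<inter> {l..<u}) = \<beta> * (u - l)" if "l \<le> u" for l u
  proof -
    obtain n :: nat where "max \<bar>l\<bar> \<bar>u\<bar> \<le> real n" using real_arch_simple by blast
    then have n: "- real n \<le> l" "u \<le> real n" by linarith+
    have "measure lborel (B \<inter> {- real n..<real n}) = measure lborel (B \<inter> {- real n..<l}) + measure lborel (B \<inter> {l..<u})
        + measure lborel (B \<inter> {u..<real n})"
      using n that measure_Int_Ico_split[of B "- real n" l "real n"] measure_Int_Ico_split[of B l u "real n"] by simp
    moreover have "measure lborel (B \<inter> {- real n..<real n}) = \<beta> * (2 * real n)"
      using measure_periodic_long_window[OF perB, of "- real n" "2 * n"] by (simp add: \<beta>_def mult.commute)
    moreover have "\<beta> * (2 * real n) = \<beta> * (l - - real n) + \<beta> * (u - l) + \<beta> * (real n - u)" by (simp add: algebra_simps)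
    ultimately show ?thesis using ge[of "- real n" l] ge[of l u] ge[of u "real n"] n that by linarith
  qed
  have "\<beta> = 0"
  proof (rule ccontr)
    assume "\<beta> \<noteq> 0"
    define M where "M = density lborel (\<lambda>x. ennreal (1 / \<beta>) * indicator B x)"
    have emM: "emeasure M S = ennreal (1 / \<beta>) * emeasure lborel (B \<inter> S)" if [measurable]: "S \<in> sets borel" for S
    proof -
      have "emeasure M S = (\<integral>\<^sup>+x. ennreal (1 / \<beta>) * indicator B x * indicator S x \<partial>lborel)"
        unfolding M_def by (subst emeasure_density) auto
      also have "\<dots> = (\<integral>\<^sup>+x. ennreal (1 / \<beta>) * indicator (B \<inter> S) x \<partial>lborel)"
        by (simp add: indicator_inter_arith mult.assoc)
      finally show ?thesis by (simp add: nn_integral_cmult_indicator)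
    qed
    have "lborel = M"
    proof (rule lborel_eqI)
      fix l u :: real assume "\<And>b. b \<in> Basis \<Longrightarrow> l \<bullet> b \<le> u \<bullet> b"
      then have lu: "l \<le> u" by simp
      have "emeasure lborel (B \<inter> {l<..<u}) = emeasure lborel (B \<inter> {l..<u})"
        using AE_lborel_singleton[of l] by (intro emeasure_eq_AE) (auto elim: eventually_mono)
      also have "\<dots> = ennreal (\<beta> * (u - l))"
        using eq[OF lu] fmeasurable_Int_Ico[of B l u] by (simp add: emeasure_eq_measure2)
      finally have "emeasure M {l<..<u} = ennreal (1 / \<beta>) * ennreal (\<beta> * (u - l))"
        by (simp add: emM)
      also have "\<dots> = ennreal (u - l)"
        using \<open>\<beta> \<noteq> 0\<close> \<beta> lu by (simp add: ennreal_mult[symmetric])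
      finally show "emeasure M (box l u) = ennreal (\<Prod>b\<in>Basis. (u - l) \<bullet> b)" by simp
    qed (simp add: M_def)
    then have "emeasure lborel (A \<inter> {0..<1}) = ennreal (1 / \<beta>) * emeasure lborel (B \<inter> (A \<inter> {0..<1}))"
      using emM[of "A \<inter> {0..<1}"] by simp
    also have "B \<inter> (A \<inter> {0..<1}) = {}" by (auto simp: B_def)
    finally have "measure circ A = 0" by (simp add: emeasure_circ measure_def)
    then show False using pos by simp
  qed
  then show ?thesis
    using circ.prob_compl[of A] by (simp add: \<beta>_def B_def Compl_eq_Diff_UNIV)
qed

section \<open>An inhomogeneous Khinchin theorem\<close>

lemma sum_symmetric_square:
  fixes f :: "nat \<Rightarrow> nat \<Rightarrow> real"
  assumes "\<And>i j. f i j = f j i"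
  shows "(\<Sum>i=1..n. \<Sum>j=1..n. f i j) = (\<Sum>i=1..n. f i i) + 2 * (\<Sum>j=1..n. \<Sum>i=1..<j. f i j)"
proof (induction n)
  case (Suc n)
  have "(\<Sum>i=1..Suc n. \<Sum>j=1..Suc n. f i j)
      = (\<Sum>i=1..n. \<Sum>j=1..n. f i j) + (\<Sum>i=1..n. f i (Suc n)) + (\<Sum>j=1..n. f (Suc n) j) + f (Suc n) (Suc n)"
    by (simp add: sum.distrib)
  also have "(\<Sum>j=1..n. f (Suc n) j) = (\<Sum>i=1..n. f i (Suc n))" by (simp add: assms)
  also have "(\<Sum>i=1..n. f i (Suc n)) = (\<Sum>i=1..<Suc n. f i (Suc n))"
    by (simp add: atLeastLessThanSuc_atLeastAtMost)
  finally show ?case using Suc by (simp add: atLeastLessThanSuc_atLeastAtMost)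
qed simp

lemma sum_divisors_flip:
  fixes g :: "nat \<Rightarrow> real"
  assumes "1 \<le> n"
  shows "(\<Sum>d | d dvd n. g (n div d)) = (\<Sum>d | d dvd n. g d)"
  using assms
  by (intro sum.reindex_bij_witness[of _ "\<lambda>d. n div d" "\<lambda>d. n div d"]) (auto elim!: dvdE)

text \<open>The numbers \<open>q < n\<close> are sorted by their gcd \<open>d\<close> with \<open>n\<close> and written as \<open>q = d * a\<close>.\<close>

lemma sum_by_gcd_le:
  fixes g :: "nat \<Rightarrow> nat \<Rightarrow> real"
  assumes "1 \<le> n" "\<And>d a. 0 \<le> g d a"
  shows "(\<Sum>q=1..<n. g (gcd q n) (q div gcd q n)) \<le> (\<Sum>d | d dvd n. \<Sum>a=1..<n div d. g d a)"
proof -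
  define \<phi> where "\<phi> = (\<lambda>q. (gcd q n, q div gcd q n))"
  have inj: "inj_on \<phi> {1..<n}"
    by (rule inj_onI) (metis Pair_inject \<phi>_def dvd_mult_div_cancel gcd_dvd1)
  have sub: "\<phi> ` {1..<n} \<subseteq> Sigma {d. d dvd n} (\<lambda>d. {1..<n div d})"
  proof
    fix x assume "x \<in> \<phi> ` {1..<n}"
    then obtain q where q: "1 \<le> q" "q < n" "x = \<phi> q" by auto
    have g: "0 < gcd q n" "gcd q n dvd q" "gcd q n dvd n" using q by auto
    then have "1 \<le> q div gcd q n" using q by (simp add: div_greater_zero_iff Suc_le_eq dvd_imp_le)
    moreover have "q div gcd q n < n div gcd q n" using g q(2) by (simp add: div_less_mono)
    ultimately show "x \<in> Sigma {d. d dvd n} (\<lambda>d. {1..<n div d})" using g q(3) by (simp add: \<phi>_def)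
  qed
  have fin: "finite (Sigma {d. d dvd n} (\<lambda>d. {1..<n div d}))" using assms(1) by (intro finite_SigmaI) auto
  have "(\<Sum>q=1..<n. g (gcd q n) (q div gcd q n)) = (\<Sum>(d, a)\<in>\<phi> ` {1..<n}. g d a)"
    using inj by (simp add: sum.reindex \<phi>_def)
  also have "\<dots> \<le> (\<Sum>(d, a)\<in>Sigma {d. d dvd n} (\<lambda>d. {1..<n div d}). g d a)"
    using fin sub assms(2) by (intro sum_mono2) auto
  also have "\<dots> = (\<Sum>d | d dvd n. \<Sum>a=1..<n div d. g d a)"
    using assms(1) by (subst sum.Sigma) auto
  finally show ?thesis .
qed

lemma card_rev_block_le:
  "card {a \<in> {1..<b::nat}. P (b - a)} \<le> card {n \<in> {0..<0 + int b}. P (nat n)}"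
proof (rule card_inj_on_le)
  show "inj_on (\<lambda>a. int (b - a)) {a \<in> {1..<b}. P (b - a)}" by (auto simp: inj_on_def)
qed (auto simp: nat_diff_distrib)

lemma (in prob_space) AE_infinitely_often_if_prob_1:
  fixes A :: "nat \<Rightarrow> 'a set"
  assumes [measurable]: "\<And>i. A i \<in> events" and "1 \<le> prob {x \<in> space M. \<exists>\<^sub>\<infinity>i. x \<in> A i}"
  shows "AE x in M. \<exists>\<^sub>\<infinity>i. x \<in> A i"
proof -
  have "{x \<in> space M. \<exists>\<^sub>\<infinity>i. x \<in> A i} \<in> events" unfolding INFM_nat by measurable
  moreover have "prob {x \<in> space M. \<exists>\<^sub>\<infinity>i. x \<in> A i} = 1" using assms(2) prob_le_1 by (rule antisym[rotated])
  ultimately show ?thesis using prob_eq_1 by (auto elim: eventually_mono)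
qed

lemma summable_powr_over_n:
  assumes "0 < s"
  shows "summable (\<lambda>d. real d powr (- s) / real d)"
proof -
  have "summable (\<lambda>d. real d powr (- s - 1))" using assms by (simp add: summable_real_powr_iff)
  moreover have "real d powr (- s - 1) = real d powr (- s) / real d" for d
    by (cases "d = 0") (simp_all add: powr_diff)
  ultimately show ?thesis by simp
qed

context diophantine
begin

text \<open>Below \<open>b / sqrt d\<close> there are few candidates \<open>a\<close>. Above it the radius is at most \<open>1 / sqrt d\<close>
  and the discrepancy bound applies.\<close>

lemma card_resonant_le:
  assumes "1 \<le> d" "1 \<le> b"
  shows "real (card {a \<in> {1..<b}. nd (real (b - a) * \<xi>) < b / (real d * real a)})
    \<le> b * (3 * real d powr (- \<eta>) + K\<^sub>0 * real b powr (- \<eta>))"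
proof -
  define \<rho> where "\<rho> = real d powr (- 1 / 2)"
  have \<rho>: "0 < \<rho>" "\<rho> \<le> real d powr (- \<eta>)"
    using assms \<eta>_bounds unfolding \<rho>_def by (auto intro!: powr_mono)
  have \<rho>2: "\<rho> * \<rho> = 1 / d" using assms by (simp add: \<rho>_def powr_add[symmetric] powr_minus_divide)
  define X where "X = {a \<in> {1..<b}. nd (real (b - a) * \<xi>) < \<rho>}"
  have "{a \<in> {1..<b}. nd (real (b - a) * \<xi>) < b / (real d * real a)} \<subseteq> {1..nat \<lfloor>b * \<rho>\<rfloor>} \<union> X"
  proof
    fix a assume a: "a \<in> {a \<in> {1..<b}. nd (real (b - a) * \<xi>) < b / (real d * real a)}"
    show "a \<in> {1..nat \<lfloor>b * \<rho>\<rfloor>} \<union> X"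
    proof (cases "real a \<le> b * \<rho>")
      case True
      then show ?thesis using a by (simp add: le_nat_floor)
    next
      case False
      have "b / (real d * real a) = (b * \<rho>) * \<rho> / a" using a \<rho>2 by (simp add: mult.assoc)
      also have "\<dots> \<le> a * \<rho> / a" using False \<rho> a by (intro divide_right_mono mult_right_mono) auto
      also have "\<dots> = \<rho>" using a by simp
      finally show ?thesis using a by (auto simp: X_def)
    qed
  qed
  then have "card {a \<in> {1..<b}. nd (real (b - a) * \<xi>) < b / (real d * real a)} \<le> card ({1..nat \<lfloor>b * \<rho>\<rfloor>} \<union> X)"
    by (intro card_mono) (auto simp: X_def)
  also have "\<dots> \<le> nat \<lfloor>b * \<rho>\<rfloor> + card X" using card_Un_le[of "{1..nat \<lfloor>b * \<rho>\<rfloor>}" X] by simp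
  finally have "real (card {a \<in> {1..<b}. nd (real (b - a) * \<xi>) < b / (real d * real a)}) \<le> real (nat \<lfloor>b * \<rho>\<rfloor>) + real (card X)"
    by linarith
  also have "real (nat \<lfloor>b * \<rho>\<rfloor>) \<le> b * \<rho>" using \<rho> by simp
  also have "real (card X) \<le> 2 * \<rho> * b + K\<^sub>0 * real b powr (1 - \<eta>)"
  proof -
    have "card X \<le> card {n \<in> {0..<0 + int b}. nd (real (nat n) * \<xi>) < \<rho>}"
      unfolding X_def by (rule card_rev_block_le)
    also have "{n \<in> {0..<0 + int b}. nd (real (nat n) * \<xi>) < \<rho>} = {n \<in> {0..<0 + int b}. nd (of_int n * (real 1 * \<xi>) - 0) < \<rho>}"
      by auto
    finally show ?thesis using card_close_le[of 1 \<rho> 0 b 0] \<rho> by simp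
  qed
  also have "real b powr (1 - \<eta>) = b * real b powr (- \<eta>)"
    using assms powr_add[of "real b" 1 "- \<eta>"] by simp
  also have "b * \<rho> + (2 * \<rho> * b + K\<^sub>0 * (b * real b powr (- \<eta>))) = b * (3 * \<rho> + K\<^sub>0 * real b powr (- \<eta>))"
    by (simp add: algebra_simps)
  also have "\<dots> \<le> b * (3 * real d powr (- \<eta>) + K\<^sub>0 * real b powr (- \<eta>))"
    using \<rho> by (intro mult_left_mono add_right_mono) auto
  finally show ?thesis by simp
qed

text \<open>The gcd term of the overlap of \<open>hits \<xi> q\<close> and \<open>hits \<xi> n\<close>, kept only if the overlap can be
  nonempty.\<close>

definition near_return :: "real \<Rightarrow> nat \<Rightarrow> nat \<Rightarrow> real" where
  "near_return \<delta> q n = (if nd (real (n div gcd q n - q div gcd q n) * \<xi>) < 2 * real (n div gcd q n) * \<delta>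
    then real (gcd q n) / real n else 0)"

lemma hits_pair_le:
  assumes "1 \<le> q" "q < n" "0 \<le> r'" "r' \<le> r"
  shows "measure circ (hits \<xi> q r \<inter> hits \<xi> n r') \<le> 4 * r * r' + 2 * r' * near_return r q n"
proof (cases "hits \<xi> q r \<inter> hits \<xi> n r' = {}")
  case True
  then show ?thesis using assms by (simp add: near_return_def)
next
  case False
  then obtain x where x: "x \<in> hits \<xi> q r \<inter> hits \<xi> n r'" by blast
  define d where "d = gcd q n"
  obtain a b where ab: "q = d * a" "n = d * b" "1 \<le> a" "1 \<le> b"
    unfolding d_def by (rule gcd_factors[of q n]) (use assms in auto)
  have d: "1 \<le> d" using assms by (simp add: d_def Suc_le_eq)
  have div: "n div d = b" "q div d = a" using ab d by auto
  have "a < b" using assms(2) d unfolding ab(1,2) by simp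
  have "nd ((real b - real a) * \<xi>) < b * r + a * r'"
    using hits_overlap_empty[OF assms(1) _ _ assms(3) x] assms unfolding d_def[symmetric] div by auto
  also have "\<dots> \<le> b * r + b * r" using assms \<open>a < b\<close> by (intro add_left_mono mult_mono) auto
  also have "\<dots> = 2 * real b * r" by simp
  finally have "near_return r q n = d / n"
    using \<open>a < b\<close> unfolding near_return_def d_def[symmetric] div by (simp add: of_nat_diff)
  moreover have "measure circ (hits \<xi> q r \<inter> hits \<xi> n r') \<le> measure circ (hits \<xi> n r') * (2 * r + d / n)"
    unfolding d_def using assms by (intro hits_overlap_le) auto
  moreover have "measure circ (hits \<xi> n r') * (2 * r + d / n) \<le> 2 * r' * (2 * r + d / n)"
    using assms by (intro mult_right_mono measure_hits_le) auto
  ultimately show ?thesis by (simp add: algebra_simps)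
qed

text \<open>The value of \<open>near_return\<close> at the radius \<open>1 / (2 * q)\<close>, an upper bound for all smaller radii.\<close>

definition resonance :: "nat \<Rightarrow> nat \<Rightarrow> real" where
  "resonance q n = (if nd (real (n div gcd q n - q div gcd q n) * \<xi>)
      < real (n div gcd q n) / (real (gcd q n) * real (q div gcd q n)) then real (gcd q n) / real n else 0)"

lemma near_return_le_resonance:
  assumes "1 \<le> q" "q < n" "r \<le> 1 / (2 * real q)"
  shows "near_return r q n \<le> resonance q n"
proof -
  define d where "d = gcd q n"
  define b where "b = n div d"
  have "q = d * (q div d)" by (simp add: d_def)
  then have q: "real q = real d * real (q div d)" by (metis of_nat_mult)
  have "2 * real b * r \<le> 2 * real b * (1 / (2 * real q))" using assms(3) by (intro mult_left_mono) auto
  also have "\<dots> = b / (real d * real (q div d))" by (simp add: q)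
  finally show ?thesis unfolding near_return_def resonance_def d_def b_def by auto
qed

lemma sum_resonance_le:
  assumes "1 \<le> n"
  shows "(\<Sum>q=1..<n. resonance q n) \<le> (3 + K\<^sub>0) * (\<Sum>d | d dvd n. real d powr (- \<eta>))"
proof -
  define g where "g = (\<lambda>d a. if nd (real (n div d - a) * \<xi>) < real (n div d) / (real d * real a) then real d / real n else (0::real))"
  have "(\<Sum>q=1..<n. resonance q n) = (\<Sum>q=1..<n. g (gcd q n) (q div gcd q n))"
    by (simp add: resonance_def g_def)
  also have "\<dots> \<le> (\<Sum>d | d dvd n. \<Sum>a=1..<n div d. g d a)"
    using assms by (intro sum_by_gcd_le) (auto simp: g_def)
  also have "\<dots> \<le> (\<Sum>d | d dvd n. 3 * real d powr (- \<eta>) + K\<^sub>0 * real (n div d) powr (- \<eta>))"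
  proof (rule sum_mono)
    fix d assume "d \<in> {d. d dvd n}"
    then have d: "d dvd n" "1 \<le> d" using assms by (auto simp: Suc_le_eq intro: dvd_pos_nat)
    define b where "b = n div d"
    have b: "n = d * b" "1 \<le> b" using d assms by (auto simp: b_def Suc_le_eq div_greater_zero_iff dvd_imp_le)
    have "(\<Sum>a=1..<b. g d a) = d / n * card {a \<in> {1..<b}. nd (real (b - a) * \<xi>) < b / (real d * real a)}"
      unfolding g_def b_def[symmetric] by (subst sum.inter_filter[symmetric]) simp_all
    also have "\<dots> \<le> d / n * (b * (3 * real d powr (- \<eta>) + K\<^sub>0 * real b powr (- \<eta>)))"
      using d b by (intro mult_left_mono card_resonant_le) auto
    also have "\<dots> = 3 * real d powr (- \<eta>) + K\<^sub>0 * real b powr (- \<eta>)"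
      using d b by simp
    finally show "(\<Sum>a=1..<n div d. g d a) \<le> 3 * real d powr (- \<eta>) + K\<^sub>0 * real (n div d) powr (- \<eta>)"
      unfolding b_def .
  qed
  also have "\<dots> = (3 + K\<^sub>0) * (\<Sum>d | d dvd n. real d powr (- \<eta>))"
    using sum_divisors_flip[OF assms, of "\<lambda>d. real d powr (- \<eta>)"]
    by (simp add: sum.distrib sum_distrib_left[symmetric] distrib_right)
  finally show ?thesis .
qed

definition G\<^sub>0 :: real where "G\<^sub>0 = (\<Sum>d. real d powr (- \<eta>) / real d)"

lemma sum_le_G\<^sub>0: "(\<Sum>d=1..Q. real d powr (- \<eta>) / real d) \<le> G\<^sub>0"
  unfolding G\<^sub>0_def using \<eta>_bounds by (intro sum_le_suminf summable_powr_over_n) auto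

text \<open>The number of \<open>q \<le> Q\<close> with \<open>\<alpha> \<in> hits \<xi> q (\<psi> q)\<close> has second moment at most the square of its
  mean plus a multiple of its mean, because the resonant gcd terms are bounded on average over \<open>n\<close>. Its
  mean diverges, so the second moment method with \<open>K = 1\<close> yields full measure.\<close>

theorem khinchin_inhomogeneous:
  fixes \<psi> :: "nat \<Rightarrow> real"
  assumes mono: "\<And>m n. 1 \<le> m \<Longrightarrow> m \<le> n \<Longrightarrow> \<psi> n \<le> \<psi> m" and nonneg: "\<And>n. 0 \<le> \<psi> n"
    and small: "\<And>n. 1 \<le> n \<Longrightarrow> \<psi> n \<le> 1 / (2 * real n)"
    and div: "filterlim (\<lambda>Q. \<Sum>n=1..Q. \<psi> n) at_top sequentially"
  shows "AE \<alpha> in circ. \<exists>\<^sub>\<infinity>q. \<alpha> \<in> hits \<xi> q (\<psi> q)"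
proof -
  define A where "A = (\<lambda>q. hits \<xi> q (\<psi> q))"
  define S where "S = (\<lambda>Q. \<Sum>n=1..Q. measure circ (A n))"
  have half: "\<psi> n \<le> 1 / 2" if "1 \<le> n" for n
  proof -
    have "1 / (2 * real n) \<le> 1 / 2" using that by (simp add: field_simps)
    with small[OF that] show ?thesis by linarith
  qed
  have mA: "measure circ (A n) = 2 * \<psi> n" if "1 \<le> n" for n
    unfolding A_def using that half[OF that] nonneg by (intro measure_hits) auto
  have S: "S Q = 2 * (\<Sum>n=1..Q. \<psi> n)" for Q
    unfolding S_def sum_distrib_left by (intro sum.cong mA) auto
  define C where "C = 1 + 2 * (3 + K\<^sub>0) * G\<^sub>0"
  have "1 / 1 \<le> measure circ {x \<in> space circ. \<exists>\<^sub>\<infinity>i. x \<in> A i}"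
  proof (rule circ.second_moment_limsup[where F = "\<lambda>n. {1..n}" and C = C])
    show "filterlim (\<lambda>Q. \<Sum>n\<in>{1..Q}. measure circ (A n)) at_top sequentially"
      using filterlim_tendsto_pos_mult_at_top[OF tendsto_const _ div, of 2] S unfolding S_def by simp
    fix Q
    have "(\<Sum>q=1..Q. \<Sum>n=1..Q. measure circ (A q \<inter> A n))
        = (\<Sum>n=1..Q. measure circ (A n)) + 2 * (\<Sum>n=1..Q. \<Sum>q=1..<n. measure circ (A q \<inter> A n))"
      by (subst sum_symmetric_square) (auto simp: Int_commute)
    moreover have "(\<Sum>n=1..Q. \<Sum>q=1..<n. measure circ (A q \<inter> A n))
        \<le> (\<Sum>n=1..Q. \<Sum>q=1..<n. 4 * \<psi> q * \<psi> n + 2 * \<psi> n * resonance q n)"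
    proof (intro sum_mono)
      fix n q assume nq: "n \<in> {1..Q}" "q \<in> {1..<n}"
      have "measure circ (A q \<inter> A n) \<le> 4 * \<psi> q * \<psi> n + 2 * \<psi> n * near_return (\<psi> q) q n"
        unfolding A_def using nq by (intro hits_pair_le nonneg mono) auto
      also have "\<dots> \<le> 4 * \<psi> q * \<psi> n + 2 * \<psi> n * resonance q n"
        using nq nonneg by (intro add_left_mono mult_left_mono near_return_le_resonance small) auto
      finally show "measure circ (A q \<inter> A n) \<le> 4 * \<psi> q * \<psi> n + 2 * \<psi> n * resonance q n" .
    qed
    moreover have "(\<Sum>n=1..Q. \<Sum>q=1..<n. 4 * \<psi> q * \<psi> n + 2 * \<psi> n * resonance q n)
        = (\<Sum>n=1..Q. \<Sum>q=1..<n. 4 * \<psi> q * \<psi> n) + 2 * (\<Sum>n=1..Q. \<psi> n * (\<Sum>q=1..<n. resonance q n))"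
      by (simp add: sum.distrib sum_distrib_left mult.assoc)
    moreover have "(\<Sum>n=1..Q. \<psi> n * (\<Sum>q=1..<n. resonance q n)) \<le> (3 + K\<^sub>0) * (G\<^sub>0 * (\<Sum>n=1..Q. \<psi> n))"
    proof -
      have "(\<Sum>n=1..Q. \<psi> n * (\<Sum>q=1..<n. resonance q n))
        \<le> (\<Sum>n=1..Q. \<psi> n * ((3 + K\<^sub>0) * (\<Sum>d | d dvd n. real d powr (- \<eta>))))"
      by (intro sum_mono mult_left_mono sum_resonance_le nonneg) auto
    also have "\<dots> = (3 + K\<^sub>0) * (\<Sum>n=1..Q. \<psi> n * (\<Sum>d | d dvd n. real d powr (- \<eta>)))"
      by (simp add: sum_distrib_left mult_ac)
    also have "\<dots> \<le> (3 + K\<^sub>0) * (G\<^sub>0 * (\<Sum>n=1..Q. \<psi> n))"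
      using K\<^sub>0_pos by (intro mult_left_mono sum_divisors_average mono nonneg sum_le_G\<^sub>0) auto
      finally show ?thesis .
    qed
    ultimately have "(\<Sum>q=1..Q. \<Sum>n=1..Q. measure circ (A q \<inter> A n))
        \<le> S Q + 2 * (\<Sum>n=1..Q. \<Sum>q=1..<n. 4 * \<psi> q * \<psi> n) + 4 * ((3 + K\<^sub>0) * (G\<^sub>0 * (\<Sum>n=1..Q. \<psi> n)))"
      unfolding S_def by linarith
    moreover have "2 * (\<Sum>n=1..Q. \<Sum>q=1..<n. 4 * \<psi> q * \<psi> n) \<le> (S Q)\<^sup>2"
    proof -
      have "(S Q)\<^sup>2 = (\<Sum>q=1..Q. \<Sum>n=1..Q. 4 * \<psi> q * \<psi> n)"
        unfolding S power2_eq_square by (simp add: sum_product sum_distrib_left mult_ac)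
      also have "\<dots> = (\<Sum>n=1..Q. 4 * \<psi> n * \<psi> n) + 2 * (\<Sum>n=1..Q. \<Sum>q=1..<n. 4 * \<psi> q * \<psi> n)"
        by (rule sum_symmetric_square) simp
      finally show ?thesis using nonneg by (simp add: sum_nonneg)
    qed
    moreover have "C * S Q = S Q + 4 * ((3 + K\<^sub>0) * (G\<^sub>0 * (\<Sum>n=1..Q. \<psi> n)))"
      unfolding C_def S by (simp add: algebra_simps)
    ultimately show "(\<Sum>q\<in>{1..Q}. \<Sum>n\<in>{1..Q}. measure circ (A q \<inter> A n))
        \<le> 1 * (\<Sum>n\<in>{1..Q}. measure circ (A n))\<^sup>2 + C * (\<Sum>n\<in>{1..Q}. measure circ (A n))"
      unfolding S_def by linarith
  qed (auto simp: A_def)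
  then show ?thesis
    using circ.AE_infinitely_often_if_prob_1[of A] by (simp add: A_def)
qed

end

section \<open>Denominators in a Bohr set\<close>

lemma sum_inverse_squares_tail:
  assumes "1 \<le> m"
  shows "(\<Sum>l\<in>{m<..N}. 1 / (real l)\<^sup>2) \<le> 1 / real m"
proof -
  have tele: "(\<Sum>l\<in>{m<..N}. 1 / (real l)\<^sup>2) \<le> 1 / real m - 1 / real N" if "m \<le> N"
    using that
  proof (induction N rule: dec_induct)
    case (step N)
    have "1 / (real (Suc N))\<^sup>2 \<le> 1 / real N - 1 / real (Suc N)"
      using step(1) assms by (simp add: divide_simps power2_eq_square)
    moreover have "{m<..Suc N} = insert (Suc N) {m<..N}" using step by auto
    ultimately show ?case using step by simp
  qed simp
  show ?thesis
  proof (cases "m \<le> N")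
    case True
    have "0 \<le> 1 / real N" by simp
    with tele[OF True] show ?thesis by linarith
  qed simp
qed

lemma real_div_bounds:
  fixes n d :: nat
  shows "real (n div d) \<le> real n / real d" "real n / real d \<le> real (n div d) + 1"
  using floor_divide_of_nat_eq[of n d, where 'a = real] by linarith+

lemma card_multiples_le:
  assumes "1 \<le> (l::nat)"
  shows "real (card {p \<in> {1..v}. l dvd p}) \<le> real v / real l"
proof -
  have "real (card {p \<in> {1..v}. l dvd p}) = (\<Sum>n | n \<in> {1..v} \<and> l dvd n. 1)" by simp
  also have "\<dots> \<le> (\<Sum>n=1..v. 1) / real l" using assms by (intro sum_over_multiples_le) auto
  finally show ?thesis by simp
qed

text \<open>The gcd of \<open>p\<close> and \<open>v\<close> itself serves as the common divisor \<open>l\<close>.\<close>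

lemma card_not_coprime_le:
  fixes v :: nat
  shows "real (card {p \<in> {1..<v}. \<not> coprime p v}) \<le> (\<Sum>l | l \<in> {2..v} \<and> l dvd v. real v / real l)"
proof -
  have "{p \<in> {1..<v}. \<not> coprime p v} \<subseteq> (\<Union>l\<in>{l. l \<in> {2..v} \<and> l dvd v}. {p \<in> {1..v}. l dvd p})"
  proof
    fix p assume p: "p \<in> {p \<in> {1..<v}. \<not> coprime p v}"
    then have "gcd p v \<noteq> 1" "gcd p v \<noteq> 0" by (auto simp: coprime_iff_gcd_eq_1)
    then have "2 \<le> gcd p v" by linarith
    moreover have "gcd p v \<le> v" using p by (intro dvd_imp_le) auto
    ultimately show "p \<in> (\<Union>l\<in>{l. l \<in> {2..v} \<and> l dvd v}. {p \<in> {1..v}. l dvd p})"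
      using p by (intro UN_I[of "gcd p v"]) auto
  qed
  then have "card {p \<in> {1..<v}. \<not> coprime p v} \<le> card (\<Union>l\<in>{l. l \<in> {2..v} \<and> l dvd v}. {p \<in> {1..v}. l dvd p})"
    by (intro card_mono) auto
  also have "\<dots> \<le> (\<Sum>l | l \<in> {2..v} \<and> l dvd v. card {p \<in> {1..v}. l dvd p})"
    by (intro card_UN_le) auto
  finally have "real (card {p \<in> {1..<v}. \<not> coprime p v}) \<le> real (\<Sum>l | l \<in> {2..v} \<and> l dvd v. card {p \<in> {1..v}. l dvd p})"
    by (rule of_nat_mono)
  also have "\<dots> = (\<Sum>l | l \<in> {2..v} \<and> l dvd v. real (card {p \<in> {1..v}. l dvd p}))"
    by (rule of_nat_sum)
  also have "\<dots> \<le> (\<Sum>l | l \<in> {2..v} \<and> l dvd v. real v / real l)"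
    by (intro sum_mono card_multiples_le) auto
  finally show ?thesis .
qed

text \<open>A denominator congruent to 1 modulo this number has only divisors \<open>l > 200\<close> apart from 1. The sum of
  \<open>1 / l\<^sup>2\<close> over these is small enough to absorb the constants of the counting bounds. The modulus is
  even, so such denominators are also odd.\<close>

definition sieve_modulus :: nat where "sieve_modulus = fact 200"

lemma sieve_modulus_dvd: "1 \<le> l \<Longrightarrow> l \<le> 200 \<Longrightarrow> l dvd sieve_modulus"
  unfolding sieve_modulus_def by (rule dvd_fact)

lemma sieve_modulus_ge: "2 \<le> sieve_modulus"
proof -
  have "0 < sieve_modulus" unfolding sieve_modulus_def by (rule fact_gt_zero)
  moreover have "2 dvd sieve_modulus" by (rule sieve_modulus_dvd) auto
  ultimately show ?thesis by (intro dvd_imp_le)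
qed

context diophantine
begin

text \<open>The arc around \<open>\<beta>\<close> shrinks like a power of \<open>n\<close>, that is, of the logarithm of the denominator.\<close>

definition bohr_window :: "real \<Rightarrow> real \<Rightarrow> nat \<Rightarrow> nat set" where
  "bohr_window \<beta> a n = {v \<in> {2 ^ n..<2 ^ Suc n}. v mod sieve_modulus = 1 \<and> nd (real v * \<xi> - \<beta>) < real n powr (- a)}"

lemma finite_bohr_window [simp]: "finite (bohr_window \<beta> a n)"
  by (simp add: bohr_window_def)

text \<open>Along \<open>v = 1 + D * u\<close> the condition on \<open>v\<close> becomes a condition on the rotation by \<open>D * \<xi>\<close>, whose
  discrepancy is a power of \<open>2 ^ n\<close> smaller than the length, hence negligible against
  \<open>n powr (- a)\<close>.\<close>

lemma card_bohr_window_ge: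
  assumes "0 < a"
  shows "eventually (\<lambda>n. real n powr (- a) * 2 ^ n / (2 * sieve_modulus) \<le> card (bohr_window \<beta> a n)) sequentially"
proof -
  define D where "D = sieve_modulus"
  have D: "2 \<le> D" using sieve_modulus_ge by (simp add: D_def)
  have Dpos: "0 < real D" using D by simp
  have "eventually (\<lambda>n::nat. real n powr (- a) \<le> 1 / 2) sequentially" using assms by real_asymp
  moreover have "eventually (\<lambda>n::nat. real n powr (- a) * 2 ^ n / (2 * D)
      \<le> 2 * real n powr (- a) * (2 ^ n / D - 2) - K\<^sub>0 * D * (2 ^ n / D) powr (1 - \<eta>)) sequentially"
    using \<eta>_bounds K\<^sub>0_pos Dpos by real_asymp
  moreover have "eventually (\<lambda>n::nat. real D \<le> 2 ^ n) sequentially" by real_asymp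
  ultimately show ?thesis
  proof eventually_elim
    case (elim n)
    define \<rho> where "\<rho> = real n powr (- a)"
    define L where "L = 2 ^ n div D - 1"
    define k where "k = int (2 ^ n div D + 1)"
    define Y where "Y = {m \<in> {k..<k + int L}. nd (of_int m * (real D * \<xi>) - (\<beta> - \<xi>)) < \<rho>}"
    have "1 \<le> 2 ^ n div D" using elim(3) D
    proof -
      have "real D \<le> real (2 ^ n)" using elim(3) by simp
      then have "D \<le> 2 ^ n" by (simp only: of_nat_le_iff)
      then show ?thesis using D by (simp add: Suc_le_eq div_greater_zero_iff)
    qed
    have "real (2 ^ n div D) \<le> real (2 ^ n) / real D" by (rule real_div_bounds)
    moreover have "real (2 ^ n) / real D - 1 \<le> real (2 ^ n div D)"
      using real_div_bounds(2)[of "2 ^ n" D] by linarith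
    ultimately have L: "real L \<le> 2 ^ n / D" "2 ^ n / D - 2 \<le> real L"
      using \<open>1 \<le> 2 ^ n div D\<close> unfolding L_def by (simp_all add: of_nat_diff)
    have "(\<lambda>m. nat (1 + int D * m)) ` Y \<subseteq> bohr_window \<beta> a n"
    proof
      fix v assume "v \<in> (\<lambda>m. nat (1 + int D * m)) ` Y"
      then obtain m where m: "m \<in> Y" "v = nat (1 + int D * m)" by blast
      define u where "u = nat m"
      have u: "2 ^ n div D + 1 \<le> u" "u < 2 ^ n div D + 1 + L" "m = int u"
        using m(1) by (auto simp: Y_def k_def u_def)
      have v: "v = 1 + D * u" unfolding m(2) u(3) by (simp add: nat_add_distrib nat_mult_distrib)
      have "2 ^ n < D * (2 ^ n div D + 1)" using D by (simp add: dividend_less_times_div)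
      also have "\<dots> \<le> D * u" using u(1) by (rule mult_le_mono2)
      finally have "2 ^ n \<le> v" unfolding v by simp
      moreover have "v < 2 ^ Suc n"
      proof -
        have "u + 1 \<le> 2 * (2 ^ n div D)" using u(2) \<open>1 \<le> 2 ^ n div D\<close> unfolding L_def by linarith
        then have "D * (u + 1) \<le> D * (2 * (2 ^ n div D))" by (rule mult_le_mono2)
        also have "\<dots> = 2 * (D * (2 ^ n div D))" by simp
        also have "\<dots> \<le> 2 * 2 ^ n" by (intro mult_le_mono2) simp
        finally show ?thesis using D unfolding v by simp
      qed
      moreover have "v mod D = 1" using D mod_mult_self2[of 1 D u] unfolding v by simp
      moreover have "nd (real v * \<xi> - \<beta>) < \<rho>"
      proof -
        have "real v * \<xi> - \<beta> = of_int m * (real D * \<xi>) - (\<beta> - \<xi>)" unfolding v u(3) by (simp add: algebra_simps)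
        with m(1) show ?thesis by (simp only: Y_def mem_Collect_eq)
      qed
      ultimately show "v \<in> bohr_window \<beta> a n" by (simp add: bohr_window_def D_def \<rho>_def)
    qed
    moreover have "inj_on (\<lambda>m. nat (1 + int D * m)) Y"
    proof (rule inj_onI)
      fix x y assume xy: "x \<in> Y" "y \<in> Y" "nat (1 + int D * x) = nat (1 + int D * y)"
      have "0 \<le> k" by (simp add: k_def)
      then have "0 \<le> x" "0 \<le> y" using xy(1,2) by (auto simp: Y_def)
      then have "0 \<le> int D * x" "0 \<le> int D * y" by simp_all
      then have "int D * x = int D * y" using xy(3) by linarith
      then show "x = y" using D by simp
    qed
    ultimately have "card Y \<le> card (bohr_window \<beta> a n)"
      by (intro card_inj_on_le) auto
    moreover have "2 * \<rho> * real L - K\<^sub>0 * D * real L powr (1 - \<eta>) \<le> real (card Y)"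
      using discrepancy[of D \<rho> k L "\<beta> - \<xi>"] elim(1) D unfolding Y_def \<rho>_def by simp
    moreover have "K\<^sub>0 * D * real L powr (1 - \<eta>) \<le> K\<^sub>0 * D * (2 ^ n / D) powr (1 - \<eta>)"
      using L K\<^sub>0_pos \<eta>_bounds by (intro mult_left_mono powr_mono2) auto
    moreover have "2 * \<rho> * (2 ^ n / D - 2) \<le> 2 * \<rho> * real L"
      using L by (intro mult_left_mono) (auto simp: \<rho>_def)
    ultimately show ?case using elim(2) unfolding \<rho>_def D_def by linarith
  qed
qed

text \<open>Any two such \<open>v\<close> differ by a multiple of \<open>D * l\<close>, so they are counted by returns of the rotation by
  \<open>D * l * \<xi>\<close>.\<close>

lemma card_bohr_multiples_le:
  assumes "1 \<le> (l::nat)"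
  shows "real (card {v \<in> bohr_window \<beta> a n. l dvd v})
    \<le> 2 * real n powr (- a) * (2 ^ n div (sieve_modulus * l) + 1)
      + K\<^sub>0 * (sieve_modulus * l) * real (2 ^ n div (sieve_modulus * l) + 1) powr (1 - \<eta>)"
proof (cases "{v \<in> bohr_window \<beta> a n. l dvd v} = {}")
  case True
  then show ?thesis using K\<^sub>0_pos by (simp only: card.empty) simp
next
  case False
  define D where "D = sieve_modulus"
  have D: "2 \<le> D" using sieve_modulus_ge by (simp add: D_def)
  define W where "W = {v \<in> bohr_window \<beta> a n. l dvd v}"
  define v\<^sub>0 where "v\<^sub>0 = Min W"
  have finW: "finite W" by (simp add: W_def)
  have v0: "v\<^sub>0 \<in> W" "\<And>v. v \<in> W \<Longrightarrow> v\<^sub>0 \<le> v"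
    using False finW unfolding v\<^sub>0_def W_def[symmetric] by (auto intro: Min_in)
  define L where "L = 2 ^ n div (D * l) + 1"
  define Y where "Y = {t \<in> {0..<0 + int L}. nd (of_int t * (real (D * l) * \<xi>) - (\<beta> - v\<^sub>0 * \<xi>)) < real n powr (- a)}"
  have "D * l dvd v - v\<^sub>0" if "v \<in> W" for v
  proof -
    have "v mod D = v\<^sub>0 mod D" "l dvd v - v\<^sub>0" "1 = v\<^sub>0 mod D" "l dvd v\<^sub>0"
      using that v0(1) by (auto simp: W_def bohr_window_def D_def)
    moreover have "D dvd v - v\<^sub>0"
      using v0(2)[OF that] \<open>v mod D = v\<^sub>0 mod D\<close> by (simp add: mod_eq_dvd_iff_nat)
    moreover have "coprime D l"
    proof (rule coprimeI)
      fix c assume "c dvd D" "c dvd l"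
      then have "c dvd v\<^sub>0 mod D" using \<open>l dvd v\<^sub>0\<close> by (metis dvd_mod dvd_trans)
      then show "is_unit c" using \<open>1 = v\<^sub>0 mod D\<close> by simp
    qed
    ultimately show ?thesis by (simp add: divides_mult)
  qed
  note dvd = this
  have step: "\<exists>t. v = v\<^sub>0 + D * l * t" if vW: "v \<in> W" for v
  proof -
    obtain t where "v - v\<^sub>0 = D * l * t" using dvd[OF vW] unfolding dvd_def by blast
    then have "v = v\<^sub>0 + D * l * t" using v0(2)[OF vW] by linarith
    then show ?thesis by blast
  qed
  have "W \<subseteq> (\<lambda>t. v\<^sub>0 + D * l * nat t) ` Y"
  proof
    fix v assume v: "v \<in> W"
    then obtain t where t: "v = v\<^sub>0 + D * l * t" using step by blast
    have "2 ^ n \<le> v\<^sub>0" "v < 2 ^ Suc n" using v v0(1) by (auto simp: W_def bohr_window_def)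
    then have "D * l * t \<le> 2 ^ n" using t by simp
    then have "t \<le> 2 ^ n div (D * l)" using D assms by (simp add: less_eq_div_iff_mult_less_eq mult.commute)
    moreover have "nd (of_int (int t) * (real (D * l) * \<xi>) - (\<beta> - v\<^sub>0 * \<xi>)) < real n powr (- a)"
    proof -
      have "of_int (int t) * (real (D * l) * \<xi>) - (\<beta> - v\<^sub>0 * \<xi>) = real v * \<xi> - \<beta>"
        unfolding t by (simp add: algebra_simps)
      then show ?thesis using v by (simp only:) (simp add: W_def bohr_window_def)
    qed
    ultimately have "int t \<in> Y" unfolding Y_def L_def by auto
    then show "v \<in> (\<lambda>t. v\<^sub>0 + D * l * nat t) ` Y" using t by (intro image_eqI[of _ _ "int t"]) auto
  qed
  moreover have finY: "finite Y" unfolding Y_def by simp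
  ultimately have "card W \<le> card Y" by (meson card_image_le card_mono finite_imageI le_trans)
  also have "real (card Y) \<le> 2 * real n powr (- a) * L + K\<^sub>0 * (D * l) * real L powr (1 - \<eta>)"
    unfolding Y_def using D assms by (intro card_close_le) auto
  finally show ?thesis unfolding W_def D_def L_def by simp
qed

lemma bohr_multiple_imp_large:
  assumes "v \<in> bohr_window \<beta> a n" "l dvd v" "2 \<le> l"
  shows "200 < l"
proof (rule ccontr)
  assume "\<not> 200 < l"
  then have "l dvd sieve_modulus" using assms by (intro sieve_modulus_dvd) auto
  then have "l dvd v mod sieve_modulus" using assms(2) by (simp add: dvd_mod)
  then show False using assms by (simp add: bohr_window_def)
qed

text \<open>For \<open>l \<le> n\<^sup>2\<close> the dependence of the discrepancy bound on the multiplier \<open>D * l\<close> is polynomial in \<open>n\<close>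
  and is beaten by the saving, which is exponential in \<open>n\<close>.\<close>

lemma card_bohr_multiples_small:
  assumes "0 < a"
  shows "eventually (\<lambda>n. \<forall>l\<in>{1..n\<^sup>2}. real (card {v \<in> bohr_window \<beta> a n. l dvd v})
    \<le> 6 * real n powr (- a) * 2 ^ n / (sieve_modulus * real l)) sequentially"
proof -
  define D where "D = sieve_modulus"
  have D: "2 \<le> D" using sieve_modulus_ge by (simp add: D_def)
  have Dpos: "0 < real D" using D by simp
  have "eventually (\<lambda>n::nat. K\<^sub>0 * D * real n ^ 2 * (2 ^ n / (D * real n ^ 2)) powr (- \<eta>) \<le> real n powr (- a)) sequentially"
    using \<eta>_bounds K\<^sub>0_pos Dpos by real_asymp
  moreover have "eventually (\<lambda>n::nat. D * real n ^ 2 \<le> 2 ^ n) sequentially" by real_asymp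
  ultimately show ?thesis
  proof eventually_elim
    case (elim n)
    show ?case
    proof
      fix l assume l: "l \<in> {1..n\<^sup>2}"
      define L where "L = 2 ^ n div (D * l) + 1"
      define x where "x = 2 ^ n / (real D * real l)"
      have ln: "real l \<le> real n ^ 2" using l by (metis atLeastAtMost_iff of_nat_le_iff of_nat_power)
      have "real D * real l \<le> D * real n ^ 2" using ln by (intro mult_left_mono) auto
      with elim have "real D * real l \<le> 2 ^ n" by linarith
      then have "1 \<le> x" using l D by (simp add: x_def)
      have "real (2 ^ n div (D * l)) \<le> x"
        using real_div_bounds(1)[of "2 ^ n" "D * l"] by (simp add: x_def)
      then have L2: "real L \<le> 2 * x" using \<open>1 \<le> x\<close> by (simp add: L_def)
      have Lx: "x \<le> real L"
        using real_div_bounds(2)[of "2 ^ n" "D * l"] by (simp add: x_def L_def)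
      have "K\<^sub>0 * (D * l) * real L powr (1 - \<eta>) = K\<^sub>0 * (real D * real l) * real L powr (- \<eta>) * real L"
        using powr_add[of "real L" "- \<eta>" 1] by (simp add: L_def)
      also have "\<dots> \<le> K\<^sub>0 * (real D * real n ^ 2) * (2 ^ n / (D * real n ^ 2)) powr (- \<eta>) * real L"
      proof -
        have "2 ^ n / (D * real n ^ 2) \<le> x"
          unfolding x_def using l ln D order_less_le_trans[of 0 "real l" "real n ^ 2"]
          by (intro divide_left_mono mult_left_mono mult_pos_pos) auto
        also note Lx
        finally have "2 ^ n / (D * real n ^ 2) \<le> real L" .
        moreover have "0 < n" using l by (cases n) auto
        ultimately have "real L powr (- \<eta>) \<le> (2 ^ n / (D * real n ^ 2)) powr (- \<eta>)"
          using l D \<eta>_bounds by (intro powr_mono2') auto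
        then show ?thesis using ln K\<^sub>0_pos by (intro mult_right_mono mult_mono) auto
      qed
      also have "\<dots> \<le> real n powr (- a) * real L"
        using elim(1) by (intro mult_right_mono) (auto simp: mult.assoc)
      finally have "2 * real n powr (- a) * L + K\<^sub>0 * (D * l) * real L powr (1 - \<eta>) \<le> 3 * real n powr (- a) * L"
        by (simp add: mult.commute)
      also have "\<dots> \<le> 3 * real n powr (- a) * (2 * x)" using L2 by (intro mult_left_mono) auto
      finally show "real (card {v \<in> bohr_window \<beta> a n. l dvd v}) \<le> 6 * real n powr (- a) * 2 ^ n / (sieve_modulus * real l)"
        using card_bohr_multiples_le[of l \<beta> a n] l unfolding L_def D_def x_def by simp
    qed
  qed
qed

lemma card_bohr_multiples_trivial:
  assumes "1 \<le> (l::nat)" "l < 2 ^ Suc n"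
  shows "real (card {v \<in> bohr_window \<beta> a n. l dvd v}) \<le> 3 * 2 ^ n / real l"
proof -
  have "card {v \<in> bohr_window \<beta> a n. l dvd v} \<le> card {v \<in> {1..2 ^ Suc n}. l dvd v}"
    by (intro card_mono) (auto simp: bohr_window_def intro: Suc_leI order_less_le_trans[of 0 "2 ^ n"])
  also have "real (card {v \<in> {1..2 ^ Suc n}. l dvd v}) \<le> real (2 ^ Suc n) / real l"
    using assms by (intro card_multiples_le) auto
  also have "\<dots> \<le> 3 * 2 ^ n / real l" by (intro divide_right_mono) auto
  finally show ?thesis by simp
qed

text \<open>The pairs with a common divisor \<open>l \<ge> 2\<close> are removed. Divisors up to 200 do not occur. Those up to
  \<open>n\<^sup>2\<close> are controlled by the Bohr set count, which keeps the factor \<open>n powr (- a)\<close>. For the larger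
  ones the trivial count loses this factor, but the tail of \<open>1 / l\<^sup>2\<close> beyond \<open>n\<^sup>2\<close> is of order
  \<open>n powr (- 2)\<close>, which is smaller as \<open>a < 2\<close>.\<close>

theorem bohr_window_coprime_pairs:
  assumes "0 < a" "a < 2"
  shows "eventually (\<lambda>n. 2 ^ n * real (card (bohr_window \<beta> a n)) / 4
    \<le> (\<Sum>v\<in>bohr_window \<beta> a n. real (card {p \<in> {1..<v}. coprime p v}))) sequentially"
proof -
  define D where "D = sieve_modulus"
  have D: "2 \<le> D" using sieve_modulus_ge by (simp add: D_def)
  have Dpos: "0 < real D" using D by simp
  have "eventually (\<lambda>n::nat. 6 / real n ^ 2 \<le> real n powr (- a) / (16 * real D)) sequentially"
    using assms Dpos by real_asymp
  moreover have "eventually (\<lambda>n::nat. 2 \<le> n) sequentially" by (rule eventually_ge_at_top)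
  ultimately show ?thesis using card_bohr_window_ge[OF assms(1), of \<beta>] card_bohr_multiples_small[OF assms(1), of \<beta>]
  proof eventually_elim
    case (elim n)
    define V where "V = bohr_window \<beta> a n"
    define X where "X = (2::real) ^ n"
    define \<kappa> where "\<kappa> = real n powr (- a)"
    have V_ge: "2 ^ n \<le> v" "v < 2 ^ Suc n" if "v \<in> V" for v using that by (auto simp: V_def bohr_window_def)
    have finV: "finite V" by (simp add: V_def)
    have X: "2 \<le> X" "1 \<le> X" using elim(2) power_increasing[of 1 n "2::real"] unfolding X_def by auto
    have W: "real (card {v \<in> V. l dvd v}) * (2 * X / l)
        \<le> (if 200 < l then 12 * \<kappa> * X\<^sup>2 / D * (1 / (real l)\<^sup>2) else 0) + (if n\<^sup>2 < l then 6 * X\<^sup>2 * (1 / (real l)\<^sup>2) else 0)"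
      if l: "l \<in> {2..<2 ^ Suc n}" for l
    proof (cases "200 < l")
      case False
      then have "{v \<in> V. l dvd v} = {}" using bohr_multiple_imp_large l unfolding V_def by fastforce
      then show ?thesis using False Dpos by (simp only: card.empty) (simp add: \<kappa>_def)
    next
      case True
      show ?thesis
      proof (cases "n\<^sup>2 < l")
        case True
        have "real (card {v \<in> V. l dvd v}) * (2 * X / l) \<le> 3 * X / l * (2 * X / l)"
          using card_bohr_multiples_trivial[of l n \<beta> a] l X unfolding V_def X_def by (intro mult_right_mono) auto
        also have "\<dots> = 6 * X\<^sup>2 * (1 / (real l)\<^sup>2)" by (simp add: power2_eq_square)
        also have "\<dots> \<le> 12 * \<kappa> * X\<^sup>2 / D * (1 / (real l)\<^sup>2) + 6 * X\<^sup>2 * (1 / (real l)\<^sup>2)"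
          by (simp add: \<kappa>_def)
        finally show ?thesis using True \<open>200 < l\<close> by simp
      next
        case False
        have "real (card {v \<in> V. l dvd v}) * (2 * X / l) \<le> 6 * \<kappa> * X / (D * real l) * (2 * X / l)"
          using elim(4) l False X unfolding V_def X_def D_def \<kappa>_def by (intro mult_right_mono) auto
        also have "\<dots> = 12 * \<kappa> * X\<^sup>2 / D * (1 / (real l)\<^sup>2)" by (simp add: power2_eq_square)
        finally show ?thesis using True False by simp
      qed
    qed
    have "(\<Sum>v\<in>V. real (card {p \<in> {1..<v}. \<not> coprime p v})) \<le> (\<Sum>v\<in>V. \<Sum>l | l \<in> {2..<2 ^ Suc n} \<and> l dvd v. 2 * X / real l)"
    proof (rule sum_mono)
      fix v assume v: "v \<in> V"
      have "real (card {p \<in> {1..<v}. \<not> coprime p v}) \<le> (\<Sum>l | l \<in> {2..v} \<and> l dvd v. real v / real l)"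
        by (rule card_not_coprime_le)
      also have "\<dots> \<le> (\<Sum>l | l \<in> {2..v} \<and> l dvd v. 2 * X / real l)"
      proof (intro sum_mono divide_right_mono)
        have "real v \<le> real (2 ^ Suc n)" using V_ge(2)[OF v] by (intro of_nat_mono) simp
        then show "real v \<le> 2 * X" by (simp add: X_def)
      qed auto
      also have "\<dots> \<le> (\<Sum>l | l \<in> {2..<2 ^ Suc n} \<and> l dvd v. 2 * X / real l)"
        using V_ge(2)[OF v] X by (intro sum_mono2) auto
      finally show "real (card {p \<in> {1..<v}. \<not> coprime p v}) \<le> \<dots>" .
    qed
    also have "\<dots> = (\<Sum>l\<in>{2..<2 ^ Suc n}. \<Sum>v | v \<in> V \<and> l dvd v. 2 * X / real l)"
      using finV by (intro sum.swap_restrict) auto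
    also have "\<dots> = (\<Sum>l\<in>{2..<2 ^ Suc n}. real (card {v \<in> V. l dvd v}) * (2 * X / l))" by simp
    also have "\<dots> \<le> (\<Sum>l\<in>{2..<2 ^ Suc n}. (if 200 < l then 12 * \<kappa> * X\<^sup>2 / D * (1 / (real l)\<^sup>2) else 0)
        + (if n\<^sup>2 < l then 6 * X\<^sup>2 * (1 / (real l)\<^sup>2) else 0))"
      by (intro sum_mono W)
    also have "\<dots> = (\<Sum>l | l \<in> {2..<2 ^ Suc n} \<and> 200 < l. 12 * \<kappa> * X\<^sup>2 / D * (1 / (real l)\<^sup>2))
        + (\<Sum>l | l \<in> {2..<2 ^ Suc n} \<and> n\<^sup>2 < l. 6 * X\<^sup>2 * (1 / (real l)\<^sup>2))"
      by (simp only: sum.distrib sum.inter_filter[symmetric] finite_atLeastLessThan)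
    also have "\<dots> \<le> 12 * \<kappa> * X\<^sup>2 / D * (1 / 200) + 6 * X\<^sup>2 * (1 / (real n)\<^sup>2)"
    proof (rule add_mono)
      have "(\<Sum>l | l \<in> {2..<2 ^ Suc n} \<and> 200 < l. 12 * \<kappa> * X\<^sup>2 / D * (1 / (real l)\<^sup>2))
          \<le> (\<Sum>l\<in>{200<..2 ^ Suc n}. 12 * \<kappa> * X\<^sup>2 / D * (1 / (real l)\<^sup>2))"
        by (intro sum_mono2) (auto simp: \<kappa>_def)
      also have "\<dots> = 12 * \<kappa> * X\<^sup>2 / D * (\<Sum>l\<in>{200<..2 ^ Suc n}. 1 / (real l)\<^sup>2)"
        by (rule sum_distrib_left[symmetric])
      also have "\<dots> \<le> 12 * \<kappa> * X\<^sup>2 / D * (1 / real 200)"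
        by (intro mult_left_mono sum_inverse_squares_tail) (auto simp: \<kappa>_def)
      finally show "(\<Sum>l | l \<in> {2..<2 ^ Suc n} \<and> 200 < l. 12 * \<kappa> * X\<^sup>2 / D * (1 / (real l)\<^sup>2)) \<le> 12 * \<kappa> * X\<^sup>2 / D * (1 / 200)"
        by simp
      have "(\<Sum>l | l \<in> {2..<2 ^ Suc n} \<and> n\<^sup>2 < l. 6 * X\<^sup>2 * (1 / (real l)\<^sup>2))
          \<le> (\<Sum>l\<in>{n\<^sup>2<..2 ^ Suc n}. 6 * X\<^sup>2 * (1 / (real l)\<^sup>2))"
        by (intro sum_mono2) auto
      also have "\<dots> = 6 * X\<^sup>2 * (\<Sum>l\<in>{n\<^sup>2<..2 ^ Suc n}. 1 / (real l)\<^sup>2)"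
        by (rule sum_distrib_left[symmetric])
      also have "\<dots> \<le> 6 * X\<^sup>2 * (1 / real (n\<^sup>2))"
        using elim(2) by (intro mult_left_mono sum_inverse_squares_tail) auto
      finally show "(\<Sum>l | l \<in> {2..<2 ^ Suc n} \<and> n\<^sup>2 < l. 6 * X\<^sup>2 * (1 / (real l)\<^sup>2)) \<le> 6 * X\<^sup>2 * (1 / (real n)\<^sup>2)"
        by simp
    qed
    also have "6 * X\<^sup>2 * (1 / (real n)\<^sup>2) \<le> X\<^sup>2 * (\<kappa> / (16 * real D))"
    proof -
      have "X\<^sup>2 * (6 / (real n)\<^sup>2) \<le> X\<^sup>2 * (\<kappa> / (16 * real D))"
        using elim(1) unfolding \<kappa>_def by (intro mult_left_mono) auto
      then show ?thesis by (simp add: mult_ac)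
    qed
    also have "12 * \<kappa> * X\<^sup>2 / D * (1 / 200) + X\<^sup>2 * (\<kappa> / (16 * real D)) \<le> X / 4 * (\<kappa> * X / (2 * D))"
    proof -
      have "0 \<le> \<kappa> * X\<^sup>2 / D" using Dpos by (simp add: \<kappa>_def)
      \<comment> \<open>Here 200 is large enough: \<open>12 / 200 + 1 / 16\<close> is below \<open>1 / 8\<close>.\<close>
      then have "12 / 200 * (\<kappa> * X\<^sup>2 / D) + 1 / 16 * (\<kappa> * X\<^sup>2 / D) \<le> 1 / 8 * (\<kappa> * X\<^sup>2 / D)" by linarith
      then show ?thesis by (simp add: power2_eq_square mult_ac)
    qed
    also have "\<dots> \<le> X / 4 * card V"
      using elim(3) X unfolding \<kappa>_def X_def D_def V_def by (intro mult_left_mono) auto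
    finally have bad: "(\<Sum>v\<in>V. real (card {p \<in> {1..<v}. \<not> coprime p v})) \<le> X / 4 * card V" by simp
    have "X / 2 * card V \<le> (\<Sum>v\<in>V. real v - 1)"
    proof -
      have "(\<Sum>v\<in>V. X / 2) \<le> (\<Sum>v\<in>V. real v - 1)"
      proof (rule sum_mono)
        fix v assume "v \<in> V"
        then have "real (2 ^ n) \<le> real v" using V_ge(1) by (intro of_nat_mono)
        moreover have "X = real (2 ^ n)" by (simp add: X_def)
        ultimately show "X / 2 \<le> real v - 1" using X by linarith
      qed
      then show ?thesis by (simp add: mult.commute)
    qed
    also have "(\<Sum>v\<in>V. real v - 1) = (\<Sum>v\<in>V. real (card {p \<in> {1..<v}. coprime p v})) + (\<Sum>v\<in>V. real (card {p \<in> {1..<v}. \<not> coprime p v}))"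
      unfolding sum.distrib[symmetric]
    proof (rule sum.cong)
      fix v assume "v \<in> V"
      then have "1 \<le> v" using V_ge(1)[of v] one_le_power[of "2::nat" n] by linarith
      have "{1..<v} = {p \<in> {1..<v}. coprime p v} \<union> {p \<in> {1..<v}. \<not> coprime p v}" by auto
      then have "card {1..<v} = card {p \<in> {1..<v}. coprime p v} + card {p \<in> {1..<v}. \<not> coprime p v}"
        by (subst card_Un_disjoint[symmetric]) (auto intro: arg_cong[of _ _ card])
      then have "real (v - 1) = real (card {p \<in> {1..<v}. coprime p v}) + real (card {p \<in> {1..<v}. \<not> coprime p v})"
        by simp
      then show "real v - 1 = real (card {p \<in> {1..<v}. coprime p v}) + real (card {p \<in> {1..<v}. \<not> coprime p v})"
        using \<open>1 \<le> v\<close> by (simp add: of_nat_diff)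
    qed simp
    finally show ?case using bad unfolding V_def[symmetric] X_def by simp
  qed
qed

end

section \<open>A Khinchin theorem with denominators in a Bohr set\<close>

lemma sum_inverse_ge_ln:
  assumes "1 \<le> n\<^sub>0" "n\<^sub>0 \<le> N"
  shows "ln (real N) - ln (real n\<^sub>0) \<le> (\<Sum>n=n\<^sub>0..<N. 1 / real n)"
  using assms(2)
proof (induction N rule: dec_induct)
  case (step N)
  have "0 < real N" using step assms by simp
  then have "ln (real (Suc N)) - ln (real N) = ln (real (Suc N) / real N)"
    by (subst ln_div) auto
  also have "\<dots> = ln (1 + 1 / real N)" using \<open>0 < real N\<close> by (simp add: field_simps)
  also have "\<dots> \<le> 1 / real N" using \<open>0 < real N\<close> by (intro ln_add_one_self_le_self) auto
  finally show ?case using step by simp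
qed simp

lemma reduced_hits_double:
  assumes "odd v" "x \<in> reduced_hits v r"
  shows "2 * x \<in> reduced_hits v (2 * r)"
proof -
  obtain p :: int where p: "coprime p (int v)" "\<bar>real v * x - of_int p\<bar> < r"
    using assms(2) by (auto simp: reduced_hits_def)
  have "coprime (2 * p) (int v)" using p(1) assms(1) by simp
  moreover have "\<bar>real v * (2 * x) - of_int (2 * p)\<bar> < 2 * r"
  proof -
    have "real v * (2 * x) - of_int (2 * p) = 2 * (real v * x - of_int p)" by simp
    then show ?thesis using p(2) by linarith
  qed
  ultimately show ?thesis unfolding reduced_hits_def by blast
qed

context diophantine
begin

text \<open>The window \<open>n\<close> contributes about \<open>n powr (- (a + b))\<close> to the sum of the measures, which diverges for
  \<open>a + b \<le> 1\<close>. Quasi-independence gives a limit superior of positive measure. Doubling \<open>\<alpha>\<close> keeps the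
  fractions reduced, since the denominators are odd, but doubles the radius. This is why the zero-one law
  is applied to the union over all constants \<open>C\<close>, and why \<open>C\<close> depends on \<open>\<alpha>\<close>.\<close>

theorem khinchin_bohr:
  assumes a: "0 < a" "a < 2" and b: "0 \<le> b" and ab: "a + b \<le> 1"
  shows "AE \<alpha> in circ. \<exists>C. \<forall>N. \<exists>n\<ge>N. \<exists>v\<in>bohr_window \<beta> a n.
    \<alpha> \<in> reduced_hits v (C * (real n powr (- b) / 2 ^ n))"
proof -
  define D where "D = sieve_modulus"
  have D: "2 \<le> D" using sieve_modulus_ge by (simp add: D_def)
  define V where "V = bohr_window \<beta> a"
  define \<psi>\<^sub>0 where "\<psi>\<^sub>0 = (\<lambda>n::nat. real n powr (- b) / 2 ^ n)"
  define \<psi> where "\<psi> = (\<lambda>v::nat. \<psi>\<^sub>0 (floor_log v))"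
  have "eventually (\<lambda>n. 1 \<le> n \<and> real n powr (- a) * 2 ^ n / (2 * D) \<le> card (V n) \<and>
      2 ^ n * real (card (V n)) / 4 \<le> (\<Sum>v\<in>V n. real (card {p \<in> {1..<v}. coprime p v}))) sequentially"
    unfolding V_def D_def
    by (intro eventually_conj eventually_ge_at_top card_bohr_window_ge bohr_window_coprime_pairs a)
  then obtain n\<^sub>0 where n0: "\<And>n. n\<^sub>0 \<le> n \<Longrightarrow> 1 \<le> n"
    "\<And>n. n\<^sub>0 \<le> n \<Longrightarrow> real n powr (- a) * 2 ^ n / (2 * D) \<le> card (V n)"
    "\<And>n. n\<^sub>0 \<le> n \<Longrightarrow> 2 ^ n * real (card (V n)) / 4 \<le> (\<Sum>v\<in>V n. real (card {p \<in> {1..<v}. coprime p v}))"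
    unfolding eventually_sequentially by blast
  have VD: "2 ^ n \<le> v" "v < 2 ^ Suc n" "floor_log v = n" "\<psi> v = \<psi>\<^sub>0 n" if "v \<in> V n" for v n
  proof -
    show "2 ^ n \<le> v" "v < 2 ^ Suc n" using that by (auto simp: V_def bohr_window_def)
    then show "floor_log v = n"
      by (intro floor_log_eqI) (auto intro: order_less_le_trans[of 0 "2 ^ n"])
    then show "\<psi> v = \<psi>\<^sub>0 n" by (simp add: \<psi>_def)
  qed
  have finV: "finite (V n)" for n by (simp add: V_def)
  \<comment> \<open>Starting at \<open>n\<^sub>0\<close>, both counting estimates hold in every window.\<close>
  define VV where "VV = (\<Union>n\<in>{n\<^sub>0..}. V n)"
  define F where "F = (\<lambda>N. \<Union>n\<in>{n\<^sub>0..<N}. V n)"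
  have F_VV: "F N \<subseteq> VV" for N by (auto simp: F_def VV_def)
  have finF: "finite (F N)" for N using finV by (simp add: F_def)
  have sum_F: "(\<Sum>v\<in>F N. f v) = (\<Sum>n=n\<^sub>0..<N. \<Sum>v\<in>V n. f v)" for f :: "nat \<Rightarrow> real" and N
  proof -
    have "V i \<inter> V j = {}" if "i \<noteq> j" for i j using VD(3) that by (metis disjoint_iff)
    then show ?thesis unfolding F_def using finV by (intro sum.UNION_disjoint) auto
  qed
  have odd: "odd v" if "v \<in> VV" for v
  proof -
    have "v mod D = 1" using that by (auto simp: VV_def V_def bohr_window_def D_def)
    moreover have "2 dvd D" unfolding D_def by (rule sieve_modulus_dvd) auto
    ultimately show ?thesis by (metis dvd_mod_iff odd_one)
  qed
  have \<psi>0: "0 \<le> \<psi>\<^sub>0 n" for n by (simp add: \<psi>\<^sub>0_def)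
  have \<psi>0_mono: "\<psi>\<^sub>0 m \<le> \<psi>\<^sub>0 n" if "1 \<le> n" "n \<le> m" for m n
    unfolding \<psi>\<^sub>0_def using that b by (intro frac_le power_increasing powr_mono2') auto
  have \<psi>0_half: "\<psi>\<^sub>0 n \<le> 1 / 2" if "1 \<le> n" for n
  proof -
    have "\<psi>\<^sub>0 n \<le> \<psi>\<^sub>0 1" using that by (intro \<psi>0_mono) auto
    then show ?thesis by (simp add: \<psi>\<^sub>0_def)
  qed
  define E where "E = (\<lambda>v. if v \<in> VV then reduced_hits v (\<psi> v) else {})"
  have E: "E v = reduced_hits v (\<psi> v)" if "v \<in> F N" for v N using that F_VV by (auto simp: E_def)
  define S where "S = (\<lambda>N. \<Sum>v\<in>F N. measure circ (E v))"
  define W where "W = (\<lambda>N. \<Sum>v\<in>F N. \<psi> v)"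
  have W_eq: "W N = (\<Sum>n=n\<^sub>0..<N. \<psi>\<^sub>0 n * card (V n))" for N
    unfolding W_def sum_F using VD(4) by (simp add: mult.commute)
  have S_ge: "W N / 4 \<le> S N" for N
    unfolding W_eq S_def sum_F sum_divide_distrib
  proof (rule sum_mono)
    fix n assume n: "n \<in> {n\<^sub>0..<N}"
    have "\<psi>\<^sub>0 n * card (V n) / 4 = \<psi>\<^sub>0 n / 2 ^ n * (2 ^ n * real (card (V n)) / 4)" by simp
    also have "\<dots> \<le> \<psi>\<^sub>0 n / 2 ^ n * (\<Sum>v\<in>V n. real (card {p \<in> {1..<v}. coprime p v}))"
      using n0(3)[of n] n \<psi>0[of n] by (intro mult_left_mono) auto
    also have "\<dots> = (\<Sum>v\<in>V n. \<psi>\<^sub>0 n / 2 ^ n * real (card {p \<in> {1..<v}. coprime p v}))" by (rule sum_distrib_left)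
    also have "\<dots> \<le> (\<Sum>v\<in>V n. measure circ (E v))"
    proof (rule sum_mono)
      fix v assume v: "v \<in> V n"
      have n1: "1 \<le> n" using n0(1) n by auto
      then have "2 \<le> v" using VD(1)[OF v] power_increasing[of 1 n "2::nat"] by simp
      have "real v \<le> real (2 ^ Suc n)" using VD(2)[OF v] by (intro of_nat_mono) simp
      then have "real v \<le> 2 * 2 ^ n" by simp
      then have "2 * \<psi>\<^sub>0 n / (2 * 2 ^ n) \<le> 2 * \<psi>\<^sub>0 n / real v"
        using \<open>2 \<le> v\<close> \<psi>0[of n] by (intro divide_left_mono) auto
      then have "\<psi>\<^sub>0 n / 2 ^ n \<le> 2 * \<psi>\<^sub>0 n / real v" by simp
      then have "\<psi>\<^sub>0 n / 2 ^ n * real (card {p \<in> {1..<v}. coprime p v}) \<le> 2 * \<psi>\<^sub>0 n / real v * real (card {p \<in> {1..<v}. coprime p v})"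
        by (intro mult_right_mono) auto
      also have "\<dots> \<le> measure circ (reduced_hits v (\<psi>\<^sub>0 n))"
        using \<open>2 \<le> v\<close> \<psi>0 \<psi>0_half[OF n1] by (intro measure_reduced_hits_ge) auto
      also have "\<dots> = measure circ (E v)"
        using v n VD(4)[OF v] by (auto simp: E_def VV_def)
      finally show "\<psi>\<^sub>0 n / 2 ^ n * real (card {p \<in> {1..<v}. coprime p v}) \<le> measure circ (E v)" .
    qed
    finally show "\<psi>\<^sub>0 n * card (V n) / 4 \<le> (\<Sum>v\<in>V n. measure circ (E v))" .
  qed
  have S_div: "filterlim S at_top sequentially"
  proof (rule filterlim_at_top_mono)
    have "0 < real D" using D by simp
    then show "filterlim (\<lambda>N. (ln (real N) - ln (real n\<^sub>0)) / (8 * D)) at_top sequentially" by real_asymp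
    show "eventually (\<lambda>N. (ln (real N) - ln (real n\<^sub>0)) / (8 * D) \<le> S N) sequentially"
      using eventually_ge_at_top[of n\<^sub>0]
    proof eventually_elim
      case (elim N)
      have "(ln (real N) - ln (real n\<^sub>0)) / (2 * D) \<le> (\<Sum>n=n\<^sub>0..<N. 1 / real n) / (2 * D)"
        using sum_inverse_ge_ln[of n\<^sub>0 N] n0(1)[of n\<^sub>0] elim by (intro divide_right_mono) auto
      also have "\<dots> = (\<Sum>n=n\<^sub>0..<N. 1 / real n / (2 * D))" by (rule sum_divide_distrib)
      also have "\<dots> \<le> (\<Sum>n=n\<^sub>0..<N. \<psi>\<^sub>0 n * card (V n))"
      proof (rule sum_mono)
        fix n assume n: "n \<in> {n\<^sub>0..<N}"
        then have n1: "1 \<le> n" using n0(1) by auto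
        have "1 / real n = real n powr (- 1)" using n1 by (simp add: powr_minus_divide)
        also have "\<dots> \<le> real n powr (- b + - a)" using n1 ab by (intro powr_mono) auto
        also have "\<dots> = real n powr (- b) * real n powr (- a)" by (rule powr_add)
        finally have "1 / real n / (2 * D) \<le> real n powr (- b) * real n powr (- a) / (2 * D)"
          by (intro divide_right_mono) auto
        also have "\<dots> = \<psi>\<^sub>0 n * (real n powr (- a) * 2 ^ n / (2 * D))" by (simp add: \<psi>\<^sub>0_def)
        also have "\<dots> \<le> \<psi>\<^sub>0 n * card (V n)" using n0(2) n \<psi>0 by (intro mult_left_mono) auto
        finally show "1 / real n / (2 * D) \<le> \<psi>\<^sub>0 n * card (V n)" .
      qed
      also have "\<dots> = W N" by (rule W_eq[symmetric])
      finally have "(ln (real N) - ln (real n\<^sub>0)) / (2 * D) / 4 \<le> W N / 4" by (rule divide_right_mono) simp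
      also have "\<dots> \<le> S N" by (rule S_ge)
      finally show ?case by simp
    qed
  qed
  have pair: "measure circ (E v \<inter> E w) \<le> (if v = w then measure circ (E v) else 0) + 8 * (\<psi> v * \<psi> w)"
    if vw: "v \<in> F N" "w \<in> F N" for v w N
  proof -
    have less: "measure circ (E v \<inter> E w) \<le> 8 * (\<psi> v * \<psi> w)" if vw: "v < w" "v \<in> F N" "w \<in> F N" for v w
    proof -
      obtain n m where nm: "n\<^sub>0 \<le> n" "v \<in> V n" "n\<^sub>0 \<le> m" "w \<in> V m" using vw by (auto simp: F_def)
      have "n \<le> m" using VD(3)[OF nm(2)] VD(3)[OF nm(4)] vw(1) floor_log_mono by (metis less_imp_le_nat monoD)
      then have "\<psi>\<^sub>0 m \<le> \<psi>\<^sub>0 n" "\<psi>\<^sub>0 m \<le> 1 / 2" using n0(1)[OF nm(1)] n0(1)[OF nm(3)] by (auto intro: \<psi>0_mono \<psi>0_half simp del: le_divide_eq_numeral1)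
      moreover have "1 \<le> v" using VD(1)[OF nm(2)] one_le_power[of "2::nat" n] by linarith
      ultimately show ?thesis
        using reduced_hits_overlap_le[of v w "\<psi>\<^sub>0 m" "\<psi>\<^sub>0 n"] vw(1) \<psi>0
        unfolding E[OF vw(2)] E[OF vw(3)] VD(4)[OF nm(2)] VD(4)[OF nm(4)] by (simp add: mult.assoc)
    qed
    have "0 \<le> 8 * (\<psi> v * \<psi> w)" using \<psi>0 by (simp add: \<psi>_def)
    then show ?thesis
      using less[of v w] less[of w v] vw by (cases v w rule: linorder_cases) (auto simp: Int_commute mult.commute)
  qed
  have "1 / 128 \<le> measure circ {x \<in> space circ. \<exists>\<^sub>\<infinity>v. x \<in> E v}"
  proof (rule circ.second_moment_limsup[where F = F and C = 1])
    show "filterlim (\<lambda>N. \<Sum>v\<in>F N. measure circ (E v)) at_top sequentially" using S_div by (simp add: S_def)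
    fix N
    have "(\<Sum>v\<in>F N. \<Sum>w\<in>F N. measure circ (E v \<inter> E w))
        \<le> (\<Sum>v\<in>F N. \<Sum>w\<in>F N. (if v = w then measure circ (E v) else 0) + 8 * (\<psi> v * \<psi> w))"
      by (intro sum_mono pair) auto
    also have "\<dots> = S N + 8 * (W N)\<^sup>2"
      using finF unfolding S_def W_def power2_eq_square sum_product
      by (simp add: sum.distrib sum_distrib_left)
    also have "(W N)\<^sup>2 \<le> (4 * S N)\<^sup>2"
      using S_ge[of N] \<psi>0 by (intro power_mono) (auto simp: W_def \<psi>_def intro!: sum_nonneg)
    finally show "(\<Sum>v\<in>F N. \<Sum>w\<in>F N. measure circ (E v \<inter> E w)) \<le> 128 * (\<Sum>v\<in>F N. measure circ (E v))\<^sup>2 + 1 * (\<Sum>v\<in>F N. measure circ (E v))"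
      unfolding S_def by (simp add: power_mult_distrib)
  qed (auto simp: E_def finF)
  define A where "A = {x. \<exists>C::nat. \<exists>\<^sub>\<infinity>v. v \<in> VV \<and> x \<in> reduced_hits v (real C * \<psi> v)}"
  have A_borel: "A \<in> sets borel"
  proof -
    have "A = {x \<in> space borel. \<exists>C::nat. \<exists>\<^sub>\<infinity>v. v \<in> VV \<and> x \<in> reduced_hits v (real C * \<psi> v)}" by (simp add: A_def)
    also have "\<dots> \<in> sets borel" unfolding INFM_nat by measurable
    finally show ?thesis .
  qed
  have "{x \<in> space circ. \<exists>\<^sub>\<infinity>v. x \<in> E v} \<subseteq> A"
  proof
    fix x assume "x \<in> {x \<in> space circ. \<exists>\<^sub>\<infinity>v. x \<in> E v}"
    then have "\<exists>\<^sub>\<infinity>v. x \<in> E v" by simp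
    then have "\<exists>\<^sub>\<infinity>v. v \<in> VV \<and> x \<in> reduced_hits v (real 1 * \<psi> v)"
      by (rule INFM_mono) (auto simp: E_def split: if_splits)
    then show "x \<in> A" unfolding A_def by blast
  qed
  then have "measure circ {x \<in> space circ. \<exists>\<^sub>\<infinity>v. x \<in> E v} \<le> measure circ A"
    using A_borel by (intro circ.finite_measure_mono) auto
  with \<open>1 / 128 \<le> _\<close> have "0 < measure circ A" by linarith
  moreover have "periodic A"
    unfolding A_def by (intro periodicI) (simp add: reduced_hits_shift)
  moreover have "2 * x \<in> A" if xA: "x \<in> A" for x
  proof -
    obtain C :: nat where "\<exists>\<^sub>\<infinity>v. v \<in> VV \<and> x \<in> reduced_hits v (real C * \<psi> v)" using xA by (auto simp: A_def)
    then have "\<exists>\<^sub>\<infinity>v. v \<in> VV \<and> 2 * x \<in> reduced_hits v (real (2 * C) * \<psi> v)"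
      by (rule INFM_mono) (use reduced_hits_double odd in \<open>auto simp: mult.assoc\<close>)
    then show ?thesis unfolding A_def by blast
  qed
  ultimately have "measure circ A = 1" using A_borel by (intro doubling_zero_one) auto
  then have "AE x in circ. x \<in> A" using A_borel by (subst (asm) circ.prob_eq_1) auto
  then show ?thesis
  proof (rule AE_mp, intro AE_I2 impI)
    fix x assume "x \<in> A"
    then obtain C :: nat where C: "\<exists>\<^sub>\<infinity>v. v \<in> VV \<and> x \<in> reduced_hits v (real C * \<psi> v)" by (auto simp: A_def)
    have "\<exists>n\<ge>N. \<exists>v\<in>V n. x \<in> reduced_hits v (real C * \<psi>\<^sub>0 n)" for N
    proof -
      obtain v where v: "2 ^ N \<le> v" "v \<in> VV" "x \<in> reduced_hits v (real C * \<psi> v)"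
        using C unfolding INFM_nat_le by blast
      then obtain n where n: "v \<in> V n" by (auto simp: VV_def)
      have "2 ^ N < (2::nat) ^ Suc n" using v(1) VD(2)[OF n] by linarith
      then have "N < Suc n" by (rule power_less_imp_less_exp[rotated]) simp
      then have "N \<le> n" by simp
      then show ?thesis using n v(3) VD(4)[OF n] by auto
    qed
    then show "\<exists>C. \<forall>N. \<exists>n\<ge>N. \<exists>v\<in>bohr_window \<beta> a n. x \<in> reduced_hits v (C * (real n powr (- b) / 2 ^ n))"
      unfolding V_def \<psi>\<^sub>0_def by blast
  qed
qed

end

section \<open>Upper bounds from the Borel-Cantelli lemma\<close>

lemma AE_circ_eventually_notin:
  assumes [measurable]: "\<And>n. B n \<in> sets borel"
    and le: "eventually (\<lambda>n. measure circ (B n) \<le> f n) sequentially" and f: "summable f"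
  shows "AE x in circ. eventually (\<lambda>n. x \<notin> B n) sequentially"
proof -
  have "summable (\<lambda>n. measure circ (B n))"
    using le by (intro summable_comparison_test_ev[OF _ f]) auto
  then have "AE x in circ. eventually (\<lambda>n. x \<in> space circ - B n) sequentially"
    by (intro borel_cantelli_AE1) (auto simp: circ.emeasure_eq_measure)
  then show ?thesis by simp
qed

lemma AE_no_close_multiple:
  assumes "1 < s"
  shows "AE \<alpha> in circ. eventually (\<lambda>n. \<forall>q\<in>{1..2 ^ Suc n}. real n powr (- s) / 2 ^ n \<le> nd (real q * \<alpha> - y)) sequentially"
proof -
  define B where "B = (\<lambda>n. \<Union>q\<in>{1..2 ^ Suc n}. hits y q (real n powr (- s) / 2 ^ n))"
  have "measure circ (B n) \<le> 4 * real n powr (- s)" for n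
  proof -
    have "measure circ (B n) \<le> (\<Sum>q\<in>{1..2 ^ Suc n}. measure circ (hits y q (real n powr (- s) / 2 ^ n)))"
      unfolding B_def by (intro measure_UNION_le) auto
    also have "\<dots> \<le> (\<Sum>q\<in>{1..2 ^ Suc n :: nat}. 2 * (real n powr (- s) / 2 ^ n))"
      by (intro sum_mono measure_hits_le) auto
    finally show ?thesis by simp
  qed
  moreover have "summable (\<lambda>n. 4 * real n powr (- s))"
    using assms by (intro summable_mult) (simp add: summable_real_powr_iff)
  ultimately have "AE x in circ. eventually (\<lambda>n. x \<notin> B n) sequentially"
    by (intro AE_circ_eventually_notin[where B = B and f = "\<lambda>n. 4 * real n powr (- s)"] always_eventually allI) (auto simp: B_def)
  then show ?thesis
    by (rule AE_mp) (auto simp: B_def hits_def not_less intro!: AE_I2 elim: eventually_mono)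
qed

text \<open>Terms up to \<open>sqrt T\<close> are bounded by 1, the others by their value at \<open>sqrt T\<close>.\<close>

lemma sum_powr_neg_le:
  assumes "0 \<le> \<sigma>" "1 \<le> (T::nat)"
  shows "(\<Sum>n=1..T. real n powr (- \<sigma>)) \<le> real T powr (1 / 2) + real T powr (1 - \<sigma> / 2)"
proof -
  define R where "R = real T powr (1 / 2)"
  have "(\<Sum>n=1..T. real n powr (- \<sigma>)) \<le> (\<Sum>n=1..T. (if real n \<le> R then 1 else 0) + real T powr (- \<sigma> / 2))"
  proof (rule sum_mono)
    fix n assume n: "n \<in> {1..T}"
    show "real n powr (- \<sigma>) \<le> (if real n \<le> R then 1 else 0) + real T powr (- \<sigma> / 2)"
    proof (cases "real n \<le> R")
      case True
      have "real n powr (- \<sigma>) \<le> real n powr 0" using n assms by (intro powr_mono) auto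
      also have "\<dots> = 1" using n by simp
      also have "1 \<le> 1 + real T powr (- \<sigma> / 2)" by simp
      finally show ?thesis using True by simp
    next
      case False
      have "real n powr (- \<sigma>) \<le> R powr (- \<sigma>)"
        using False assms by (intro powr_mono2') (auto simp: R_def)
      also have "\<dots> = real T powr (- \<sigma> / 2)" by (simp add: R_def powr_powr)
      finally show ?thesis using False by simp
    qed
  qed
  also have "\<dots> = (\<Sum>n=1..T. if real n \<le> R then 1 else 0) + real T * real T powr (- \<sigma> / 2)"
    by (simp add: sum.distrib)
  also have "(\<Sum>n=1..T. if real n \<le> R then 1 else 0) = real (card {n \<in> {1..T}. real n \<le> R})"
    by (subst sum.inter_filter[symmetric]) simp_all
  also have "card {n \<in> {1..T}. real n \<le> R} \<le> card {1..nat \<lfloor>R\<rfloor>}"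
    by (intro card_mono) (auto simp: le_nat_floor)
  also have "real (card {1..nat \<lfloor>R\<rfloor>}) \<le> R" by (simp add: R_def)
  also have "real T * real T powr (- \<sigma> / 2) = real T powr (1 - \<sigma> / 2)"
    using assms powr_add[of "real T" 1 "- \<sigma> / 2"] by simp
  finally show ?thesis by (simp add: R_def)
qed

context diophantine
begin

text \<open>Half of the saving \<open>b powr (- \<eta>)\<close>, expressed through \<open>n\<close> when \<open>n\<close> is at most of order
  \<open>b powr (M + 1)\<close>.\<close>

definition \<sigma> :: real where "\<sigma> = \<eta> / (2 * (M + 1))"

lemma \<sigma>_pos: "0 < \<sigma>"
  using \<eta>_bounds M_ge by (simp add: \<sigma>_def)

lemma \<sigma>_less_1: "\<sigma> < 1"
  using \<eta>_bounds M_ge by (simp add: \<sigma>_def field_simps)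

definition K\<^sub>1 :: real where "K\<^sub>1 = K\<^sub>0 * (c / 2) powr (- \<sigma>)"

lemma K\<^sub>1_nonneg: "0 \<le> K\<^sub>1"
  using K\<^sub>0_pos by (simp add: K\<^sub>1_def)

text \<open>The gain over the discrepancy bound: the set is empty unless \<open>b\<close> exceeds a fixed power of
  \<open>n\<close>, because small multiples of \<open>\<xi>\<close> stay away from the integers.\<close>

lemma card_near_return_le:
  assumes "1 \<le> b" "0 < \<delta>" "real n * \<delta> \<le> 1" "1 \<le> n"
  shows "real (card {a \<in> {1..<b}. nd (real (b - a) * \<xi>) < 2 * real b * \<delta>})
    \<le> b * (4 * real b * \<delta> + K\<^sub>1 * real n powr (- \<sigma>) * real b powr (- \<eta> / 2))"
proof (cases "{a \<in> {1..<b}. nd (real (b - a) * \<xi>) < 2 * real b * \<delta>} = {}")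
  case True
  then show ?thesis using assms K\<^sub>1_nonneg by (simp only: card.empty) simp
next
  case False
  then obtain a where a: "1 \<le> a" "a < b" "nd (real (b - a) * \<xi>) < 2 * real b * \<delta>" by auto
  have "c / real b powr M \<le> c / real (b - a) powr M"
    using a c_pos M_ge by (intro divide_left_mono powr_mono2 mult_pos_pos) auto
  also have "\<dots> \<le> nd (real (b - a) * \<xi>)" using a by (intro nd_multiple_ge) auto
  also have "\<dots> < 2 * real b * \<delta>" by (rule a(3))
  finally have "c < 2 * real b * \<delta> * real b powr M" using a by (simp add: field_simps)
  also have "\<dots> = 2 * \<delta> * real b powr (M + 1)" using a by (simp add: powr_add)
  finally have "real n * c \<le> real n * (2 * \<delta> * real b powr (M + 1))" using assms by (intro mult_left_mono) auto
  also have "\<dots> = (real n * \<delta>) * (2 * real b powr (M + 1))" by simp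
  also have "\<dots> \<le> 1 * (2 * real b powr (M + 1))" using assms by (intro mult_right_mono) auto
  finally have "c / 2 * real n \<le> real b powr (M + 1)" by (simp add: mult.commute)
  then have "(real b powr (M + 1)) powr (- \<sigma>) \<le> (c / 2 * real n) powr (- \<sigma>)"
    using \<sigma>_pos c_pos assms by (intro powr_mono2') auto
  moreover have "(real b powr (M + 1)) powr (- \<sigma>) = real b powr (- \<eta> / 2)"
  proof -
    have "(M + 1) * (- \<sigma>) = - \<eta> / 2" using M_ge by (simp add: \<sigma>_def field_simps)
    then show ?thesis by (simp only: powr_powr)
  qed
  moreover have "(c / 2 * real n) powr (- \<sigma>) = (c / 2) powr (- \<sigma>) * real n powr (- \<sigma>)"
    using c_pos by (intro powr_mult)
  ultimately have half: "real b powr (- \<eta> / 2) \<le> (c / 2) powr (- \<sigma>) * real n powr (- \<sigma>)" by simp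
  have "card {a \<in> {1..<b}. nd (real (b - a) * \<xi>) < 2 * real b * \<delta>} \<le> card {m \<in> {0..<0 + int b}. nd (real (nat m) * \<xi>) < 2 * real b * \<delta>}"
    by (rule card_rev_block_le)
  also have "{m \<in> {0..<0 + int b}. nd (real (nat m) * \<xi>) < 2 * real b * \<delta>} = {m \<in> {0..<0 + int b}. nd (of_int m * (real 1 * \<xi>) - 0) < 2 * real b * \<delta>}"
    by auto
  also have "real (card \<dots>) \<le> 2 * (2 * real b * \<delta>) * b + K\<^sub>0 * 1 * real b powr (1 - \<eta>)"
    using card_close_le[of 1 "2 * real b * \<delta>" 0 b 0] assms by simp
  also have "real b powr (1 - \<eta>) = b * (real b powr (- \<eta> / 2) * real b powr (- \<eta> / 2))"
    using assms powr_add[of "real b" 1 "- \<eta>"] powr_add[of "real b" "- \<eta> / 2" "- \<eta> / 2"] by simp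
  also have "K\<^sub>0 * 1 * \<dots> \<le> K\<^sub>0 * 1 * (b * ((c / 2) powr (- \<sigma>) * real n powr (- \<sigma>) * real b powr (- \<eta> / 2)))"
    using half K\<^sub>0_pos by (intro mult_left_mono mult_right_mono) auto
  finally show ?thesis by (simp add: K\<^sub>1_def algebra_simps)
qed

lemma sum_near_return_le:
  assumes "1 \<le> n" "n \<le> T" "0 < \<delta>" "real T * \<delta> \<le> 1"
  shows "(\<Sum>q=1..<n. near_return \<delta> q n)
    \<le> 4 * \<delta> * T * (\<Sum>d | d dvd n. 1 / real d) + K\<^sub>1 * (real n powr (- \<sigma>) * (\<Sum>d | d dvd n. real d powr (- \<eta> / 2)))"
proof -
  define g where "g = (\<lambda>d a. if nd (real (n div d - a) * \<xi>) < 2 * real (n div d) * \<delta> then real d / real n else 0)"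
  have n\<delta>: "real n * \<delta> \<le> 1"
  proof -
    have "real n * \<delta> \<le> real T * \<delta>" using assms by (intro mult_right_mono) auto
    then show ?thesis using assms(4) by linarith
  qed
  have "(\<Sum>q=1..<n. near_return \<delta> q n) = (\<Sum>q=1..<n. g (gcd q n) (q div gcd q n))"
    by (simp add: near_return_def g_def)
  also have "\<dots> \<le> (\<Sum>d | d dvd n. \<Sum>a=1..<n div d. g d a)"
    using assms by (intro sum_by_gcd_le) (auto simp: g_def)
  also have "\<dots> \<le> (\<Sum>d | d dvd n. 4 * \<delta> * T * (1 / real d) + K\<^sub>1 * real n powr (- \<sigma>) * real (n div d) powr (- \<eta> / 2))"
  proof (rule sum_mono)
    fix d assume "d \<in> {d. d dvd n}"
    then have d: "d dvd n" "1 \<le> d" using assms by (auto simp: Suc_le_eq intro: dvd_pos_nat)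
    define b where "b = n div d"
    have b: "n = d * b" "1 \<le> b" using d assms by (auto simp: b_def Suc_le_eq div_greater_zero_iff dvd_imp_le)
    have "(\<Sum>a=1..<b. g d a) = d / n * card {a \<in> {1..<b}. nd (real (b - a) * \<xi>) < 2 * real b * \<delta>}"
      unfolding g_def b_def[symmetric] by (subst sum.inter_filter[symmetric]) simp_all
    also have "\<dots> \<le> d / n * (b * (4 * real b * \<delta> + K\<^sub>1 * real n powr (- \<sigma>) * real b powr (- \<eta> / 2)))"
      using d b assms n\<delta> by (intro mult_left_mono card_near_return_le) auto
    also have "\<dots> = 4 * real b * \<delta> + K\<^sub>1 * real n powr (- \<sigma>) * real b powr (- \<eta> / 2)"
      using d b by simp
    also have "4 * real b * \<delta> \<le> 4 * \<delta> * T * (1 / real d)"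
    proof -
      have "real b = real n / real d" using b d by simp
      also have "\<dots> \<le> real T / real d" using assms by (intro divide_right_mono) auto
      finally have "4 * \<delta> * real b \<le> 4 * \<delta> * (real T / real d)" using assms by (intro mult_left_mono) auto
      then show ?thesis by (simp add: mult_ac)
    qed
    finally show "(\<Sum>a=1..<n div d. g d a) \<le> 4 * \<delta> * T * (1 / real d) + K\<^sub>1 * real n powr (- \<sigma>) * real (n div d) powr (- \<eta> / 2)"
      unfolding b_def by simp
  qed
  also have "\<dots> = 4 * \<delta> * T * (\<Sum>d | d dvd n. 1 / real d) + K\<^sub>1 * real n powr (- \<sigma>) * (\<Sum>d | d dvd n. real (n div d) powr (- \<eta> / 2))"
    by (simp add: sum.distrib sum_distrib_left)
  also have "(\<Sum>d | d dvd n. real (n div d) powr (- \<eta> / 2)) = (\<Sum>d | d dvd n. real d powr (- \<eta> / 2))"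
    using assms(1) by (rule sum_divisors_flip)
  finally show ?thesis by (simp add: mult.assoc)
qed

definition G\<^sub>1 :: real where "G\<^sub>1 = (\<Sum>d. real d powr (- 1) / real d)"
definition G\<^sub>2 :: real where "G\<^sub>2 = (\<Sum>d. real d powr (- (\<eta> / 2)) / real d)"

text \<open>The first term is of the order of the expected number of pairs of independent hits. The second has a power
  saving over \<open>\<delta> * T\<close>, so it does not compete with the first when \<open>\<delta> * T\<close> is a power of
  \<open>ln T\<close>.\<close>

lemma sum_pairs_le:
  assumes "0 < \<delta>" "real T * \<delta> \<le> 1"
  shows "(\<Sum>n=1..T. \<Sum>q=1..<n. measure circ (hits \<xi> q \<delta> \<inter> hits \<xi> n \<delta>))
    \<le> (4 + 8 * G\<^sub>1) * (\<delta> * T)\<^sup>2 + 2 * K\<^sub>1 * G\<^sub>2 * \<delta> * (\<Sum>n=1..T. real n powr (- \<sigma>))"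
proof -
  have "(\<Sum>n=1..T. \<Sum>q=1..<n. measure circ (hits \<xi> q \<delta> \<inter> hits \<xi> n \<delta>))
      \<le> (\<Sum>n=1..T. 4 * \<delta>\<^sup>2 * T + 2 * \<delta> * (4 * \<delta> * T * (1 * (\<Sum>d | d dvd n. 1 / real d))
        + K\<^sub>1 * (real n powr (- \<sigma>) * (\<Sum>d | d dvd n. real d powr (- \<eta> / 2)))))"
  proof (rule sum_mono)
    fix n assume n: "n \<in> {1..T}"
    have "(\<Sum>q=1..<n. measure circ (hits \<xi> q \<delta> \<inter> hits \<xi> n \<delta>)) \<le> (\<Sum>q=1..<n. 4 * \<delta>\<^sup>2 + 2 * \<delta> * near_return \<delta> q n)"
    proof (rule sum_mono)
      fix q assume "q \<in> {1..<n}"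
      then show "measure circ (hits \<xi> q \<delta> \<inter> hits \<xi> n \<delta>) \<le> 4 * \<delta>\<^sup>2 + 2 * \<delta> * near_return \<delta> q n"
        using hits_pair_le[of q n \<delta> \<delta>] assms by (simp add: power2_eq_square)
    qed
    also have "\<dots> = 4 * \<delta>\<^sup>2 * real (n - 1) + 2 * \<delta> * (\<Sum>q=1..<n. near_return \<delta> q n)"
      by (simp add: sum.distrib sum_distrib_left)
    also have "\<dots> \<le> 4 * \<delta>\<^sup>2 * T + 2 * \<delta> * (4 * \<delta> * T * (\<Sum>d | d dvd n. 1 / real d)
        + K\<^sub>1 * (real n powr (- \<sigma>) * (\<Sum>d | d dvd n. real d powr (- \<eta> / 2))))"
      using n assms by (intro add_mono mult_left_mono sum_near_return_le) auto
    finally show "(\<Sum>q=1..<n. measure circ (hits \<xi> q \<delta> \<inter> hits \<xi> n \<delta>)) \<le> 4 * \<delta>\<^sup>2 * T + 2 * \<delta> * (4 * \<delta> * T * (1 * (\<Sum>d | d dvd n. 1 / real d))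
        + K\<^sub>1 * (real n powr (- \<sigma>) * (\<Sum>d | d dvd n. real d powr (- \<eta> / 2))))" by simp
  qed
  also have "\<dots> = 4 * (\<delta> * T)\<^sup>2 + 8 * \<delta>\<^sup>2 * T * (\<Sum>n=1..T. 1 * (\<Sum>d | d dvd n. 1 / real d))
      + 2 * \<delta> * K\<^sub>1 * (\<Sum>n=1..T. real n powr (- \<sigma>) * (\<Sum>d | d dvd n. real d powr (- \<eta> / 2)))"
    by (simp add: sum.distrib distrib_left sum_distrib_left[symmetric] power2_eq_square)
  also have "\<dots> \<le> 4 * (\<delta> * T)\<^sup>2 + 8 * \<delta>\<^sup>2 * T * (G\<^sub>1 * (\<Sum>n=1..T. 1))
      + 2 * \<delta> * K\<^sub>1 * (G\<^sub>2 * (\<Sum>n=1..T. real n powr (- \<sigma>)))"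
  proof (intro add_mono mult_left_mono sum_divisors_average order_refl)
    show "(\<Sum>d=1..T. 1 / real d / real d) \<le> G\<^sub>1"
    proof -
      have "(\<Sum>d=1..T. 1 / real d / real d) = (\<Sum>d=1..T. real d powr (- 1) / real d)"
        by (intro sum.cong) (auto simp: powr_minus_divide)
      also have "\<dots> \<le> G\<^sub>1" unfolding G\<^sub>1_def by (intro sum_le_suminf summable_powr_over_n) auto
      finally show ?thesis .
    qed
    show "(\<Sum>d=1..T. real d powr (- \<eta> / 2) / real d) \<le> G\<^sub>2"
      unfolding G\<^sub>2_def minus_divide_left[symmetric]
      using \<eta>_bounds by (intro sum_le_suminf summable_powr_over_n) auto
    show "real n powr (- \<sigma>) \<le> real m powr (- \<sigma>)" if "1 \<le> m" "m \<le> n" for m n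
      using that \<sigma>_pos by (intro powr_mono2') auto
  qed (use assms K\<^sub>1_nonneg in auto)
  also have "\<dots> = (4 + 8 * G\<^sub>1) * (\<delta> * T)\<^sup>2 + 2 * K\<^sub>1 * G\<^sub>2 * \<delta> * (\<Sum>n=1..T. real n powr (- \<sigma>))"
    by (simp add: power2_eq_square algebra_simps)
  finally show ?thesis .
qed

text \<open>The expected number of close pairs in window \<open>n\<close> is of order \<open>n powr (- 2 * s)\<close>, which is summable
  precisely for \<open>s > 1 / 2\<close>.\<close>

theorem AE_no_close_pair:
  assumes "1 / 2 < s"
  shows "AE \<alpha> in circ. eventually (\<lambda>n. \<forall>p\<in>{1..2 ^ Suc n}. \<forall>q\<in>{1..<p}.
    \<not> (nd (real q * \<alpha> - \<xi>) < real n powr (- s) / 2 ^ n \<and> nd (real p * \<alpha> - \<xi>) < real n powr (- s) / 2 ^ n)) sequentially"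
proof -
  define \<delta> where "\<delta> = (\<lambda>n::nat. real n powr (- s) / 2 ^ n)"
  define B where "B = (\<lambda>n. \<Union>p\<in>{1..2 ^ Suc n}. \<Union>q\<in>{1..<p}. hits \<xi> q (\<delta> n) \<inter> hits \<xi> p (\<delta> n))"
  define f where "f = (\<lambda>n. (4 + 8 * G\<^sub>1) * (4 * real n powr (- (2 * s))) + 2 * K\<^sub>1 * G\<^sub>2 * real n powr (- 2))"
  have G2: "0 \<le> G\<^sub>2" unfolding G\<^sub>2_def using \<eta>_bounds by (intro suminf_nonneg summable_powr_over_n) auto
  have "eventually (\<lambda>n::nat. 2 * real n powr (- s) \<le> 1) sequentially" using assms by real_asymp
  moreover have "eventually (\<lambda>n::nat. real n powr (- s) / 2 ^ n * ((2 * 2 ^ n) powr (1 / 2) + (2 * 2 ^ n) powr (1 - \<sigma> / 2)) \<le> real n powr (- 2)) sequentially"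
    using assms \<sigma>_pos \<sigma>_less_1 by real_asymp
  ultimately have "eventually (\<lambda>n. measure circ (B n) \<le> f n) sequentially"
    using eventually_ge_at_top[of 1]
  proof eventually_elim
    case (elim n)
    have \<delta>: "0 < \<delta> n" using elim(3) by (simp add: \<delta>_def)
    have T\<delta>: "real (2 ^ Suc n) * \<delta> n \<le> 1" using elim(1) by (simp add: \<delta>_def)
    have "measure circ (B n) \<le> (\<Sum>p\<in>{1..2 ^ Suc n}. measure circ (\<Union>q\<in>{1..<p}. hits \<xi> q (\<delta> n) \<inter> hits \<xi> p (\<delta> n)))"
      unfolding B_def by (intro measure_UNION_le) auto
    also have "\<dots> \<le> (\<Sum>p\<in>{1..2 ^ Suc n}. \<Sum>q\<in>{1..<p}. measure circ (hits \<xi> q (\<delta> n) \<inter> hits \<xi> p (\<delta> n)))"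
      by (intro sum_mono measure_UNION_le) auto
    also have "\<dots> \<le> (4 + 8 * G\<^sub>1) * (\<delta> n * real (2 ^ Suc n))\<^sup>2 + 2 * K\<^sub>1 * G\<^sub>2 * \<delta> n * (\<Sum>m=1..2 ^ Suc n. real m powr (- \<sigma>))"
      using sum_pairs_le[OF \<delta> T\<delta>] .
    also have "\<delta> n * real (2 ^ Suc n) = 2 * real n powr (- s)" by (simp add: \<delta>_def)
    also have "(2 * real n powr (- s))\<^sup>2 = 4 * real n powr (- (2 * s))"
      by (simp add: power2_eq_square powr_add[symmetric])
    also have "2 * K\<^sub>1 * G\<^sub>2 * \<delta> n * (\<Sum>m=1..2 ^ Suc n. real m powr (- \<sigma>)) \<le> 2 * K\<^sub>1 * G\<^sub>2 * real n powr (- 2)"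
    proof -
      have "\<delta> n * (\<Sum>m=1..2 ^ Suc n. real m powr (- \<sigma>)) \<le> \<delta> n * (real (2 ^ Suc n) powr (1 / 2) + real (2 ^ Suc n) powr (1 - \<sigma> / 2))"
        using \<delta> \<sigma>_pos by (intro mult_left_mono sum_powr_neg_le) auto
      also have "\<dots> \<le> real n powr (- 2)" using elim(2) by (simp add: \<delta>_def)
      finally have "2 * K\<^sub>1 * G\<^sub>2 * (\<delta> n * (\<Sum>m=1..2 ^ Suc n. real m powr (- \<sigma>))) \<le> 2 * K\<^sub>1 * G\<^sub>2 * real n powr (- 2)"
        using K\<^sub>1_nonneg G2 by (intro mult_left_mono) auto
      then show ?thesis by (simp only: mult.assoc)
    qed
    finally show ?case by (simp add: f_def)
  qed
  moreover have "summable f"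
    unfolding f_def using assms by (intro summable_add summable_mult) (simp_all add: summable_real_powr_iff)
  ultimately have "AE x in circ. eventually (\<lambda>n. x \<notin> B n) sequentially"
    by (intro AE_circ_eventually_notin) (auto simp: B_def)
  then show ?thesis
    by (rule AE_mp) (auto simp: B_def hits_def \<delta>_def intro!: AE_I2 elim!: eventually_mono)
qed

end

section \<open>Limsup bookkeeping\<close>

lemma Limsup_at_top_eqI:
  fixes f :: "real \<Rightarrow> real"
  assumes le: "\<And>j::nat. eventually (\<lambda>T. f T \<le> l + 1 / Suc j) at_top"
    and ge: "\<And>j::nat. frequently (\<lambda>T. l - 1 / Suc j \<le> f T) at_top"
  shows "Limsup at_top (\<lambda>T. ereal (f T)) = ereal l"
proof (rule antisym)
  show "Limsup at_top (\<lambda>T. ereal (f T)) \<le> ereal l"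
  proof (rule ereal_le_epsilon2)
    fix e :: real assume "0 < e"
    then obtain j where "inverse (real (Suc j)) < e" using reals_Archimedean by blast
    then have "eventually (\<lambda>T. ereal (f T) \<le> ereal (l + e)) at_top"
      using le[of j] by (auto simp: inverse_eq_divide elim!: eventually_mono)
    then have "Limsup at_top (\<lambda>T. ereal (f T)) \<le> ereal (l + e)" by (rule Limsup_bounded)
    then show "Limsup at_top (\<lambda>T. ereal (f T)) \<le> ereal l + ereal e" by simp
  qed
  show "ereal l \<le> Limsup at_top (\<lambda>T. ereal (f T))"
  proof (rule ccontr)
    assume "\<not> ?thesis"
    then obtain z where z: "Limsup at_top (\<lambda>T. ereal (f T)) < ereal z" "ereal z < ereal l"
      using ereal_dense2[of "Limsup at_top (\<lambda>T. ereal (f T))" "ereal l"] by (auto simp: not_le)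
    then obtain j where "inverse (real (Suc j)) < l - z" using reals_Archimedean[of "l - z"] by auto
    then have j: "z < l - 1 / Suc j" by (simp add: inverse_eq_divide)
    have "eventually (\<lambda>T. ereal (f T) < ereal z) at_top" using z(1) by (rule Limsup_lessD)
    then have "frequently (\<lambda>T. l - 1 / Suc j \<le> f T \<and> ereal (f T) < ereal z) at_top"
      by (rule frequently_eventually_frequently[OF ge[of j]])
    then have "frequently (\<lambda>T::real. False) at_top" by (rule frequently_elim1) (use j in auto)
    then show False by simp
  qed
qed

lemma frequently_at_top_real_iff: "frequently P at_top \<longleftrightarrow> (\<forall>B::real. \<exists>T\<ge>B. P T)"
  by (simp add: frequently_def eventually_at_top_linorder)

lemma ln_ln_pos: "4 \<le> T \<Longrightarrow> 1 < ln (T::real) \<and> 0 < ln (ln T)"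
proof -
  assume "4 \<le> T"
  then have "exp 1 < T" using exp_le by linarith
  then have "1 < ln T" using \<open>4 \<le> T\<close> ln_less_cancel_iff[of "exp 1" T] by simp
  then show ?thesis by simp
qed

lemma dyadic_window:
  fixes T :: real
  assumes "2 ^ N \<le> T"
  obtains n where "N \<le> n" "2 ^ n \<le> T" "T < 2 ^ Suc n"
proof -
  obtain m where m: "T < 2 ^ m" using real_arch_pow[of 2 T] by auto
  define n where "n = (GREATEST n. 2 ^ n \<le> T)"
  have bound: "k \<le> m" if "2 ^ k \<le> T" for k
  proof (rule ccontr)
    assume "\<not> k \<le> m"
    then have "(2::real) ^ m \<le> 2 ^ k" by (intro power_increasing) auto
    with m that show False by linarith
  qed
  have n: "2 ^ n \<le> T" unfolding n_def using assms bound by (rule GreatestI_nat)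
  have ge: "k \<le> n" if "2 ^ k \<le> T" for k unfolding n_def using that bound by (rule Greatest_le_nat)
  have "T < 2 ^ Suc n" using ge[of "Suc n"] by force
  then show ?thesis using that n ge[OF assms] by blast
qed

text \<open>On the window \<open>2 ^ n \<le> T < 2 ^ Suc n\<close> the quantity \<open>ln (ln T)\<close> is \<open>ln n\<close> up to a bounded error,
  which the gap between \<open>s\<close> and \<open>t\<close> absorbs.\<close>

lemma scaled_min_exponent_le:
  assumes s: "0 \<le> s" "s < t"
    and low: "eventually (\<lambda>n. \<forall>T. 2 ^ n \<le> T \<and> T < 2 ^ Suc n \<longrightarrow> real n powr (- s) / 2 ^ n \<le> rth_min r \<xi> T \<alpha>) sequentially"
  shows "eventually (\<lambda>T. - ln (rth_min_scaled r \<xi> T \<alpha>) / ln (ln T) \<le> t) at_top"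
proof -
  have "eventually (\<lambda>n::nat. s * ln n \<le> t * (ln n + ln (ln 2))) sequentially" using s by real_asymp
  with low have "eventually (\<lambda>n. 2 \<le> n \<and> s * ln n \<le> t * (ln n + ln (ln 2)) \<and>
      (\<forall>T. 2 ^ n \<le> T \<and> T < 2 ^ Suc n \<longrightarrow> real n powr (- s) / 2 ^ n \<le> rth_min r \<xi> T \<alpha>)) sequentially"
    by (intro eventually_conj eventually_ge_at_top)
  then obtain N where all: "\<forall>n\<ge>N. 2 \<le> n \<and> s * ln n \<le> t * (ln n + ln (ln 2)) \<and>
      (\<forall>T. 2 ^ n \<le> T \<and> T < 2 ^ Suc n \<longrightarrow> real n powr (- s) / 2 ^ n \<le> rth_min r \<xi> T \<alpha>)"
    unfolding eventually_sequentially by (rule exE)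
  have N: "\<And>n. N \<le> n \<Longrightarrow> 2 \<le> n" "\<And>n. N \<le> n \<Longrightarrow> s * ln n \<le> t * (ln n + ln (ln 2))"
    "\<And>n T. N \<le> n \<Longrightarrow> 2 ^ n \<le> T \<Longrightarrow> T < 2 ^ Suc n \<Longrightarrow> real n powr (- s) / 2 ^ n \<le> rth_min r \<xi> T \<alpha>"
    using all by simp_all
  show ?thesis
    using eventually_ge_at_top[of "2 ^ N"]
  proof eventually_elim
    case (elim T)
    then obtain n where n: "N \<le> n" "2 ^ n \<le> T" "T < 2 ^ Suc n" by (rule dyadic_window)
    have n2: "2 \<le> n" by (rule N(1)[OF n(1)])
    have "(2::real) ^ 2 \<le> 2 ^ n" using n2 by (intro power_increasing) auto
    then have T4: "4 \<le> T" using n(2) by simp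
    have "real n powr (- s) = 2 ^ n * (real n powr (- s) / 2 ^ n)" by simp
    also have "\<dots> \<le> T * rth_min r \<xi> T \<alpha>"
      using n T4 N(3)[OF n] by (intro mult_mono) auto
    finally have "real n powr (- s) \<le> rth_min_scaled r \<xi> T \<alpha>" by (simp add: rth_min_scaled_def)
    moreover have "0 < real n powr (- s)" using n2 by simp
    ultimately have "ln (real n powr (- s)) \<le> ln (rth_min_scaled r \<xi> T \<alpha>)" by (subst ln_le_cancel_iff; linarith)
    then have "- ln (rth_min_scaled r \<xi> T \<alpha>) \<le> s * ln n" using n2 by (simp add: ln_powr)
    also have "\<dots> \<le> t * (ln n + ln (ln 2))" by (rule N(2)[OF n(1)])
    also have "\<dots> = t * ln (ln (2 ^ n))" using n2 by (simp add: ln_realpow ln_mult)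
    also have "\<dots> \<le> t * ln (ln T)"
    proof (intro mult_left_mono)
      have "0 < ln ((2::real) ^ n)" using n2 by (simp add: ln_realpow)
      moreover have "ln (2 ^ n) \<le> ln T" using n(2) T4 by (subst ln_le_cancel_iff) auto
      ultimately show "ln (ln (2 ^ n)) \<le> ln (ln T)" by (subst ln_le_cancel_iff; linarith)
    qed (use s in auto)
    finally show ?case using ln_ln_pos[OF T4] by (subst pos_divide_le_eq) auto
  qed
qed

lemma exponent_ge_if_small:
  assumes "0 < k" "k \<le> real n powr (- t)" "0 \<le> t" "4 \<le> T" "ln T \<le> real n"
  shows "t \<le> - ln k / ln (ln T)"
proof -
  have n: "0 < real n" using ln_ln_pos[OF assms(4)] assms(5) by linarith
  have "t * ln (ln T) \<le> t * ln (real n)"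
    using assms ln_ln_pos[OF assms(4)] n by (intro mult_left_mono) auto
  also have "\<dots> = - ln (real n powr (- t))" using n by (simp add: ln_powr)
  also have "\<dots> \<le> - ln k" using assms(1,2) n ln_le_cancel_iff[of k "real n powr (- t)"] by linarith
  finally show ?thesis using ln_ln_pos[OF assms(4)] by (subst pos_le_divide_eq) auto
qed

section \<open>Orbits near a rational rotation\<close>

text \<open>With \<open>m\<close> the integer nearest to \<open>v * \<xi>\<close>, the solution \<open>j\<close> of \<open>j * p = m\<close> modulo \<open>v\<close> works.\<close>

lemma rational_orbit_near:
  assumes "1 \<le> v" "coprime p (int v)"
  obtains j where "0 \<le> j" "j < int v" "nd (of_int j * (of_int p / real v) - \<xi>) \<le> nd (real v * \<xi>) / v"
proof -
  obtain m :: int where m: "nd (real v * \<xi>) = \<bar>real v * \<xi> - of_int m\<bar>" by (rule nd_attained)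
  obtain u w where uw: "u * p + w * int v = 1" using bezout_int[of p "int v"] assms(2) by auto
  define j where "j = (u * m) mod int v"
  define z where "z = - ((u * m) div int v) * p - m * w"
  have j_eq: "j = u * m - (u * m) div int v * int v" by (simp add: j_def minus_div_mult_eq_mod)
  have "j * p = m * (u * p) - (u * m) div int v * int v * p"
    unfolding j_eq by (simp add: algebra_simps)
  also have "u * p = 1 - w * int v" using uw by simp
  finally have jp: "j * p = m + z * int v" by (simp add: z_def algebra_simps)
  have "of_int j * (of_int p / real v) - \<xi> = of_int (j * p) / real v - \<xi>" by simp
  also have "\<dots> = - (real v * \<xi> - of_int m) / real v + of_int z"
    unfolding jp using assms(1) by (simp add: field_simps)
  finally have "nd (of_int j * (of_int p / real v) - \<xi>) = nd (- (real v * \<xi> - of_int m) / real v)" by simp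
  also have "\<dots> \<le> \<bar>- (real v * \<xi> - of_int m) / real v\<bar>" by (rule nd_le_abs)
  also have "\<dots> = nd (real v * \<xi>) / v" unfolding m by (simp add: abs_minus_commute)
  finally show ?thesis using that[of j] assms(1) by (simp add: j_def)
qed

lemma nd_orbit_shift: "nd (of_int (j + i * int v) * (of_int p / real v) - \<xi>) = nd (of_int j * (of_int p / real v) - \<xi>)"
proof (cases "v = 0")
  case False
  then have "of_int (j + i * int v) * (of_int p / real v) - \<xi> = of_int j * (of_int p / real v) - \<xi> + of_int (i * p)"
    by (simp add: field_simps)
  then show ?thesis by (metis nd_add_int)
qed simp

lemma rational_rotation_error:
  assumes "1 \<le> v" "0 \<le> q" "\<bar>real v * \<alpha> - of_int p\<bar> < \<delta>"
  shows "\<bar>of_int q * \<alpha> - of_int q * (of_int p / real v)\<bar> \<le> of_int q / v * \<delta>"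
proof -
  have "of_int q * \<alpha> - of_int q * (of_int p / real v) = of_int q / real v * (real v * \<alpha> - of_int p)"
    using assms(1) by (simp add: field_simps)
  then have "\<bar>of_int q * \<alpha> - of_int q * (of_int p / real v)\<bar> = of_int q / v * \<bar>real v * \<alpha> - of_int p\<bar>"
    using assms(2) by (simp add: abs_mult)
  also have "\<dots> \<le> of_int q / v * \<delta>" using assms by (intro mult_left_mono) auto
  finally show ?thesis .
qed

lemma nd_perturb: "nd (x - \<xi>) \<le> nd (y - \<xi>) + \<bar>x - y\<bar>"
  using nd_diff_le[of "x - \<xi>" "x - y"] by simp

text \<open>Once \<open>j\<close> is close, so are \<open>j + v\<close>, \<open>j + 2 * v\<close> and so on, because \<open>v * \<alpha>\<close> is nearly an
  integer.\<close>

lemma rth_min_near_rational: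
  assumes r: "1 \<le> r" and v: "1 \<le> v" "coprime p (int v)" "\<bar>real v * \<alpha> - of_int p\<bar> < \<delta>"
  shows "rth_min r \<xi> (real (r * v)) \<alpha> \<le> nd (real v * \<xi>) / v + r * \<delta>"
proof -
  obtain j where j: "0 \<le> j" "j < int v" "nd (of_int j * (of_int p / real v) - \<xi>) \<le> nd (real v * \<xi>) / v"
    using rational_orbit_near[OF v(1,2)] by blast
  define Q where "Q = (\<lambda>i::nat. j + int i * int v) ` {..<r}"
  have "card Q = r" unfolding Q_def using v(1) by (subst card_image) (auto simp: inj_on_def)
  have \<delta>: "0 < \<delta>" using v(3) by linarith
  have "Q \<subseteq> {q. 0 \<le> q \<and> q \<le> \<lfloor>real (r * v)\<rfloor> \<and> nd (of_int q * \<alpha> - \<xi>) \<le> nd (real v * \<xi>) / v + r * \<delta>}"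
  proof
    fix q assume "q \<in> Q"
    then obtain i where i: "i < r" "q = j + int i * int v" by (auto simp: Q_def)
    have "int i * int v + int v \<le> int r * int v"
      using i(1) mult_right_mono[of "int i + 1" "int r" "int v"] by (simp add: distrib_right)
    then have q: "0 \<le> q" "q \<le> int (r * v)" using i(2) j by auto
    have "nd (of_int q * \<alpha> - \<xi>) \<le> nd (of_int q * (of_int p / real v) - \<xi>) + \<bar>of_int q * \<alpha> - of_int q * (of_int p / real v)\<bar>"
      by (rule nd_perturb)
    also have "\<bar>of_int q * \<alpha> - of_int q * (of_int p / real v)\<bar> \<le> of_int q / v * \<delta>"
      using v q by (intro rational_rotation_error) auto
    also have "of_int q / v * \<delta> \<le> r * \<delta>"
    proof (intro mult_right_mono)
      have "real_of_int q \<le> real r * real v" using q(2) by (metis of_int_le_iff of_int_of_nat_eq of_nat_mult)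
      then show "real_of_int q / real v \<le> real r" using v(1) by (simp add: pos_divide_le_eq)
    qed (use \<delta> in auto)
    also have "nd (of_int q * (of_int p / real v) - \<xi>) \<le> nd (real v * \<xi>) / v"
      unfolding i(2) nd_orbit_shift by (rule j(3))
    finally show "q \<in> {q. 0 \<le> q \<and> q \<le> \<lfloor>real (r * v)\<rfloor> \<and> nd (of_int q * \<alpha> - \<xi>) \<le> nd (real v * \<xi>) / v + r * \<delta>}"
      using q by (simp del: of_nat_mult)
  qed
  then have "card Q \<le> card {q. 0 \<le> q \<and> q \<le> \<lfloor>real (r * v)\<rfloor> \<and> nd (of_int q * \<alpha> - \<xi>) \<le> nd (real v * \<xi>) / v + r * \<delta>}"
    by (intro card_mono finite_bounded_ints)
  moreover have "real r \<le> real (r * v) + 1"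
  proof -
    have "r * 1 \<le> r * v" using v(1) by (rule mult_le_mono2)
    then have "real r \<le> real (r * v)" by (intro of_nat_mono) simp
    then show ?thesis by simp
  qed
  ultimately show ?thesis
    using r \<open>card Q = r\<close> by (subst rth_min_le_iff) auto
qed

text \<open>Up to the drift \<open>T / v * \<delta>\<close>, the orbit stays on the multiples of \<open>1 / v\<close>, whose distance from \<open>\<xi>\<close>
  is at least \<open>nd (v * \<xi>) / v\<close>.\<close>

lemma first_min_ge_near_rational:
  assumes v: "1 \<le> v" "\<bar>real v * \<alpha> - of_int p\<bar> < \<delta>" and "0 \<le> T"
  shows "nd (real v * \<xi>) / v - T / v * \<delta> \<le> rth_min 1 \<xi> T \<alpha>"
proof (rule first_min_ge)
  fix q :: int assume q: "0 \<le> q" "of_int q \<le> T"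
  have \<delta>: "0 < \<delta>" using v(2) by linarith
  have "nd (real v * \<xi>) = nd (of_int (int v) * (of_int q * (of_int p / real v) - \<xi>))"
  proof -
    have "of_int (int v) * (of_int q * (of_int p / real v) - \<xi>) = - (real v * \<xi>) + of_int (q * p)"
      using v(1) by (simp add: field_simps)
    then have "nd (of_int (int v) * (of_int q * (of_int p / real v) - \<xi>)) = nd (- (real v * \<xi>))" by (metis nd_add_int)
    then show ?thesis by simp
  qed
  also have "\<dots> \<le> v * nd (of_int q * (of_int p / real v) - \<xi>)"
    using nd_int_mult_le[of "int v"] by simp
  finally have "nd (real v * \<xi>) / v \<le> nd (of_int q * (of_int p / real v) - \<xi>)"
    using v(1) by (simp add: pos_divide_le_eq mult.commute)
  also have "\<dots> \<le> nd (of_int q * \<alpha> - \<xi>) + \<bar>of_int q * (of_int p / real v) - of_int q * \<alpha>\<bar>" by (rule nd_perturb)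
  also have "\<bar>of_int q * (of_int p / real v) - of_int q * \<alpha>\<bar> \<le> of_int q / v * \<delta>"
    using rational_rotation_error[OF v(1) q(1) v(2)] by (simp add: abs_minus_commute)
  also have "of_int q / v * \<delta> \<le> T / v * \<delta>"
    using q \<delta> by (intro mult_right_mono divide_right_mono) auto
  finally show "nd (real v * \<xi>) / v - T / v * \<delta> \<le> nd (of_int q * \<alpha> - \<xi>)" by simp
qed fact

section \<open>The exponents\<close>

lemma AE_circ_countable_exception:
  assumes "countable {x. \<not> P x}"
  shows "AE x in circ. P x"
proof -
  have "{x. \<not> P x} \<in> null_sets lborel" using assms by (rule countable_imp_null_set_lborel)
  then have "AE x in lborel. x \<notin> {x. \<not> P x}" by (rule AE_not_in)
  then show ?thesis unfolding AE_circ by (rule AE_mp) auto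
qed

lemma AE_circ_irrational: "AE \<alpha> in circ. \<alpha> \<notin> \<rat>"
  by (rule AE_circ_countable_exception) (simp add: countable_rat)

lemma AE_circ_no_exact_hit:
  assumes "\<xi> \<notin> \<int>"
  shows "AE \<alpha> in circ. \<forall>q::int. of_int q * \<alpha> - \<xi> \<notin> \<int>"
proof (rule AE_circ_countable_exception)
  have "{\<alpha>. \<not> (\<forall>q::int. of_int q * \<alpha> - \<xi> \<notin> \<int>)} \<subseteq> (\<lambda>(q::int, m::int). (of_int m + \<xi>) / of_int q) ` UNIV"
  proof
    fix \<alpha> assume "\<alpha> \<in> {\<alpha>. \<not> (\<forall>q::int. of_int q * \<alpha> - \<xi> \<notin> \<int>)}"
    then obtain q m :: int where qm: "of_int q * \<alpha> - \<xi> = of_int m" by (auto elim: Ints_cases)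
    have "q \<noteq> 0"
    proof
      assume "q = 0"
      with qm have "\<xi> = of_int (- m)" by simp
      then show False using assms by (metis Ints_of_int)
    qed
    then have "\<alpha> = (of_int m + \<xi>) / of_int q" using qm by (simp add: field_simps)
    then show "\<alpha> \<in> (\<lambda>(q::int, m::int). (of_int m + \<xi>) / of_int q) ` UNIV" by (intro image_eqI[of _ _ "(q, m)"]) auto
  qed
  then show "countable {\<alpha>. \<not> (\<forall>q::int. of_int q * \<alpha> - \<xi> \<notin> \<int>)}"
    by (rule countable_subset) auto
qed

lemma eventually_ln_dyadic_le:
  assumes "0 < r"
  shows "eventually (\<lambda>n::nat. ln (r * 2 ^ n * real n powr u) \<le> real n) sequentially"
proof -
  define l :: real where "l = ln 2"
  have "l < 1" unfolding l_def by (rule ln_2_less_1)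
  then have "eventually (\<lambda>n::nat. ln r + real n * l + u * ln (real n) \<le> real n) sequentially" by real_asymp
  then show ?thesis
    using eventually_gt_at_top[of 0]
  proof eventually_elim
    case (elim n)
    have "ln (r * 2 ^ n * real n powr u) = ln r + real n * l + u * ln (real n)"
      using assms elim(2) by (simp add: ln_mult ln_realpow ln_powr l_def)
    with elim(1) show ?case by simp
  qed
qed

text \<open>The first \<open>q\<close> points of the orbit come close to every multiple of \<open>1 / q\<close>.\<close>

lemma large_first_min_bound:
  assumes "1 \<le> T" and q: "0 < q" "q \<le> \<lfloor>T\<rfloor>" "coprime p q" "\<bar>of_int q * \<alpha> - of_int p\<bar> < 1 / of_int \<lfloor>T\<rfloor>"
  shows "rth_min 1 \<xi> T \<alpha> \<le> 2 / of_int q"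
proof -
  define v where "v = nat q"
  have v: "1 \<le> v" "q = int v" using q(1) by (auto simp: v_def)
  obtain j where j: "0 \<le> j" "j < int v" "nd (of_int j * (of_int p / real v) - \<xi>) \<le> nd (real v * \<xi>) / v"
    using rational_orbit_near[of v p \<xi>] v q(3) by auto
  have T: "0 < (of_int \<lfloor>T\<rfloor> :: real)" "of_int q \<le> (of_int \<lfloor>T\<rfloor> :: real)" using assms(1) q(2) by auto
  have inv: "1 / of_int \<lfloor>T\<rfloor> \<le> 1 / (of_int q :: real)" using T q(1) by (intro divide_left_mono) auto
  show ?thesis
  proof (rule first_min_le)
    show "0 \<le> j" by (rule j(1))
    show "of_int j \<le> T" using j(2) q(2) v(2) by linarith
    have "nd (of_int j * \<alpha> - \<xi>) \<le> nd (of_int j * (of_int p / real v) - \<xi>) + \<bar>of_int j * \<alpha> - of_int j * (of_int p / real v)\<bar>"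
      by (rule nd_perturb)
    also have "\<bar>of_int j * \<alpha> - of_int j * (of_int p / real v)\<bar> \<le> of_int j / v * (1 / of_int \<lfloor>T\<rfloor>)"
      using v j q(4) by (intro rational_rotation_error) auto
    also have "of_int j / v * (1 / of_int \<lfloor>T\<rfloor>) \<le> 1 * (1 / of_int q)"
      using j v T inv by (intro mult_mono) auto
    also have "nd (of_int j * (of_int p / real v) - \<xi>) \<le> nd (real v * \<xi>) / v" by (rule j(3))
    also have "nd (real v * \<xi>) / v \<le> 1 / of_int q"
      using nd_le_half[of "real v * \<xi>"] v by (intro frac_le) auto
    finally show "nd (of_int j * \<alpha> - \<xi>) \<le> 2 / of_int q" by simp
  qed
qed

text \<open>Dirichlet's theorem gives a denominator \<open>q \<le> T\<close> with \<open>nd (q * \<alpha>) < 1 / T\<close>, up to rounding. For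
  almost every \<open>\<alpha>\<close> and large \<open>q\<close>, this distance is at least \<open>1 / q\<close> divided by a power of
  \<open>ln q\<close>. Hence \<open>q\<close> is at least \<open>T\<close> divided by a power of
  \<open>ln T\<close>, and the orbit has no gap much longer than \<open>1 / q\<close>.\<close>

theorem AE_large_first_min_exponent_le:
  assumes t: "1 < t" and \<xi>: "\<xi> \<notin> \<int>"
  shows "AE \<alpha> in circ. eventually (\<lambda>T. ln (rth_min_scaled 1 \<xi> T \<alpha>) / ln (ln T) \<le> t) at_top"
proof -
  obtain s where s: "1 < s" "s < t" using dense[OF t] by blast
  show ?thesis
    using AE_no_close_multiple[OF s(1), of 0] AE_circ_irrational AE_circ_no_exact_hit[OF \<xi>]
  proof eventually_elim
    case (elim \<alpha>)
    then obtain n\<^sub>0 where n0: "\<forall>n\<ge>n\<^sub>0. \<forall>q\<in>{1..2 ^ Suc n}. real n powr (- s) / 2 ^ n \<le> nd (real q * \<alpha> - 0)"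
      unfolding eventually_sequentially by blast
    define n\<^sub>1 where "n\<^sub>1 = max n\<^sub>0 1"
    \<comment> \<open>Denominators up to \<open>2 ^ n\<^sub>1\<close> are excluded for large \<open>T\<close> because \<open>\<alpha>\<close> is irrational.\<close>
    define \<mu> where "\<mu> = Min ((\<lambda>q. nd (real q * \<alpha>)) ` {1..2 ^ n\<^sub>1})"
    have "0 < nd (real q * \<alpha>)" if "1 \<le> q" for q :: nat
    proof -
      have "real q * \<alpha> \<notin> \<int>"
      proof
        assume "real q * \<alpha> \<in> \<int>"
        then have "real q * \<alpha> / real q \<in> \<rat>" by (intro Rats_divide) (auto intro: subsetD[OF Ints_subset_Rats])
        then show False using elim(2) that by simp
      qed
      then show ?thesis by (simp add: nd_pos_iff)
    qed
    then have \<mu>: "0 < \<mu>" unfolding \<mu>_def by (subst Min_gr_iff) auto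
    have "eventually (\<lambda>T::real. 4 * (2 * ln T) powr s \<le> ln T powr t) at_top" using s by real_asymp
    moreover have "eventually (\<lambda>T::real. 1 / \<mu> + 1 < T) at_top" by (rule eventually_gt_at_top)
    ultimately show ?case
      using eventually_ge_at_top[of 4]
    proof eventually_elim
      case (elim T)
      define N where "N = nat \<lfloor>T\<rfloor>"
      have N: "real N = of_int \<lfloor>T\<rfloor>" "1 \<le> N" "T \<le> real N + 1" "1 / \<mu> < real N" "real N \<le> T"
        using elim(2,3) unfolding N_def by linarith+
      have N0: "0 < N" using N(2) by simp
      obtain p q where pq: "coprime p q" "0 < q" "q \<le> int N" "\<bar>of_int q * \<alpha> - of_int p\<bar> < 1 / real N"
        using Dirichlet_approx_coprime[OF N0, of \<alpha>] by blast
      define v where "v = nat q"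
      have v: "1 \<le> v" "q = int v" "real v \<le> real N" using pq(2,3) by (auto simp: v_def)
      have small: "nd (real v * \<alpha>) < 1 / real N"
        using nd_le[of "real v * \<alpha>" p] pq(4) v(2) by simp
      have "2 ^ n\<^sub>1 < v"
      proof (rule ccontr)
        assume "\<not> ?thesis"
        then have "\<mu> \<le> nd (real v * \<alpha>)" unfolding \<mu>_def using v(1) by (intro Min_le) auto
        also note small
        also have "1 / real N < \<mu>" using N(4) \<mu> N0 by (simp add: field_simps)
        finally show False .
      qed
      then have "(2::real) ^ n\<^sub>1 \<le> real v" by (metis less_imp_le_nat of_nat_le_iff of_nat_numeral of_nat_power)
      then obtain n where n: "n\<^sub>1 \<le> n" "2 ^ n \<le> real v" "real v < 2 ^ Suc n" by (rule dyadic_window)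
      have "real v \<le> real (2 ^ Suc n)" using n(3) by simp
      then have "v \<le> 2 ^ Suc n" by (simp only: of_nat_le_iff)
      then have "real n powr (- s) / 2 ^ n \<le> nd (real v * \<alpha>)"
        using n0 n(1) v(1) by (auto simp: n\<^sub>1_def)
      also note small
      finally have lower: "real n powr (- s) / 2 ^ n < 1 / real N" .
      have n1: "1 \<le> n" using n(1) by (simp add: n\<^sub>1_def)
      have "real N < real n powr s * 2 ^ n"
        using lower N0 n1 by (simp add: powr_minus field_simps)
      also have "\<dots> \<le> real n powr s * real v" using n(2) by (intro mult_left_mono) auto
      finally have Nv: "real N \<le> real n powr s * real v" by simp
      have "real n * ln 2 = ln (2 ^ n)" by (simp add: ln_realpow)
      also have "\<dots> \<le> ln T"
      proof -
        have "2 ^ n \<le> T" using n(2) v(3) N(5) by linarith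
        then show ?thesis using elim(3) by (subst ln_le_cancel_iff) auto
      qed
      finally have "real n * ln 2 \<le> ln T" .
      moreover have "real n * (1 / 2) \<le> real n * ln 2"
        using ln_le_minus_one[of "1 / 2"] by (intro mult_left_mono) (auto simp: ln_div)
      ultimately have nT: "real n \<le> 2 * ln T" by linarith
      define k where "k = rth_min_scaled 1 \<xi> T \<alpha>"
      have "0 < k"
        unfolding k_def rth_min_scaled_def using elim(3) \<open>\<forall>q::int. of_int q * \<alpha> - \<xi> \<notin> \<int>\<close>
        by (intro mult_pos_pos rth_min_pos) auto
      have "rth_min 1 \<xi> T \<alpha> \<le> 2 / of_int q"
        using pq elim(3) N(1) by (intro large_first_min_bound) (auto simp: N_def)
      then have "k \<le> T * (2 / of_int q)"
        unfolding k_def rth_min_scaled_def using elim(3) by (intro mult_left_mono) auto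
      also have "\<dots> = T * (2 / real v)" by (simp add: v(2))
      also have "\<dots> \<le> (2 * real N) * (2 / real v)"
        using N(2,3) by (intro mult_right_mono) auto
      also have "\<dots> = 4 * (real N / real v)" by simp
      also have "\<dots> \<le> 4 * real n powr s" using Nv v(1) by (simp add: pos_divide_le_eq)
      also have "\<dots> \<le> 4 * (2 * ln T) powr s" using nT s by (intro mult_left_mono powr_mono2) auto
      also have "\<dots> \<le> ln T powr t" by (rule elim(1))
      finally have "k \<le> ln T powr t" .
      then have "ln k \<le> ln (ln T powr t)" using \<open>0 < k\<close> by (subst ln_le_cancel_iff; linarith)
      also have "\<dots> = t * ln (ln T)" using ln_ln_pos[OF elim(3)] by (simp add: ln_powr)
      finally show "ln (rth_min_scaled 1 \<xi> T \<alpha>) / ln (ln T) \<le> t"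
        using ln_ln_pos[OF elim(3)] unfolding k_def by (subst pos_divide_le_eq) auto
    qed
  qed
qed

text \<open>Comparison with the primitive \<open>ln (ln x)\<close> of \<open>1 / (x * ln x)\<close>.\<close>

lemma sum_inverse_n_ln_ge:
  "ln (ln (real N + 3)) - ln (ln 3) \<le> (\<Sum>q=1..N. 1 / (real q * ln (real q + 2)))"
proof (induction N)
  case (Suc N)
  define x where "x = real N + 3"
  have x: "3 \<le> x" by (simp add: x_def)
  then have lx: "0 < ln x" by simp
  have "ln (ln (x + 1)) - ln (ln x) = ln (ln (x + 1) / ln x)"
    using x lx by (subst ln_div) auto
  also have "\<dots> = ln (1 + (ln (x + 1) - ln x) / ln x)" using lx by (simp add: field_simps)
  also have "\<dots> \<le> (ln (x + 1) - ln x) / ln x"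
    using lx x by (intro ln_add_one_self_le_self divide_nonneg_pos) auto
  also have "ln (x + 1) - ln x \<le> 1 / x"
  proof -
    have "ln (x + 1) - ln x = ln ((x + 1) / x)" using x by (subst ln_div) auto
    also have "\<dots> = ln (1 + 1 / x)" using x by (simp add: field_simps)
    also have "\<dots> \<le> 1 / x" using x by (intro ln_add_one_self_le_self) auto
    finally show ?thesis .
  qed
  then have "(ln (x + 1) - ln x) / ln x \<le> 1 / x / ln x" using lx by (intro divide_right_mono) auto
  also have "\<dots> \<le> 1 / (real (Suc N) * ln (real (Suc N) + 2))"
  proof -
    have "real (Suc N) + 2 = x" by (simp add: x_def)
    moreover have "1 / (x * ln x) \<le> 1 / (real (Suc N) * ln x)"
      using lx by (intro frac_le mult_right_mono mult_pos_pos) (auto simp: x_def)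
    ultimately show ?thesis by simp
  qed
  finally have "ln (ln (x + 1)) - ln (ln x) \<le> 1 / (real (Suc N) * ln (real (Suc N) + 2))" .
  then show ?case using Suc by (simp add: x_def algebra_simps)
qed simp

context diophantine
begin

lemma irrational: "\<xi> \<notin> \<rat>"
  using diophantine_type_irrational[of \<xi>] M_ge c_pos badly_approximable
  unfolding diophantine_type_def by blast

lemma not_int: "\<xi> \<notin> \<int>"
  using irrational Ints_subset_Rats by blast

lemma eventually_nd_ge:
  assumes "0 < s"
  shows "eventually (\<lambda>n::nat. real n powr (- s) / 2 ^ n < nd \<xi>) sequentially"
proof -
  have "0 < nd \<xi>" using not_int nd_pos_iff by simp
  then show ?thesis using assms by real_asymp
qed

theorem AE_first_min_exponent_le:
  assumes "1 < t"
  shows "AE \<alpha> in circ. eventually (\<lambda>T. - ln (rth_min_scaled 1 \<xi> T \<alpha>) / ln (ln T) \<le> t) at_top"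
proof -
  obtain s where s: "1 < s" "s < t" using dense[OF assms] by blast
  show ?thesis
    using AE_no_close_multiple[OF s(1), of \<xi>]
  proof (rule AE_mp, intro AE_I2 impI)
    fix \<alpha> assume ev: "eventually (\<lambda>n. \<forall>q\<in>{1..2 ^ Suc n}. real n powr (- s) / 2 ^ n \<le> nd (real q * \<alpha> - \<xi>)) sequentially"
    show "eventually (\<lambda>T. - ln (rth_min_scaled 1 \<xi> T \<alpha>) / ln (ln T) \<le> t) at_top"
    proof (rule scaled_min_exponent_le)
      have "0 < s" using s by simp
      from ev eventually_nd_ge[OF this]
      show "eventually (\<lambda>n. \<forall>T. 2 ^ n \<le> T \<and> T < 2 ^ Suc n \<longrightarrow> real n powr (- s) / 2 ^ n \<le> rth_min 1 \<xi> T \<alpha>) sequentially"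
      proof eventually_elim
        case (elim n)
        show ?case
        proof (intro allI impI first_min_ge)
          fix T :: real assume T: "2 ^ n \<le> T \<and> T < 2 ^ Suc n"
          then show "0 \<le> T" by (auto intro: order_trans[OF _ conjunct1])
          fix q :: int assume q: "0 \<le> q" "of_int q \<le> T"
          show "real n powr (- s) / 2 ^ n \<le> nd (of_int q * \<alpha> - \<xi>)"
          proof (cases "q = 0")
            case False
            define m where "m = nat q"
            have m: "q = int m" "1 \<le> m" using q False by (auto simp: m_def)
            have "real m \<le> real (2 ^ Suc n)" using q(2) T m(1) by simp
            then have "m \<le> 2 ^ Suc n" by (simp only: of_nat_le_iff)
            then show ?thesis using elim(1) m by simp
          qed (use elim(2) in simp)
        qed
      qed
    qed (use s in auto)
  qed
qed

theorem AE_second_min_exponent_le: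
  assumes "1 / 2 < t"
  shows "AE \<alpha> in circ. \<forall>r\<ge>2. eventually (\<lambda>T. - ln (rth_min_scaled r \<xi> T \<alpha>) / ln (ln T) \<le> t) at_top"
proof -
  obtain s where s: "1 / 2 < s" "s < t" using dense[OF assms] by blast
  show ?thesis
    using AE_no_close_pair[OF s(1)]
  proof (rule AE_mp, intro AE_I2 impI allI)
    fix \<alpha> and r :: nat
    assume ev: "eventually (\<lambda>n. \<forall>p\<in>{1..2 ^ Suc n}. \<forall>q\<in>{1..<p}.
      \<not> (nd (real q * \<alpha> - \<xi>) < real n powr (- s) / 2 ^ n \<and> nd (real p * \<alpha> - \<xi>) < real n powr (- s) / 2 ^ n)) sequentially"
      and r: "2 \<le> r"
    show "eventually (\<lambda>T. - ln (rth_min_scaled r \<xi> T \<alpha>) / ln (ln T) \<le> t) at_top"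
    proof (rule scaled_min_exponent_le)
      have "0 < s" using s by simp
      have "eventually (\<lambda>n::nat. real r \<le> 2 ^ n) sequentially" by real_asymp
      from this ev eventually_nd_ge[OF \<open>0 < s\<close>]
      show "eventually (\<lambda>n. \<forall>T. 2 ^ n \<le> T \<and> T < 2 ^ Suc n \<longrightarrow> real n powr (- s) / 2 ^ n \<le> rth_min r \<xi> T \<alpha>) sequentially"
      proof eventually_elim
        case (elim n)
        show ?case
        proof (intro allI impI)
          fix T :: real assume T: "2 ^ n \<le> T \<and> T < 2 ^ Suc n"
          define \<delta> where "\<delta> = real n powr (- s) / 2 ^ n"
          define Q where "Q = {q::int. 0 \<le> q \<and> q \<le> \<lfloor>T\<rfloor> \<and> nd (of_int q * \<alpha> - \<xi>) < \<delta>}"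
          have "q = p" if pq: "q \<in> Q" "p \<in> Q" for p q
          proof (rule ccontr)
            have pos: "1 \<le> k \<and> nat k \<le> 2 ^ Suc n \<and> nd (real (nat k) * \<alpha> - \<xi>) < \<delta>" if "k \<in> Q" for k
            proof -
              have "k \<noteq> 0"
              proof
                assume "k = 0"
                then have "nd \<xi> < \<delta>" using that by (simp add: Q_def)
                then show False using elim(3) by (simp add: \<delta>_def)
              qed
              moreover have "of_int k \<le> T" using that by (simp add: Q_def le_floor_iff)
              moreover have "0 \<le> k" using that by (simp add: Q_def)
              ultimately have "1 \<le> k" "real (nat k) \<le> real (2 ^ Suc n)" using T by simp_all
              then show ?thesis using that by (simp only: of_nat_le_iff) (simp add: Q_def)
            qed
            have main: False if kl: "k \<in> Q" "l \<in> Q" "k < l" for k l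
            proof -
              have "nat l \<in> {1..2 ^ Suc n}" "nat k \<in> {1..<nat l}"
                using pos[OF kl(1)] pos[OF kl(2)] kl(3) by auto
              then have "\<not> (nd (real (nat k) * \<alpha> - \<xi>) < \<delta> \<and> nd (real (nat l) * \<alpha> - \<xi>) < \<delta>)"
                using elim(2) unfolding \<delta>_def by blast
              then show False using pos[OF kl(1)] pos[OF kl(2)] by blast
            qed
            assume "q \<noteq> p"
            then show False using main pq by (metis linorder_neqE)
          qed
          then have "card Q \<le> 1" by (simp add: card_le_Suc0_iff_eq Q_def finite_bounded_ints)
          then have "card Q < r" using r by linarith
          then show "real n powr (- s) / 2 ^ n \<le> rth_min r \<xi> T \<alpha>"
          proof (intro rth_min_ge_if_few_close)
            show "real r \<le> T + 1" using elim(1) T by linarith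
          qed (use r in \<open>auto simp: Q_def \<delta>_def\<close>)
        qed
      qed
    qed (use s in auto)
  qed
qed

text \<open>The radii \<open>1 / (2 * q * ln q powr t)\<close> have a divergent sum for \<open>t < 1\<close>, and a hit at \<open>q\<close> bounds the
  scaled minimum at \<open>T = q\<close>.\<close>

theorem AE_first_min_exponent_ge:
  assumes t: "0 \<le> t" "t < 1"
  shows "AE \<alpha> in circ. frequently (\<lambda>T. t \<le> - ln (rth_min_scaled 1 \<xi> T \<alpha>) / ln (ln T)) at_top"
proof -
  \<comment> \<open>The shift by 2 keeps the logarithm above 1, so that the radii stay below \<open>1 / (2 * q)\<close>.\<close>
  define \<psi> where "\<psi> = (\<lambda>q::nat. if q = 0 then 0 else 1 / (2 * real q * ln (real q + 2) powr t))"
  have ln1: "1 < ln (real q + 2)" if "1 \<le> q" for q :: nat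
  proof -
    have "exp 1 < (3::real)" by (rule e_less_272[THEN order_less_trans]) simp
    also have "3 \<le> real q + 2" using that by simp
    finally show ?thesis using ln_less_cancel_iff[of "exp 1" "real q + 2"] by simp
  qed
  have "AE \<alpha> in circ. \<exists>\<^sub>\<infinity>q. \<alpha> \<in> hits \<xi> q (\<psi> q)"
  proof (rule khinchin_inhomogeneous)
    show "\<psi> n \<le> \<psi> m" if mn: "1 \<le> m" "m \<le> n" for m n
    proof -
      have "ln (real m + 2) powr t \<le> ln (real n + 2) powr t"
        using mn t ln1[of m] by (intro powr_mono2) auto
      then have "2 * real m * ln (real m + 2) powr t \<le> 2 * real n * ln (real n + 2) powr t"
        using mn by (intro mult_mono) auto
      moreover have "0 < 2 * real m * ln (real m + 2) powr t" using mn ln1[of m] by (intro mult_pos_pos) auto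
      ultimately show ?thesis using mn by (simp add: \<psi>_def frac_le)
    qed
    show "0 \<le> \<psi> n" for n by (simp add: \<psi>_def)
    show "\<psi> n \<le> 1 / (2 * real n)" if n: "1 \<le> n" for n
    proof -
      have "1 \<le> ln (real n + 2) powr t" using ln1[OF n] t by (simp add: ge_one_powr_ge_zero)
      then have "2 * real n * 1 \<le> 2 * real n * ln (real n + 2) powr t" by (intro mult_left_mono) auto
      then show ?thesis using n by (simp add: \<psi>_def frac_le)
    qed
    show "filterlim (\<lambda>Q. \<Sum>n=1..Q. \<psi> n) at_top sequentially"
    proof (rule filterlim_at_top_mono)
      show "filterlim (\<lambda>N::nat. (ln (ln (real N + 3)) - ln (ln 3)) / 2) at_top sequentially" by real_asymp
      have "(ln (ln (real N + 3)) - ln (ln 3)) / 2 \<le> (\<Sum>n=1..N. \<psi> n)" for N :: nat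
      proof -
        have "(ln (ln (real N + 3)) - ln (ln 3)) / 2 \<le> (\<Sum>q=1..N. 1 / (real q * ln (real q + 2))) / 2"
          using sum_inverse_n_ln_ge by (intro divide_right_mono) auto
        also have "\<dots> = (\<Sum>q=1..N. 1 / (2 * real q * ln (real q + 2)))"
          by (simp add: sum_divide_distrib mult_ac)
        also have "\<dots> \<le> (\<Sum>n=1..N. \<psi> n)"
        proof (rule sum_mono)
          fix q assume q: "q \<in> {1..N}"
          then have l: "1 < ln (real q + 2)" using ln1 by auto
          then have "ln (real q + 2) powr t \<le> ln (real q + 2) powr 1" using t by (intro powr_mono) auto
          then have "2 * real q * ln (real q + 2) powr t \<le> 2 * real q * ln (real q + 2)"
            using l by (intro mult_left_mono) auto
          moreover have "0 < 2 * real q * ln (real q + 2) powr t" using q l by (intro mult_pos_pos) auto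
          ultimately show "1 / (2 * real q * ln (real q + 2)) \<le> \<psi> q" using q by (simp add: \<psi>_def frac_le)
        qed
        finally show ?thesis .
      qed
      then show "eventually (\<lambda>N::nat. (ln (ln (real N + 3)) - ln (ln 3)) / 2 \<le> (\<Sum>n=1..N. \<psi> n)) sequentially" by simp
    qed
  qed
  then show ?thesis
    using AE_circ_no_exact_hit[OF not_int]
  proof eventually_elim
    case (elim \<alpha>)
    show ?case unfolding frequently_at_top_real_iff
    proof
      fix B :: real
      obtain N :: nat where N: "max 4 B \<le> real N" using real_arch_simple by blast
      obtain q where q: "N \<le> q" "\<alpha> \<in> hits \<xi> q (\<psi> q)" using elim(1) unfolding INFM_nat_le by blast
      define T where "T = real q"
      have T: "4 \<le> T" "B \<le> T" using N q(1) by (auto simp: T_def)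
      have q0: "1 \<le> q" using T by (simp add: T_def)
      define k where "k = rth_min_scaled 1 \<xi> T \<alpha>"
      have "0 < k"
        unfolding k_def rth_min_scaled_def using T elim(2) by (intro mult_pos_pos rth_min_pos) auto
      have "rth_min 1 \<xi> T \<alpha> \<le> \<psi> q"
        using q(2) first_min_le[of "int q" T \<alpha> \<xi> "\<psi> q"] by (simp add: hits_def T_def)
      then have "k \<le> T * \<psi> q"
        unfolding k_def rth_min_scaled_def using T by (intro mult_left_mono) auto
      also have "\<dots> = (1 / 2) * ln (T + 2) powr (- t)"
        using q0 by (simp add: \<psi>_def T_def powr_minus_divide)
      also have "\<dots> \<le> 1 * ln (T + 2) powr (- t)" by (intro mult_right_mono) auto
      also have "\<dots> \<le> 1 * ln T powr (- t)"
        using T t ln_ln_pos[OF T(1)] by (intro mult_left_mono powr_mono2') auto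
      finally have "k \<le> ln T powr (- t)" by simp
      then have "ln k \<le> ln (ln T powr (- t))"
        using \<open>0 < k\<close> by (subst ln_le_cancel_iff) auto
      also have "\<dots> = - t * ln (ln T)" using ln_ln_pos[OF T(1)] by (simp add: ln_powr)
      finally have "t \<le> - ln k / ln (ln T)" using ln_ln_pos[OF T(1)] by (subst pos_le_divide_eq) auto
      then show "\<exists>T\<ge>B. t \<le> - ln (rth_min_scaled 1 \<xi> T \<alpha>) / ln (ln T)"
        using T(2) unfolding k_def by blast
    qed
  qed
qed

text \<open>The cost \<open>a + b \<le> 1\<close> is shared equally between \<open>v * \<xi>\<close> being close to an integer, which places one
  point near \<open>\<xi>\<close>, and \<open>v * \<alpha>\<close> being close to an integer, which repeats it \<open>r\<close> times.\<close>

theorem AE_rth_min_exponent_ge: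
  assumes t: "0 \<le> t" "t < 1 / 2"
  shows "AE \<alpha> in circ. \<forall>r\<ge>1. frequently (\<lambda>T. t \<le> - ln (rth_min_scaled r \<xi> T \<alpha>) / ln (ln T)) at_top"
proof -
  obtain a where a: "t < a" "a < 1 / 2" using dense[OF t(2)] by blast
  have "AE \<alpha> in circ. \<exists>C. \<forall>N. \<exists>n\<ge>N. \<exists>v\<in>bohr_window 0 a n. \<alpha> \<in> reduced_hits v (C * (real n powr (- a) / 2 ^ n))"
    using a t by (intro khinchin_bohr) auto
  then show ?thesis
    using AE_circ_no_exact_hit[OF not_int]
  proof eventually_elim
    case (elim \<alpha>)
    show ?case
    proof (intro allI impI)
      fix r :: nat assume r: "1 \<le> r"
      obtain C where C: "\<And>N. \<exists>n\<ge>N. \<exists>v\<in>bohr_window 0 a n. \<alpha> \<in> reduced_hits v (C * (real n powr (- a) / 2 ^ n))"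
        using elim(1) by blast
      have "eventually (\<lambda>n::nat. (real r + 2 * real r ^ 2 * C) * real n powr (- a) \<le> real n powr (- t)) sequentially"
        using a t by real_asymp
      moreover have "eventually (\<lambda>n::nat. ln (real r * (2 * 2 ^ n)) \<le> real n) sequentially"
      proof -
        have "0 < 2 * real r" using r by simp
        from eventually_ln_dyadic_le[OF this, of 0] eventually_gt_at_top[of 0] show ?thesis
          by eventually_elim (simp add: mult_ac)
      qed
      ultimately have "eventually (\<lambda>n::nat. (real r + 2 * real r ^ 2 * C) * real n powr (- a) \<le> real n powr (- t) \<and>
          ln (real r * (2 * 2 ^ n)) \<le> real n) sequentially" by (rule eventually_conj)
      then obtain N\<^sub>0 where N0: "\<forall>n\<ge>N\<^sub>0. (real r + 2 * real r ^ 2 * C) * real n powr (- a) \<le> real n powr (- t) \<and>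
          ln (real r * (2 * 2 ^ n)) \<le> real n" unfolding eventually_sequentially by (rule exE)
      show "frequently (\<lambda>T. t \<le> - ln (rth_min_scaled r \<xi> T \<alpha>) / ln (ln T)) at_top"
        unfolding frequently_at_top_real_iff
      proof
        fix B :: real
        obtain m where m: "max 4 B < 2 ^ m" using real_arch_pow[of 2 "max 4 B"] by auto
        obtain n v where n: "max m N\<^sub>0 \<le> n" "v \<in> bohr_window 0 a n" "\<alpha> \<in> reduced_hits v (C * (real n powr (- a) / 2 ^ n))"
          using C[of "max m N\<^sub>0"] by blast
        define \<delta> where "\<delta> = C * (real n powr (- a) / 2 ^ n)"
        obtain p :: int where p: "coprime p (int v)" "\<bar>real v * \<alpha> - of_int p\<bar> < \<delta>"
          using n(3) by (auto simp: reduced_hits_def \<delta>_def)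
        have v: "2 ^ n \<le> v" "v < 2 ^ Suc n" "nd (real v * \<xi>) < real n powr (- a)"
          using n(2) by (auto simp: bohr_window_def)
        have "real (2 ^ n) \<le> real v" using v(1) by (intro of_nat_mono)
        then have vr: "2 ^ n \<le> real v" by simp
        have "real v \<le> real (2 ^ Suc n)" using v(2) by (intro of_nat_mono) simp
        then have vr2: "real v \<le> 2 * 2 ^ n" by simp
        have v1: "1 \<le> v" using v(1) one_le_power[of "2::nat" n] by linarith
        define T where "T = real (r * v)"
        have "(2::real) ^ m \<le> 2 ^ n" using n(1) by (intro power_increasing) auto
        also have "\<dots> \<le> 1 * real v" using vr by simp
        also have "\<dots> \<le> real r * real v" using r by (intro mult_right_mono) auto
        finally have "(2::real) ^ m \<le> T" by (simp add: T_def)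
        then have T: "4 \<le> T" "B \<le> T" using m by auto
        have lnT: "ln T \<le> real n"
        proof -
          have "T \<le> real r * (2 * 2 ^ n)" unfolding T_def of_nat_mult using vr2 by (intro mult_left_mono) auto
          then have "ln T \<le> ln (real r * (2 * 2 ^ n))" using T by (subst ln_le_cancel_iff; linarith)
          then show ?thesis using N0 n(1) by force
        qed
        define k where "k = rth_min_scaled r \<xi> T \<alpha>"
        have rT: "real r \<le> T + 1"
        proof -
          have "real r * 1 \<le> real r * real v" using v1 by (intro mult_left_mono) auto
          then show ?thesis by (simp add: T_def)
        qed
        have "0 < k"
          unfolding k_def rth_min_scaled_def using T r rT elim(2) by (intro mult_pos_pos rth_min_pos) auto
        have "k \<le> T * (nd (real v * \<xi>) / v + r * \<delta>)"
          unfolding k_def rth_min_scaled_def using T rth_min_near_rational[OF r v1 p, of \<xi>]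
          by (intro mult_left_mono) (auto simp: T_def)
        also have "\<dots> = r * nd (real v * \<xi>) + real r ^ 2 * (real v * \<delta>)"
          using v1 by (simp add: T_def distrib_left power2_eq_square)
        also have "\<dots> \<le> r * real n powr (- a) + real r ^ 2 * ((2 * 2 ^ n) * \<delta>)"
          using v(3) vr2 p(2) by (intro add_mono mult_left_mono mult_right_mono) auto
        also have "\<dots> = (real r + 2 * real r ^ 2 * C) * real n powr (- a)"
          by (simp add: \<delta>_def algebra_simps)
        also have "\<dots> \<le> real n powr (- t)" using N0 n(1) by force
        finally have "t \<le> - ln k / ln (ln T)"
          using \<open>0 < k\<close> t T lnT by (intro exponent_ge_if_small)
        then show "\<exists>T\<ge>B. t \<le> - ln (rth_min_scaled r \<xi> T \<alpha>) / ln (ln T)"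
          using T(2) unfolding k_def by blast
      qed
    qed
  qed
qed

text \<open>It suffices that \<open>v * \<xi>\<close> stays away from the integers, so nearly the whole exponent is
  spent on the approximation of \<open>\<alpha>\<close>. The orbit then misses \<open>\<xi>\<close> up to the time
  \<open>2 ^ n * n powr u\<close>, longer than \<open>v\<close> by almost a full logarithm.\<close>

theorem AE_large_first_min_exponent_ge:
  assumes t: "0 \<le> t" "t < 1"
  shows "AE \<alpha> in circ. frequently (\<lambda>T. t \<le> ln (rth_min_scaled 1 \<xi> T \<alpha>) / ln (ln T)) at_top"
proof -
  obtain u where u: "t < u" "u < 1" using dense[OF t(2)] by blast
  obtain b where b: "u < b" "b < 1" using dense[OF u(2)] by blast
  have "AE \<alpha> in circ. \<exists>C. \<forall>N. \<exists>n\<ge>N. \<exists>v\<in>bohr_window (1 / 2) (1 - b) n. \<alpha> \<in> reduced_hits v (C * (real n powr (- b) / 2 ^ n))"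
    using b u t by (intro khinchin_bohr) auto
  then show ?thesis
  proof eventually_elim
    case (elim \<alpha>)
    then obtain C where C: "\<And>N. \<exists>n\<ge>N. \<exists>v\<in>bohr_window (1 / 2) (1 - b) n. \<alpha> \<in> reduced_hits v (C * (real n powr (- b) / 2 ^ n))"
      by blast
    have "eventually (\<lambda>n::nat. C * real n powr (u - b) \<le> 1 / 16) sequentially" using b by real_asymp
    moreover have "eventually (\<lambda>n::nat. real n powr (- (1 - b)) \<le> 1 / 4) sequentially" using b by real_asymp
    moreover have "eventually (\<lambda>n::nat. ln (2 ^ n * real n powr u) \<le> real n) sequentially"
      using eventually_ln_dyadic_le[of 1 u] by simp
    moreover have "eventually (\<lambda>n::nat. real n powr t \<le> real n powr u / 16) sequentially" using u t by real_asymp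
    ultimately have "eventually (\<lambda>n::nat. 1 \<le> n \<and> C * real n powr (u - b) \<le> 1 / 16 \<and> real n powr (- (1 - b)) \<le> 1 / 4 \<and>
        ln (2 ^ n * real n powr u) \<le> real n \<and> real n powr t \<le> real n powr u / 16) sequentially"
      by (intro eventually_conj eventually_ge_at_top)
    then obtain N\<^sub>0 where N0: "\<forall>n\<ge>N\<^sub>0. 1 \<le> n \<and> C * real n powr (u - b) \<le> 1 / 16 \<and> real n powr (- (1 - b)) \<le> 1 / 4 \<and>
        ln (2 ^ n * real n powr u) \<le> real n \<and> real n powr t \<le> real n powr u / 16"
      unfolding eventually_sequentially by (rule exE)
    show ?case unfolding frequently_at_top_real_iff
    proof
      fix B :: real
      obtain m where m: "max 4 B < 2 ^ m" using real_arch_pow[of 2 "max 4 B"] by auto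
      obtain n v where n: "max m N\<^sub>0 \<le> n" "v \<in> bohr_window (1 / 2) (1 - b) n" "\<alpha> \<in> reduced_hits v (C * (real n powr (- b) / 2 ^ n))"
        using C[of "max m N\<^sub>0"] by blast
      have large: "1 \<le> n" "C * real n powr (u - b) \<le> 1 / 16" "real n powr (- (1 - b)) \<le> 1 / 4"
        "ln (2 ^ n * real n powr u) \<le> real n" "real n powr t \<le> real n powr u / 16"
        using N0 n(1) by auto
      define \<delta> where "\<delta> = C * (real n powr (- b) / 2 ^ n)"
      obtain p :: int where p: "coprime p (int v)" "\<bar>real v * \<alpha> - of_int p\<bar> < \<delta>"
        using n(3) by (auto simp: reduced_hits_def \<delta>_def)
      have v: "2 ^ n \<le> v" "v < 2 ^ Suc n" "nd (real v * \<xi> - 1 / 2) < real n powr (- (1 - b))"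
        using n(2) by (auto simp: bohr_window_def)
      have "real (2 ^ n) \<le> real v" using v(1) by (intro of_nat_mono)
      then have vr: "2 ^ n \<le> real v" by simp
      have "real v \<le> real (2 ^ Suc n)" using v(2) by (intro of_nat_mono) simp
      then have vr2: "real v \<le> 2 * 2 ^ n" by simp
      have v1: "1 \<le> v" using v(1) one_le_power[of "2::nat" n] by linarith
      have "nd (1 / 2) = 1 / 2" by (simp add: nd_def round_def)
      moreover have "nd (1 / 2) \<le> nd (real v * \<xi>) + nd (1 / 2 - real v * \<xi>)"
        using nd_triangle[of "real v * \<xi>" "1 / 2 - real v * \<xi>"] by simp
      ultimately have quarter: "1 / 4 \<le> nd (real v * \<xi>)"
        using v(3) large(3) nd_minus_commute[of "1 / 2" "real v * \<xi>"] by linarith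
      define T where "T = 2 ^ n * real n powr u"
      have "(2::real) ^ m \<le> 2 ^ n * 1" using n(1) by (simp add: power_increasing)
      also have "\<dots> \<le> T" unfolding T_def using large(1) u t by (intro mult_left_mono ge_one_powr_ge_zero) auto
      finally have T: "4 \<le> T" "B \<le> T" using m by auto
      define k where "k = rth_min_scaled 1 \<xi> T \<alpha>"
      have "1 / 4 / (2 * 2 ^ n) \<le> nd (real v * \<xi>) / v"
        using quarter vr2 v1 by (intro frac_le) auto
      moreover have "T / v * \<delta> \<le> (1 / 16) / 2 ^ n"
      proof -
        have "T / v * \<delta> \<le> T / 2 ^ n * \<delta>"
          using vr T p(2) v1 by (intro mult_right_mono divide_left_mono mult_pos_pos) auto
        also have "\<dots> = (C * (real n powr u * real n powr (- b))) / 2 ^ n" by (simp add: T_def \<delta>_def)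
        also have "real n powr u * real n powr (- b) = real n powr (u - b)" by (simp add: powr_add[symmetric])
        also have "C * real n powr (u - b) / 2 ^ n \<le> (1 / 16) / 2 ^ n" using large(2) by (intro divide_right_mono) auto
        finally show ?thesis .
      qed
      moreover have "1 / 4 / (2 * 2 ^ n) = 2 * ((1 / 16) / (2::real) ^ n)" by simp
      ultimately have "(1 / 16) / 2 ^ n \<le> rth_min 1 \<xi> T \<alpha>"
        using first_min_ge_near_rational[OF v1 p(2), of T \<xi>] T by linarith
      then have "T * ((1 / 16) / 2 ^ n) \<le> k"
        unfolding k_def rth_min_scaled_def using T by (intro mult_left_mono) auto
      then have "real n powr u / 16 \<le> k" by (simp add: T_def)
      with large(5) have "real n powr t \<le> k" by linarith
      moreover have "0 < real n powr t" using large(1) by simp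
      ultimately have "ln (real n powr t) \<le> ln k" by (subst ln_le_cancel_iff; linarith)
      then have "t * ln n \<le> ln k" using large(1) by (simp add: ln_powr)
      moreover have "t * ln (ln T) \<le> t * ln n"
      proof (intro mult_left_mono)
        have "ln T \<le> real n" "1 < ln T" using large(4) ln_ln_pos[OF T(1)] by (simp_all add: T_def)
        then show "ln (ln T) \<le> ln n" by (subst ln_le_cancel_iff; linarith)
      qed (rule t(1))
      ultimately have "t \<le> ln k / ln (ln T)" using ln_ln_pos[OF T(1)] by (subst pos_le_divide_eq) auto
      then show "\<exists>T\<ge>B. t \<le> ln (rth_min_scaled 1 \<xi> T \<alpha>) / ln (ln T)"
        using T(2) unfolding k_def by blast
    qed
  qed
qed

end

theorem corollary1p3:
  fixes \<xi> :: real
  assumes "diophantine_type \<xi>"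
  shows "(AE \<alpha> in lebesgue_on {0..<1}.
            Limsup at_top (\<lambda>T::real. ereal (- ln (rth_min_scaled 1 \<xi> T \<alpha>) / ln (ln T))) = 1 \<and>
            (\<forall>r\<ge>2. Limsup at_top
               (\<lambda>T::real. ereal (- ln (rth_min_scaled r \<xi> T \<alpha>) / ln (ln T))) = ereal (1 / 2))) \<and>
         (AE \<alpha> in lebesgue_on {0..<1}.
            Limsup at_top (\<lambda>T::real. ereal (ln (rth_min_scaled 1 \<xi> T \<alpha>) / ln (ln T))) = 1)"
proof -
  obtain M c where "2 \<le> M" "0 < c"
    "\<forall>p::int. \<forall>q::nat. 1 \<le> q \<longrightarrow> c / real q powr M \<le> \<bar>\<xi> - of_int p / real q\<bar>"
    using assms unfolding diophantine_type_def by blast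
  then interpret diophantine \<xi> M c by unfold_locales auto
  define k where "k = (\<lambda>r \<alpha> T. rth_min_scaled r \<xi> T \<alpha>)"
  have e: "0 < 1 / real (Suc j)" "1 / real (Suc j) \<le> 1" for j by simp_all
  have first_le: "AE \<alpha> in circ. \<forall>j. eventually (\<lambda>T. - ln (k 1 \<alpha> T) / ln (ln T) \<le> 1 + 1 / real (Suc j)) at_top"
    unfolding AE_all_countable k_def using e by (intro allI AE_first_min_exponent_le) simp
  have first_ge: "AE \<alpha> in circ. \<forall>j. frequently (\<lambda>T. 1 - 1 / real (Suc j) \<le> - ln (k 1 \<alpha> T) / ln (ln T)) at_top"
    unfolding AE_all_countable k_def using e by (intro allI AE_first_min_exponent_ge) simp_all
  have second_le: "AE \<alpha> in circ. \<forall>j. \<forall>r\<ge>2. eventually (\<lambda>T. - ln (k r \<alpha> T) / ln (ln T) \<le> 1 / 2 + 1 / real (Suc j)) at_top"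
    unfolding k_def using e by (subst AE_all_countable, intro allI AE_second_min_exponent_le) simp
  have second_ge: "AE \<alpha> in circ. \<forall>j. \<forall>r\<ge>1. frequently (\<lambda>T. max 0 (1 / 2 - 1 / real (Suc j)) \<le> - ln (k r \<alpha> T) / ln (ln T)) at_top"
    unfolding k_def using e by (subst AE_all_countable, intro allI AE_rth_min_exponent_ge) (simp_all add: max_def)
  have large_le: "AE \<alpha> in circ. \<forall>j. eventually (\<lambda>T. ln (k 1 \<alpha> T) / ln (ln T) \<le> 1 + 1 / real (Suc j)) at_top"
    unfolding AE_all_countable k_def using e not_int by (intro allI AE_large_first_min_exponent_le) simp_all
  have large_ge: "AE \<alpha> in circ. \<forall>j. frequently (\<lambda>T. 1 - 1 / real (Suc j) \<le> ln (k 1 \<alpha> T) / ln (ln T)) at_top"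
    unfolding AE_all_countable k_def using e by (intro allI AE_large_first_min_exponent_ge) simp_all
  have "AE \<alpha> in circ. Limsup at_top (\<lambda>T. ereal (- ln (k 1 \<alpha> T) / ln (ln T))) = 1 \<and>
      (\<forall>r\<ge>2. Limsup at_top (\<lambda>T. ereal (- ln (k r \<alpha> T) / ln (ln T))) = ereal (1 / 2))"
    using first_le first_ge second_le second_ge
  proof eventually_elim
    case (elim \<alpha>)
    have "Limsup at_top (\<lambda>T. ereal (- ln (k 1 \<alpha> T) / ln (ln T))) = ereal 1"
      using elim(1,2) by (intro Limsup_at_top_eqI) auto
    moreover have "Limsup at_top (\<lambda>T. ereal (- ln (k r \<alpha> T) / ln (ln T))) = ereal (1 / 2)" if r: "2 \<le> r" for r
    proof (rule Limsup_at_top_eqI)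
      fix j :: nat
      show "eventually (\<lambda>T. - ln (k r \<alpha> T) / ln (ln T) \<le> 1 / 2 + 1 / real (Suc j)) at_top"
        using elim(3) r by blast
      have "frequently (\<lambda>T. max 0 (1 / 2 - 1 / real (Suc j)) \<le> - ln (k r \<alpha> T) / ln (ln T)) at_top"
        using elim(4) r by simp
      then show "frequently (\<lambda>T. 1 / 2 - 1 / real (Suc j) \<le> - ln (k r \<alpha> T) / ln (ln T)) at_top"
        by (rule frequently_elim1) simp
    qed
    ultimately show ?case by (simp add: one_ereal_def)
  qed
  moreover have "AE \<alpha> in circ. Limsup at_top (\<lambda>T. ereal (ln (k 1 \<alpha> T) / ln (ln T))) = 1"
    using large_le large_ge
  proof eventually_elim
    case (elim \<alpha>)
    then have "Limsup at_top (\<lambda>T. ereal (ln (k 1 \<alpha> T) / ln (ln T))) = ereal 1"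
      by (intro Limsup_at_top_eqI) auto
    then show ?case by (simp add: one_ereal_def)
  qed
  ultimately show ?thesis
    unfolding k_def by (intro conjI AE_lebesgue_on_of_circ)
qed

end
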